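(* Let $f$ be a time bound that is time-constructible and quasihomogeneous. If $\mathrm{DTIME}_b(f)\neq\mathrm{DTIME}(f)$ for every $b\in\mathbb{N}$, then $\mathrm{DTIME}(f)\neq\mathrm{NTIME}(f)$.
   Context: A time bound is a function $f:\mathbb{N}\to\mathbb{N}$ with $n\le f(n)\le f(n+1)$ for all $n\in\mathbb{N}$. Turing machines (deterministic: DTM; nondeterministic: NTM) have a separate read-only input tape and some number $b\in\mathbb{N}$ of work tapes ("$b$-tape" machines). For a time bound $f$, $\mathrm{DTIME}(f)$ (resp. $\mathrm{NTIME}(f)$) is the class of languages $L\subseteq\{0,1\}^*$ accepted by some DTM (resp. NTM) $\mathfrak{M}$ whose time complexity $t_{\mathfrak{M}}$ lies in $O(f)$; $\mathrm{DTIME}_b(f)$ is defined the same way using only $b$-tape DTMs. A time bound $g$ is time-constructible if some DTM, on every input $w$, writes $1^{g(|w|)}$ on one of its work tapes and halts within $O(g(|w|))$ steps. A function $f:\mathbb{N}\to\mathbb{N}$ is subhomogeneous if for every $c\in\mathbb{N}_{+}$ there is $\bar c\in\mathbb{N}_{+}$ with $f(cn)\le \bar c\, f(n)$ for all $n\in\mathbb{N}_{+}$; superhomogeneous if for every $c\in\mathbb{N}_{+}$ there is $c'\in\mathbb{N}_{+}$ with $c\,f(n)\le f(c'n)$ for all $n\in\mathbb{N}_{+}$; quasihomogeneous if it is both. *)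

theory Defs
  imports Complex_Main "HOL-Library.Extended_Nat" "HOL-Library.Landau_Symbols"
begin

datatype direction = MoveL | Stay | MoveR

datatype input_symbol = LeftEnd | RightEnd | In bool

text \<open>The work alphabet of a machine is a finite set of these symbols; \<^term>\<open>Aux\<close> supplies
  arbitrarily many symbols besides the blank and the two bits.\<close>
datatype symbol = Blank | Bit bool | Aux nat

text \<open>A nondeterministic machine with \<^term>\<open>tapes M\<close> work tapes. The transition function maps a
  state, the scanned input symbol and the scanned work symbols (one per work tape) to a set of
  possible actions: a new state, a move of the input head, and a symbol to write together with a
  move for every work tape. A machine halts when no action is possible.\<close>
record ntm =
  tapes :: nat
  states :: "nat set"
  alphabet :: "symbol set"
  start :: nat
  accepting :: "nat set"
  delta :: "nat \<Rightarrow> input_symbol \<Rightarrow> symbol list \<Rightarrow> (nat \<times> direction \<times> (symbol \<times> direction) list) set"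

definition scannable :: "ntm \<Rightarrow> symbol list set" where
  "scannable M = {ss. length ss = tapes M \<and> set ss \<subseteq> alphabet M}"

definition is_NTM :: "ntm \<Rightarrow> bool" where
  "is_NTM M \<longleftrightarrow>
     finite (states M) \<and> finite (alphabet M) \<and> Blank \<in> alphabet M \<and>
     start M \<in> states M \<and> accepting M \<subseteq> states M \<and>
     (\<forall>q\<in>states M. \<forall>a. \<forall>ss\<in>scannable M. \<forall>(q', d, as)\<in>delta M q a ss.
        q' \<in> states M \<and> length as = tapes M \<and> fst ` set as \<subseteq> alphabet M)"

definition is_DTM :: "ntm \<Rightarrow> bool" where
  "is_DTM M \<longleftrightarrow> is_NTM M \<and>
     (\<forall>q\<in>states M. \<forall>a. \<forall>ss\<in>scannable M. \<forall>x\<in>delta M q a ss. \<forall>y\<in>delta M q a ss. x = y)"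

text \<open>A work tape is infinite in both directions; it is given by its contents and the position of
  its head. A configuration consists of the state, the position of the input head, and the work
  tapes.\<close>
type_synonym tape = "(int \<Rightarrow> symbol) \<times> int"

type_synonym config = "nat \<times> nat \<times> tape list"

fun scan :: "tape \<Rightarrow> symbol" where
  "scan (t, h) = t h"

fun act :: "tape \<Rightarrow> symbol \<times> direction \<Rightarrow> tape" where
  "act (t, h) (s, d) = (t(h := s), case d of MoveL \<Rightarrow> h - 1 | Stay \<Rightarrow> h | MoveR \<Rightarrow> h + 1)"

text \<open>The input word occupies the cells 1 to \<^term>\<open>length w\<close> of the input tape, between the end
  markers in cells 0 and \<^term>\<open>length w + 1\<close>. The input head cannot leave this segment: a move
  beyond an end marker has no effect.\<close>
definition input_at :: "bool list \<Rightarrow> nat \<Rightarrow> input_symbol" where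
  "input_at w i =
     (if i = 0 then LeftEnd else if i \<le> length w then In (w ! (i - 1)) else RightEnd)"

definition move_input :: "bool list \<Rightarrow> direction \<Rightarrow> nat \<Rightarrow> nat" where
  "move_input w d i =
     (case d of MoveL \<Rightarrow> i - 1 | Stay \<Rightarrow> i | MoveR \<Rightarrow> min (i + 1) (length w + 1))"

definition initial :: "ntm \<Rightarrow> config" where
  "initial M = (start M, 0, replicate (tapes M) (\<lambda>_. Blank, 0))"

inductive step :: "ntm \<Rightarrow> bool list \<Rightarrow> config \<Rightarrow> config \<Rightarrow> bool" for M w where
  "(q', d, as) \<in> delta M q (input_at w i) (map scan ts) \<Longrightarrow>
     step M w (q, i, ts) (q', move_input w d i, map2 act ts as)"

definition halts_in :: "ntm \<Rightarrow> bool list \<Rightarrow> config \<Rightarrow> bool" where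
  "halts_in M w c \<longleftrightarrow> (step M w)\<^sup>*\<^sup>* (initial M) c \<and> (\<nexists>c'. step M w c c')"

definition language :: "ntm \<Rightarrow> bool list set" where
  "language M = {w. \<exists>q i ts. halts_in M w (q, i, ts) \<and> q \<in> accepting M}"

text \<open>The maximal number of steps over all (partial) computations on inputs of length \<^term>\<open>n\<close>; it
  is infinite iff some such input admits a nonterminating computation.\<close>
definition time_complexity :: "ntm \<Rightarrow> nat \<Rightarrow> enat" where
  "time_complexity M n =
     Sup {enat k | k. \<exists>w c. length w = n \<and> (step M w ^^ k) (initial M) c}"

definition runs_in_time_O :: "ntm \<Rightarrow> (nat \<Rightarrow> nat) \<Rightarrow> bool" where
  "runs_in_time_O M f \<longleftrightarrow>
     (\<exists>t. (\<forall>n. time_complexity M n = enat (t n)) \<and>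
          (\<lambda>n. real (t n)) \<in> O(\<lambda>n. real (f n)))"

definition DTIME :: "(nat \<Rightarrow> nat) \<Rightarrow> bool list set set" where
  "DTIME f = {L. \<exists>M. is_DTM M \<and> language M = L \<and> runs_in_time_O M f}"

definition NTIME :: "(nat \<Rightarrow> nat) \<Rightarrow> bool list set set" where
  "NTIME f = {L. \<exists>M. is_NTM M \<and> language M = L \<and> runs_in_time_O M f}"

definition DTIME_b :: "nat \<Rightarrow> (nat \<Rightarrow> nat) \<Rightarrow> bool list set set" where
  "DTIME_b b f = {L. \<exists>M. is_DTM M \<and> tapes M = b \<and> language M = L \<and> runs_in_time_O M f}"

definition time_bound :: "(nat \<Rightarrow> nat) \<Rightarrow> bool" where
  "time_bound f \<longleftrightarrow> (\<forall>n. n \<le> f n \<and> f n \<le> f (n + 1))"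

text \<open>The tape holds \<open>1\<^sup>m\<close>, starting at an arbitrary cell, and is blank elsewhere.\<close>
definition holds_ones :: "tape \<Rightarrow> nat \<Rightarrow> bool" where
  "holds_ones T m \<longleftrightarrow>
     (\<exists>p. \<forall>x. fst T x = (if p \<le> x \<and> x < p + int m then Bit True else Blank))"

definition time_constructible :: "(nat \<Rightarrow> nat) \<Rightarrow> bool" where
  "time_constructible g \<longleftrightarrow>
     (\<exists>M j. is_DTM M \<and> j < tapes M \<and> runs_in_time_O M g \<and>
        (\<forall>w q i ts. halts_in M w (q, i, ts) \<longrightarrow> holds_ones (ts ! j) (g (length w))))"

definition subhomogeneous :: "(nat \<Rightarrow> nat) \<Rightarrow> bool" where
  "subhomogeneous f \<longleftrightarrow> (\<forall>c>0. \<exists>c'>0. \<forall>n>0. f (c * n) \<le> c' * f n)"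

definition superhomogeneous :: "(nat \<Rightarrow> nat) \<Rightarrow> bool" where
  "superhomogeneous f \<longleftrightarrow> (\<forall>c>0. \<exists>c'>0. \<forall>n>0. c * f n \<le> f (c' * n))"

definition quasihomogeneous :: "(nat \<Rightarrow> nat) \<Rightarrow> bool" where
  "quasihomogeneous f \<longleftrightarrow> subhomogeneous f \<and> superhomogeneous f"

end

theory Submission
  imports Defs "HOL-Library.Nat_Bijection" "HOL-Library.Countable"
begin

text \<open>Suppose \<open>DTIME f = NTIME f\<close>. A single nondeterministic machine with a fixed number of tapes
  simulates every machine in linear time, with a constant depending on the simulated machine: it
  guesses the whole sequence of transitions and then checks this transcript against the tapes one
  after the other, so that the work space of one check can be buried and reused in the next
  (Book, Greibach and Wegbreit). Cut off after \<open>O(f)\<close> steps by a clock, it accepts a language in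
  \<open>NTIME f = DTIME f\<close>, hence some deterministic machine \<open>D\<close> with \<open>b\<close> tapes accepts it in time \<open>O(f)\<close>.
  A machine \<open>M\<close> running in time \<open>O(f)\<close> is reduced to this language by replacing each input
  symbol and each end marker by a block of constant length, with the program of \<open>M\<close> in the last
  block; superhomogeneity provides a block length for which the clock suffices. On such inputs \<open>D\<close>
  can be run without an additional tape, by keeping the position inside a block in the finite
  control, and by subhomogeneity this takes time \<open>O(f)\<close>. So \<open>DTIME f\<close> equals \<open>DTIME_b b f\<close>.\<close>

section \<open>Machines and running times\<close>

text \<open>The constants have to be chosen without a circle. The universal machine finds its next
  rule by walking along the input, so the cost of a simulated step is governed by the length of the
  rule table. The table is therefore a contiguous stretch behind the part that loads the input, its
  rules are not padded, and its length is known before the block length. It determines the constant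
  \<open>K\<close> of the simulation, \<open>K\<close> determines the factor that superhomogeneity
  assigns to \<open>2 * K\<close>, and only then is the block length \<open>m\<close> fixed. The
  clock grants \<open>2 * f (length w)\<close> steps: one share pays for the single pass over the
  encoded input, the other for the simulation. The budget matters for completeness alone;
  conversely, any accepting computation of the universal machine, of whatever length, proves that
  the simulated machine accepts. Five tapes are enough: one stack for the control state, two for the
  transcript, two for the halves of the tape under inspection. A stack cannot be tested for
  emptiness, which is the reason for the markers \<open>Bot\<close>.\<close>

lemma relpowp_simulation:
  assumes sim: "\<And>c c' d. R c d \<Longrightarrow> S c c' \<Longrightarrow> \<exists>d'. S' d d' \<and> R c' d'"
    and "R c d" and "(S ^^ k) c c'"
  shows "\<exists>d'. (S' ^^ k) d d' \<and> R c' d'"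
  using assms(3)
proof (induction k arbitrary: c')
  case 0
  then show ?case using assms(2) by auto
next
  case (Suc k)
  then obtain b where "(S ^^ k) c b" "S b c'"
    by auto
  with Suc.IH sim show ?case
    by (metis relpowp_Suc_I)
qed

lemma relpowp_rtranclp: "(S ^^ k) c c' \<Longrightarrow> S\<^sup>*\<^sup>* c c'"
  by (metis rtranclp_power)

abbreviation runs :: "ntm \<Rightarrow> bool list \<Rightarrow> nat \<Rightarrow> config \<Rightarrow> bool" where
  "runs M w k \<equiv> (step M w ^^ k) (initial M)"

abbreviation reaches :: "ntm \<Rightarrow> bool list \<Rightarrow> config \<Rightarrow> bool" where
  "reaches M w \<equiv> (step M w)\<^sup>*\<^sup>* (initial M)"

text \<open>Nothing is known about \<open>delta\<close> on states or symbols foreign to the machine;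
  this invariant keeps computations inside the part that \<open>is_NTM\<close> controls.\<close>

definition well_formed :: "ntm \<Rightarrow> config \<Rightarrow> bool" where
  "well_formed M c = (case c of (q, i, ts) \<Rightarrow>
     q \<in> states M \<and> length ts = tapes M \<and> (\<forall>T\<in>set ts. range (fst T) \<subseteq> alphabet M))"

lemma scan_in_alphabet: "range (fst T) \<subseteq> A \<Longrightarrow> scan T \<in> A"
  by (cases T) auto

lemma well_formed_scannable:
  "well_formed M (q, i, ts) \<Longrightarrow> map scan ts \<in> scannable M"
  unfolding well_formed_def scannable_def using scan_in_alphabet by fastforce

lemma well_formed_initial: "is_NTM M \<Longrightarrow> well_formed M (initial M)"
  unfolding well_formed_def initial_def is_NTM_def by auto

lemma range_act: "range (fst T) \<subseteq> A \<Longrightarrow> fst x \<in> A \<Longrightarrow> range (fst (act T x)) \<subseteq> A"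
  by (cases T; cases x) auto

lemma is_NTM_deltaD:
  assumes "is_NTM M" "q \<in> states M" "ss \<in> scannable M" "(q', d, as) \<in> delta M q a ss"
  shows "q' \<in> states M" "length as = tapes M" "fst ` set as \<subseteq> alphabet M"
  using assms unfolding is_NTM_def by fastforce+

lemma well_formed_step:
  assumes "is_NTM M" "step M w c c'" "well_formed M c"
  shows "well_formed M c'"
  using assms(2)
proof cases
  case (1 q' d as q i ts)
  have sc: "map scan ts \<in> scannable M"
    using assms(3) 1 well_formed_scannable by blast
  have q: "q \<in> states M" "length ts = tapes M" "\<forall>T\<in>set ts. range (fst T) \<subseteq> alphabet M"
    using assms(3) 1 unfolding well_formed_def by auto
  note D = is_NTM_deltaD[OF assms(1) q(1) sc 1(3)]
  have "range (fst T) \<subseteq> alphabet M" if T: "T \<in> set (map2 act ts as)" for T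
  proof -
    obtain t x where "T = act t x" "t \<in> set ts" "x \<in> set as"
      using T by (fastforce dest: set_zip_leftD set_zip_rightD)
    then show ?thesis
      using range_act[of t "alphabet M" x] q(3) D(3) by blast
  qed
  then show ?thesis
    unfolding well_formed_def 1 using D q by auto
qed

lemma well_formed_reachable:
  assumes "is_NTM M" "runs M w k c"
  shows "well_formed M c"
  using assms(2)
proof (induction k arbitrary: c)
  case 0
  then show ?case using well_formed_initial[OF assms(1)] by auto
next
  case (Suc k)
  then obtain b where "runs M w k b" "step M w b c" by auto
  then show ?case using well_formed_step[OF assms(1)] Suc.IH by blast
qed

section \<open>Running times as bounds valid for every length\<close>

lemma bigo_nat_linear_bound:
  fixes t f :: "nat \<Rightarrow> nat"
  assumes "(\<lambda>n. real (t n)) \<in> O(\<lambda>n. real (f n))"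
  shows "\<exists>c. \<forall>n. t n \<le> c * f n + c"
proof -
  obtain c where "c > 0" "\<forall>\<^sub>F n in sequentially. norm (real (t n)) \<le> c * norm (real (f n))"
    using landau_o.bigE[OF assms] by blast
  then obtain n0 where n0: "\<And>n. n \<ge> n0 \<Longrightarrow> real (t n) \<le> c * real (f n)"
    by (auto simp: eventually_sequentially)
  \<comment> \<open>The factor serves the lengths from \<open>n0\<close> on, the additive constant
    the finitely many others.\<close>
  define C where "C = max (nat \<lceil>c\<rceil>) (Max (t ` {..n0}))"
  have "t n \<le> C * f n + C" for n
  proof (cases "n \<ge> n0")
    case True
    have "real (t n) \<le> c * real (f n)" using n0[OF True] .
    also have "\<dots> \<le> real (nat \<lceil>c\<rceil>) * real (f n)"
      by (intro mult_right_mono) linarith+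
    finally have "t n \<le> nat \<lceil>c\<rceil> * f n"
      by (metis of_nat_le_iff of_nat_mult)
    also have "\<dots> \<le> C * f n" unfolding C_def by simp
    finally show ?thesis by simp
  next
    case False
    then have "t n \<le> Max (t ` {..n0})" by (intro Max_ge) auto
    then show ?thesis unfolding C_def by simp
  qed
  then show ?thesis by blast
qed

text \<open>A bound on all partial computations also forces termination, hence a finite
  \<open>time_complexity\<close>. The additive \<open>c\<close> covers the exceptional lengths and a
  possible \<open>f 0 = 0\<close>; conversely it is absorbed for \<open>n \<ge> 1\<close>, because
  then \<open>f n \<ge> n \<ge> 1\<close>.\<close>

lemma runs_in_time_O_iff:
  assumes "time_bound f"
  shows "runs_in_time_O M f \<longleftrightarrow>
    (\<exists>c. \<forall>w k e. runs M w k e \<longrightarrow> k \<le> c * f (length w) + c)"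
proof
  assume "runs_in_time_O M f"
  then obtain t where t: "\<And>n. time_complexity M n = enat (t n)"
    and O: "(\<lambda>n. real (t n)) \<in> O(\<lambda>n. real (f n))"
    unfolding runs_in_time_O_def by blast
  obtain c where c: "\<And>n. t n \<le> c * f n + c"
    using bigo_nat_linear_bound[OF O] by blast
  have "k \<le> t (length w)" if "runs M w k e" for w k e
  proof -
    have "enat k \<le> time_complexity M (length w)"
      unfolding time_complexity_def by (rule Sup_upper) (use that in blast)
    then show ?thesis by (simp add: t)
  qed
  with c show "\<exists>c. \<forall>w k e. runs M w k e \<longrightarrow> k \<le> c * f (length w) + c"
    by (meson order_trans)
next
  assume "\<exists>c. \<forall>w k e. runs M w k e \<longrightarrow> k \<le> c * f (length w) + c"
  then obtain c where c: "\<And>w k e. runs M w k e \<Longrightarrow> k \<le> c * f (length w) + c"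
    by blast
  have le: "time_complexity M n \<le> enat (c * f n + c)" for n
    unfolding time_complexity_def by (rule Sup_least) (auto dest: c)
  then have fin: "time_complexity M n \<noteq> \<infinity>" for n
    by (metis enat_ord_simps(5) not_infinity_eq)
  define t where "t n = the_enat (time_complexity M n)" for n
  have t: "time_complexity M n = enat (t n)" for n
    using fin[of n] unfolding t_def by auto
  have "t n \<le> c * f n + c" for n
    using le[of n] unfolding t by simp
  moreover have "f n \<ge> 1" if "n \<ge> 1" for n
    using that assms unfolding time_bound_def by (meson le_trans)
  ultimately have "norm (real (t n)) \<le> real (2 * c) * norm (real (f n))" if "n \<ge> 1" for n
  proof -
    have "t n \<le> c * f n + c * f n"
      using \<open>\<And>n. t n \<le> c * f n + c\<close>[of n]
        mult_le_mono2[OF \<open>\<And>n. n \<ge> 1 \<Longrightarrow> f n \<ge> 1\<close>[OF that], of c] by linarith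
    then have "t n \<le> (2 * c) * f n" by simp
    then have "real (t n) \<le> real ((2 * c) * f n)" by (simp only: of_nat_le_iff)
    then show ?thesis by simp
  qed
  then have "(\<lambda>n. real (t n)) \<in> O(\<lambda>n. real (f n))"
    by (intro bigoI[where c = "real (2 * c)"]) (auto simp: eventually_sequentially)
  with t show "runs_in_time_O M f"
    unfolding runs_in_time_O_def by blast
qed

section \<open>Inverse images under block codes\<close>

text \<open>The end markers get blocks of their own, so the encoded word can carry a fixed suffix:
  the block of \<open>RightEnd\<close> will hold the program.\<close>

definition block_input :: "(input_symbol \<Rightarrow> bool list) \<Rightarrow> bool list \<Rightarrow> bool list" where
  "block_input blk x = concat (map blk (LeftEnd # map In x @ [RightEnd]))"

text \<open>Offsets 1 to \<open>m\<close> address the bits of the block of the scanned cell; 0 and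
  \<open>m + 1\<close> stand for the end markers of the encoded word.\<close>

definition virtual_symbol :: "(input_symbol \<Rightarrow> bool list) \<Rightarrow> nat \<Rightarrow> input_symbol \<Rightarrow> nat \<Rightarrow> input_symbol" where
  "virtual_symbol blk m a r =
     (if r = 0 then LeftEnd else if r = m + 1 then RightEnd else In (blk a ! (r - 1)))"

text \<open>The real head moves only when the virtual one crosses a block boundary, so every step of
  \<open>D\<close> is matched by exactly one step.\<close>

definition virtual_move :: "nat \<Rightarrow> input_symbol \<Rightarrow> nat \<Rightarrow> direction \<Rightarrow> nat \<times> direction" where
  "virtual_move m a r d = (case d of
     Stay \<Rightarrow> (r, Stay)
   | MoveR \<Rightarrow> if r = m + 1 then (r, Stay) else if r < m then (r + 1, Stay)
       else if a = RightEnd then (m + 1, Stay) else (1, MoveR)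
   | MoveL \<Rightarrow> if r = 0 then (0, Stay) else if r > 1 then (r - 1, Stay)
       else if a = LeftEnd then (0, Stay) else (m, MoveL))"

definition pull_back :: "ntm \<Rightarrow> (input_symbol \<Rightarrow> bool list) \<Rightarrow> nat \<Rightarrow> ntm" where
  "pull_back D blk m = \<lparr>
     tapes = tapes D,
     states = prod_encode ` (states D \<times> {..m + 1}),
     alphabet = alphabet D,
     start = prod_encode (start D, 0),
     accepting = prod_encode ` (accepting D \<times> {..m + 1}),
     delta = \<lambda>p a ss. case prod_decode p of (q, r) \<Rightarrow>
       (\<lambda>(q', d, as). (prod_encode (q', fst (virtual_move m a r d)), snd (virtual_move m a r d), as)) `
         delta D q (virtual_symbol blk m a r) ss\<rparr>"

lemma pull_back_simps [simp]:
  "tapes (pull_back D blk m) = tapes D"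
  "alphabet (pull_back D blk m) = alphabet D"
  "start (pull_back D blk m) = prod_encode (start D, 0)"
  "states (pull_back D blk m) = prod_encode ` (states D \<times> {..m + 1})"
  "accepting (pull_back D blk m) = prod_encode ` (accepting D \<times> {..m + 1})"
  "scannable (pull_back D blk m) = scannable D"
  by (auto simp: pull_back_def scannable_def)

lemma pull_back_delta:
  "delta (pull_back D blk m) (prod_encode (q, r)) a ss =
     (\<lambda>(q', d, as). (prod_encode (q', fst (virtual_move m a r d)), snd (virtual_move m a r d), as)) `
         delta D q (virtual_symbol blk m a r) ss"
  by (simp add: pull_back_def)

lemma virtual_move_le: "m > 0 \<Longrightarrow> r \<le> m + 1 \<Longrightarrow> fst (virtual_move m a r d) \<le> m + 1"
  by (auto simp: virtual_move_def split: direction.splits)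

lemma is_NTM_pull_back:
  assumes "is_NTM D" "m > 0"
  shows "is_NTM (pull_back D blk m)"
  unfolding is_NTM_def
proof (intro conjI ballI allI)
  fix p a ss x
  assume p: "p \<in> states (pull_back D blk m)" and ss: "ss \<in> scannable (pull_back D blk m)"
    and x: "x \<in> delta (pull_back D blk m) p a ss"
  from p obtain q r where qr: "p = prod_encode (q, r)" "q \<in> states D" "r \<le> m + 1"
    by auto
  from x obtain q' d as where y: "(q', d, as) \<in> delta D q (virtual_symbol blk m a r) ss"
    "x = (prod_encode (q', fst (virtual_move m a r d)), snd (virtual_move m a r d), as)"
    by (auto simp: qr(1) pull_back_delta)
  have ss': "ss \<in> scannable D" using ss by simp
  show "case x of (q', d, as) \<Rightarrow> q' \<in> states (pull_back D blk m) \<and>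
      length as = tapes (pull_back D blk m) \<and> fst ` set as \<subseteq> alphabet (pull_back D blk m)"
    using is_NTM_deltaD[OF assms(1) qr(2) ss' y(1)] virtual_move_le[OF assms(2) qr(3)]
    by (auto simp: y(2))
qed (use assms in \<open>auto simp: is_NTM_def\<close>)

lemma is_DTM_pull_back:
  assumes "is_DTM D" "m > 0"
  shows "is_DTM (pull_back D blk m)"
proof -
  have N: "is_NTM D" using assms unfolding is_DTM_def by blast
  have U: "x = y" if "q \<in> states D" "ss \<in> scannable D" "x \<in> delta D q a ss" "y \<in> delta D q a ss"
    for q a ss x y
    using assms that unfolding is_DTM_def by blast
  show ?thesis
    unfolding is_DTM_def
  proof (intro conjI ballI allI)
    fix p a ss x y
    assume p: "p \<in> states (pull_back D blk m)" and ss: "ss \<in> scannable (pull_back D blk m)"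
      and x: "x \<in> delta (pull_back D blk m) p a ss"
      and y: "y \<in> delta (pull_back D blk m) p a ss"
    from p obtain q r where "p = prod_encode (q, r)" "q \<in> states D"
      by auto
    moreover have "ss \<in> scannable D" using ss by simp
    ultimately obtain x0 y0 where "x0 \<in> delta D q (virtual_symbol blk m a r) ss"
      "y0 \<in> delta D q (virtual_symbol blk m a r) ss"
      "x = (\<lambda>(q', d, as). (prod_encode (q', fst (virtual_move m a r d)), snd (virtual_move m a r d), as)) x0"
      "y = (\<lambda>(q', d, as). (prod_encode (q', fst (virtual_move m a r d)), snd (virtual_move m a r d), as)) y0"
      using x y by (auto simp only: pull_back_delta image_iff)
    moreover have "x0 = y0"
      using U \<open>q \<in> states D\<close> \<open>ss \<in> scannable D\<close> calculation by blast
    ultimately show "x = y" by simp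
  qed (use is_NTM_pull_back[OF N assms(2)] in auto)
qed

section \<open>Step-by-step correspondence between a machine and its pull-back\<close>

locale block_code =
  fixes blk :: "input_symbol \<Rightarrow> bool list" and m :: nat
  assumes length_blk: "\<And>a. length (blk a) = m" and m_pos: "m > 0"
begin

lemma length_concat_blk: "length (concat (map blk as)) = m * length as"
  by (induction as) (auto simp: length_blk)

lemma nth_concat_blk:
  "i < length as \<Longrightarrow> r < m \<Longrightarrow> concat (map blk as) ! (m * i + r) = blk (as ! i) ! r"
proof (induction as arbitrary: i)
  case (Cons a as)
  show ?case
  proof (cases i)
    case 0
    then show ?thesis using Cons by (auto simp: nth_append length_blk)
  next
    case (Suc k)
    then show ?thesis using Cons by (auto simp: nth_append length_blk)
  qed
qed auto

lemma length_block_input: "length (block_input blk x) = m * (length x + 2)"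
  unfolding block_input_def by (subst length_concat_blk) simp

lemma nth_markers:
  "i \<le> length x + 1 \<Longrightarrow> (LeftEnd # map In x @ [RightEnd]) ! i = input_at x i"
  by (auto simp: input_at_def nth_Cons' nth_append)

text \<open>The virtual head is on cell \<open>m * i + r\<close>. Without the last two conditions
  this description would be ambiguous: offset 0 of a block is the same cell as offset
  \<open>m\<close> of the block before it.\<close>

definition valid_position :: "bool list \<Rightarrow> nat \<Rightarrow> nat \<Rightarrow> bool" where
  "valid_position x i r \<longleftrightarrow> i \<le> length x + 1 \<and> r \<le> m + 1 \<and> (r = 0 \<longrightarrow> i = 0) \<and>
     (r = m + 1 \<longrightarrow> i = length x + 1)"

lemma input_at_block_input:
  assumes "valid_position x i r"
  shows "input_at (block_input blk x) (m * i + r) = virtual_symbol blk m (input_at x i) r"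
proof -
  consider "r = 0" | "r = m + 1" | "0 < r" "r \<le> m"
    using assms unfolding valid_position_def by linarith
  then show ?thesis
  proof cases
    case 1
    then show ?thesis using assms
      by (auto simp: valid_position_def virtual_symbol_def input_at_def)
  next
    case 2
    then have "m * i + r > length (block_input blk x)"
      using assms by (auto simp: valid_position_def length_block_input)
    then show ?thesis using 2
      by (auto simp: virtual_symbol_def input_at_def)
  next
    case 3
    have i: "i < length (LeftEnd # map In x @ [RightEnd])" "i \<le> length x + 1"
      using assms by (auto simp: valid_position_def)
    have "m * i + r \<le> m * (i + 1)" using 3 by simp
    also have "\<dots> \<le> length (block_input blk x)"
      unfolding length_block_input using i by (intro mult_le_mono2) auto
    finally have "input_at (block_input blk x) (m * i + r) = In (block_input blk x ! (m * i + (r - 1)))"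
      using 3 by (auto simp: input_at_def)
    also have "block_input blk x ! (m * i + (r - 1)) = blk (input_at x i) ! (r - 1)"
      unfolding block_input_def using 3 i nth_markers[OF i(2)]
      by (subst nth_concat_blk) auto
    finally show ?thesis using 3 by (auto simp: virtual_symbol_def)
  qed
qed

lemma input_at_RightEnd: "i \<le> length x + 1 \<Longrightarrow> input_at x i = RightEnd \<longleftrightarrow> i = length x + 1"
  by (auto simp: input_at_def)

lemma input_at_LeftEnd: "input_at x i = LeftEnd \<longleftrightarrow> i = 0"
  by (auto simp: input_at_def)

lemma virtual_move_input:
  fixes x i r d
  defines "y \<equiv> virtual_move m (input_at x i) r d"
  assumes v: "valid_position x i r"
  shows "valid_position x (move_input x (snd y) i) (fst y)"
    and "move_input (block_input blk x) d (m * i + r) = m * move_input x (snd y) i + fst y"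
proof -
  have R: "input_at x i = RightEnd \<longleftrightarrow> i = length x + 1"
    using v by (intro input_at_RightEnd) (auto simp: valid_position_def)
  have i: "i \<le> length x + 1" "r \<le> m + 1" using v by (auto simp: valid_position_def)
  have mi: "m * i \<le> m * (length x + 1)" using i by (intro mult_le_mono2)
  have mi': "m * i + m \<le> m * (length x + 1)" if "i \<noteq> length x + 1"
  proof -
    have "m * (i + 1) \<le> m * (length x + 1)" using i that by (intro mult_le_mono2) auto
    then show ?thesis by simp
  qed
  have mi0: "\<exists>j. i = Suc j" if "i \<noteq> 0" using that by (cases i) auto
  show "valid_position x (move_input x (snd y) i) (fst y)"
    unfolding y_def using v m_pos R
    by (auto simp: valid_position_def virtual_move_def move_input_def input_at_LeftEnd split: direction.splits)
  show "move_input (block_input blk x) d (m * i + r) = m * move_input x (snd y) i + fst y"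
  proof (cases d)
    case MoveL
    then show ?thesis
      unfolding y_def using v m_pos mi0
      by (auto simp: valid_position_def virtual_move_def move_input_def input_at_LeftEnd)
  next
    case Stay
    then show ?thesis
      unfolding y_def by (auto simp: virtual_move_def move_input_def)
  next
    case MoveR
    then show ?thesis
      unfolding y_def using v m_pos R mi mi'
      by (auto simp: valid_position_def virtual_move_def move_input_def length_block_input min_def)
  qed
qed

definition pull_back_rel :: "bool list \<Rightarrow> config \<Rightarrow> config \<Rightarrow> bool" where
  "pull_back_rel x c d = (\<exists>q i r ts. valid_position x i r \<and>
     c = (q, m * i + r, ts) \<and> d = (prod_encode (q, r), i, ts))"

lemma pull_back_step:
  assumes "pull_back_rel x c d" "step D (block_input blk x) c c'"
  shows "\<exists>d'. step (pull_back D blk m) x d d' \<and> pull_back_rel x c' d'"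
proof -
  obtain q i r ts where c: "valid_position x i r" "c = (q, m * i + r, ts)"
    "d = (prod_encode (q, r), i, ts)"
    using assms(1) unfolding pull_back_rel_def by blast
  obtain q' e as where s: "(q', e, as) \<in> delta D q (virtual_symbol blk m (input_at x i) r) (map scan ts)"
    "c' = (q', move_input (block_input blk x) e (m * i + r), map2 act ts as)"
    using assms(2) by (auto simp: c(2) step.simps input_at_block_input[OF c(1)])
  let ?y = "virtual_move m (input_at x i) r e"
  have "step (pull_back D blk m) x d (prod_encode (q', fst ?y), move_input x (snd ?y) i, map2 act ts as)"
    unfolding c(3) by (intro step.intros) (use s(1) in \<open>force simp: pull_back_delta\<close>)
  then show ?thesis
    using virtual_move_input[OF c(1), of e] s(2) unfolding pull_back_rel_def by blast
qed

lemma pull_back_step_back: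
  assumes "pull_back_rel x c d" "step (pull_back D blk m) x d d'"
  shows "\<exists>c'. step D (block_input blk x) c c' \<and> pull_back_rel x c' d'"
proof -
  obtain q i r ts where c: "valid_position x i r" "c = (q, m * i + r, ts)"
    "d = (prod_encode (q, r), i, ts)"
    using assms(1) unfolding pull_back_rel_def by blast
  obtain q' e as where s: "(q', e, as) \<in> delta D q (virtual_symbol blk m (input_at x i) r) (map scan ts)"
    "d' = (prod_encode (q', fst (virtual_move m (input_at x i) r e)),
       move_input x (snd (virtual_move m (input_at x i) r e)) i, map2 act ts as)"
    using assms(2) by (auto simp: c(3) step.simps pull_back_delta)
  have "step D (block_input blk x) c (q', move_input (block_input blk x) e (m * i + r), map2 act ts as)"
    unfolding c(2) by (intro step.intros) (use s(1) in \<open>simp add: input_at_block_input[OF c(1)]\<close>)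
  then show ?thesis
    using virtual_move_input[OF c(1), of e] s(2) unfolding pull_back_rel_def by blast
qed

lemma pull_back_rel_initial: "pull_back_rel x (initial D) (initial (pull_back D blk m))"
  by (auto simp: pull_back_rel_def initial_def valid_position_def)

lemma pull_back_runs:
  assumes "runs (pull_back D blk m) x k d"
  shows "\<exists>c. runs D (block_input blk x) k c \<and> pull_back_rel x c d"
  by (rule relpowp_simulation[where R = "\<lambda>d c. pull_back_rel x c d", OF _ pull_back_rel_initial assms])
    (rule pull_back_step_back)

lemma pull_back_runs_back:
  assumes "runs D (block_input blk x) k c"
  shows "\<exists>d. runs (pull_back D blk m) x k d \<and> pull_back_rel x c d"
  by (rule relpowp_simulation[where R = "pull_back_rel x", OF _ pull_back_rel_initial assms])
    (rule pull_back_step)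

text \<open>Steps correspond in both directions, so that being halted is transferred along with
  acceptance.\<close>

lemma language_pull_back:
  "x \<in> language (pull_back D blk m) \<longleftrightarrow> block_input blk x \<in> language D"
proof
  assume "x \<in> language (pull_back D blk m)"
  then obtain d where d: "reaches (pull_back D blk m) x d"
    "\<nexists>d'. step (pull_back D blk m) x d d'" "fst d \<in> accepting (pull_back D blk m)"
    by (auto simp: language_def halts_in_def)
  obtain k where "runs (pull_back D blk m) x k d"
    using d(1) by (meson rtranclp_power)
  from pull_back_runs[OF this] obtain c where
    c: "runs D (block_input blk x) k c" "pull_back_rel x c d" by blast
  have "\<nexists>c'. step D (block_input blk x) c c'"
    using pull_back_step[OF c(2)] d(2) by blast
  moreover have "fst c \<in> accepting D"
    using c(2) d(3) by (auto simp: pull_back_rel_def)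
  ultimately show "block_input blk x \<in> language D"
    using relpowp_rtranclp[OF c(1)] by (cases c) (auto simp: language_def halts_in_def)
next
  assume "block_input blk x \<in> language D"
  then obtain c where c: "reaches D (block_input blk x) c"
    "\<nexists>c'. step D (block_input blk x) c c'" "fst c \<in> accepting D"
    by (auto simp: language_def halts_in_def)
  obtain k where "runs D (block_input blk x) k c"
    using c(1) by (meson rtranclp_power)
  from pull_back_runs_back[OF this] obtain d where
    d: "runs (pull_back D blk m) x k d" "pull_back_rel x c d"
    by blast
  have "\<nexists>d'. step (pull_back D blk m) x d d'"
    using pull_back_step_back[OF d(2)] c(2) by blast
  moreover have "fst d \<in> accepting (pull_back D blk m)"
    using d(2) c(3) by (auto simp: pull_back_rel_def valid_position_def)
  ultimately show "x \<in> language (pull_back D blk m)"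
    using relpowp_rtranclp[OF d(1)] by (cases d) (auto simp: language_def halts_in_def)
qed

end

section \<open>Clocked computations\<close>

lemma move_input_le: "i \<le> length w + 1 \<Longrightarrow> move_input w d i \<le> length w + 1"
  by (auto simp: move_input_def split: direction.splits)

lemma input_head_le:
  assumes "runs M w k c"
  shows "fst (snd c) \<le> length w + 1"
  using assms
proof (induction k arbitrary: c)
  case 0
  then show ?case by (auto simp: initial_def)
next
  case (Suc k)
  then obtain b where "runs M w k b" and s: "step M w b c" by auto
  then have "fst (snd b) \<le> length w + 1" using Suc.IH by blast
  with s show ?case using move_input_le by (fastforce simp: step.simps)
qed

text \<open>A step rewrites one cell per work tape. Hence a machine that ends with
  \<open>f n\<close> ones on a tape has made at least \<open>f n\<close> steps, and its number of
  steps can serve as the clock in place of the string it writes.\<close>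

lemma nonblank_cells_le_steps:
  assumes "is_NTM M" "runs M w k (q, i, ts)" "j < tapes M"
  shows "finite {x. fst (ts ! j) x \<noteq> Blank} \<and> card {x. fst (ts ! j) x \<noteq> Blank} \<le> k"
  using assms(2)
proof (induction k arbitrary: q i ts)
  case 0
  then show ?case using assms(3) by (auto simp: initial_def)
next
  case (Suc k)
  then obtain b where b: "runs M w k b" and s: "step M w b (q, i, ts)" by auto
  obtain q0 i0 ts0 where b_eq: "b = (q0, i0, ts0)" by (cases b)
  have wf: "well_formed M b" "well_formed M (q, i, ts)"
    using well_formed_reachable[OF assms(1)] b Suc.prems by blast+
  obtain as where ts: "ts = map2 act ts0 as"
    using s b_eq by (auto simp: step.simps)
  have len: "length ts0 = tapes M" "length ts = tapes M"
    using wf b_eq by (auto simp: well_formed_def)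
  have j: "j < length ts0" "j < length as" using len ts assms(3) by auto
  have "ts ! j = act (ts0 ! j) (as ! j)" using j ts by simp
  then have sub: "{x. fst (ts ! j) x \<noteq> Blank} \<subseteq>
      insert (snd (ts0 ! j)) {x. fst (ts0 ! j) x \<noteq> Blank}"
    by (cases "ts0 ! j"; cases "as ! j") auto
  have IH: "finite {x. fst (ts0 ! j) x \<noteq> Blank}" "card {x. fst (ts0 ! j) x \<noteq> Blank} \<le> k"
    using Suc.IH b b_eq by blast+
  then show ?case
    using finite_subset[OF sub] card_mono[OF _ sub] card_insert_le_m1
    by (smt (verit, best) Suc_le_mono card_insert_if finite_insert le_SucI le_trans)
qed

lemma card_holds_ones:
  assumes "holds_ones T m"
  shows "card {x. fst T x \<noteq> Blank} = m"
proof -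
  obtain p where p: "\<And>x. fst T x = (if p \<le> x \<and> x < p + int m then Bit True else Blank)"
    using assms unfolding holds_ones_def by blast
  have "{x. fst T x \<noteq> Blank} = {p..<p + int m}"
    by (auto simp: p)
  then show ?thesis by simp
qed

text \<open>Bounded run lengths have a maximum, and a run of maximal length cannot be
  continued.\<close>

lemma halting_run_exists:
  assumes "\<And>k c. runs M w k c \<Longrightarrow> k \<le> B"
  shows "\<exists>k c. runs M w k c \<and> (\<nexists>c'. step M w c c')"
proof -
  let ?P = "\<lambda>k. \<exists>c. runs M w k c"
  have "?P 0" by (metis relpowp_0_I)
  then have g: "?P (Greatest ?P)" using assms by (intro GreatestI_nat[of ?P 0 B]) auto
  then obtain c where c: "runs M w (Greatest ?P) c" by blast
  have "\<not> step M w c c'" for c'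
  proof
    assume "step M w c c'"
    with c have "?P (Suc (Greatest ?P))" by (meson relpowp_Suc_I)
    then have "Suc (Greatest ?P) \<le> Greatest ?P"
      using assms by (intro Greatest_le_nat[of ?P _ B]) auto
    then show False by simp
  qed
  with c show ?thesis by blast
qed

section \<open>Running one machine under a clock set by another\<close>

datatype clock_state = Timing nat | Rewinding | Running nat bool

instance clock_state :: countable
  by countable_datatype

definition hold :: "symbol list \<Rightarrow> (symbol \<times> direction) list" where
  "hold ss = map (\<lambda>s. (s, Stay)) ss"

lemma hold_simps [simp]:
  "hold [] = []" "hold (s # ss) = (s, Stay) # hold ss" "length (hold ss) = length ss"
  "hold (ss @ ss') = hold ss @ hold ss'" "fst ` set (hold ss) = set ss"
  by (auto simp: hold_def image_image)

lemma in_set_hold [simp]: "(s, d) \<in> set (hold ss) \<longleftrightarrow> s \<in> set ss \<and> d = Stay"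
  by (auto simp: hold_def)

lemma act_scan_Stay [simp]: "act T (scan T, Stay) = T"
  by (cases T) auto

lemma act_hold [simp]: "map2 act ts (hold (map scan ts)) = ts"
  by (induction ts) auto

lemma map2_append:
  "length xs = length ys \<Longrightarrow> map2 f (xs @ xs') (ys @ ys') = map2 f xs ys @ map2 f xs' ys'"
  by simp

text \<open>The first tape is the clock: it receives one mark per step of \<open>M\<close>. The
  Boolean in \<open>Running\<close> lets the clock head retreat at every second step only, so
  \<open>k\<close> marks grant \<open>2 * k\<close> steps of \<open>V\<close>. The tests for
  \<open>scannable\<close> are there because the tapes of both machines now share the larger
  alphabet, and nothing is known about \<open>M\<close> and \<open>V\<close> on symbols outside
  their own.\<close>

definition clocked :: "ntm \<Rightarrow> ntm \<Rightarrow> ntm" where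
  "clocked M V = \<lparr>
     tapes = Suc (tapes M + tapes V),
     states = to_nat ` (Timing ` states M \<union> {Rewinding} \<union> case_prod Running ` (states V \<times> UNIV)),
     alphabet = insert (Bit True) (alphabet M \<union> alphabet V),
     start = to_nat (Timing (start M)),
     accepting = to_nat ` case_prod Running ` (accepting V \<times> UNIV),
     delta = \<lambda>p a ss. (let us = take (tapes M) (tl ss); vs = drop (tapes M) (tl ss) in
       case from_nat p of
         Timing q \<Rightarrow>
           if us \<notin> scannable M then {}
           else if delta M q a us = {}
             then {(to_nat Rewinding, Stay, (hd ss, MoveL) # hold (us @ vs))}
           else (\<lambda>(q', d, as). (to_nat (Timing q'), d, (Bit True, MoveR) # as @ hold vs)) ` delta M q a us
       | Rewinding \<Rightarrow>
           if a = LeftEnd then {(to_nat (Running (start V) False), Stay, (hd ss, Stay) # hold (us @ vs))}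
           else {(to_nat Rewinding, MoveL, (hd ss, Stay) # hold (us @ vs))}
       | Running q b \<Rightarrow>
           if hd ss = Bit True \<and> vs \<in> scannable V
             then (\<lambda>(q', d, as). (to_nat (Running q' (\<not> b)), d,
                 (hd ss, if b then MoveL else Stay) # hold us @ as)) ` delta V q a vs
           else {})\<rparr>"

lemma clocked_simps [simp]:
  "tapes (clocked M V) = Suc (tapes M + tapes V)"
  "states (clocked M V) =
     to_nat ` (Timing ` states M \<union> {Rewinding} \<union> case_prod Running ` (states V \<times> UNIV))"
  "alphabet (clocked M V) = insert (Bit True) (alphabet M \<union> alphabet V)"
  "start (clocked M V) = to_nat (Timing (start M))"
  "accepting (clocked M V) = to_nat ` case_prod Running ` (accepting V \<times> UNIV)"
  by (auto simp: clocked_def)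

lemma clocked_delta:
  assumes "length us = tapes M"
  shows "delta (clocked M V) (to_nat (Timing q)) a (s # us @ vs) =
      (if us \<notin> scannable M then {}
       else if delta M q a us = {}
         then {(to_nat Rewinding, Stay, (s, MoveL) # hold (us @ vs))}
       else (\<lambda>(q', d, as). (to_nat (Timing q'), d, (Bit True, MoveR) # as @ hold vs)) ` delta M q a us)"
    "delta (clocked M V) (to_nat Rewinding) a (s # us @ vs) =
      (if a = LeftEnd then {(to_nat (Running (start V) False), Stay, (s, Stay) # hold (us @ vs))}
       else {(to_nat Rewinding, MoveL, (s, Stay) # hold (us @ vs))})"
    "delta (clocked M V) (to_nat (Running q b)) a (s # us @ vs) =
      (if s = Bit True \<and> vs \<in> scannable V
         then (\<lambda>(q', d, as). (to_nat (Running q' (\<not> b)), d,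
             (s, if b then MoveL else Stay) # hold us @ as)) ` delta V q a vs
       else {})"
  using assms by (simp_all add: clocked_def)

text \<open>The head position is kept apart from the number of marks: the head is just behind the
  marks during \<open>Timing\<close> and at -1 when the time is used up.\<close>

definition clock :: "nat \<Rightarrow> int \<Rightarrow> tape" where
  "clock k h = (\<lambda>x. if 0 \<le> x \<and> x < int k then Bit True else Blank, h)"

lemma scan_clock: "scan (clock k h) = (if 0 \<le> h \<and> h < int k then Bit True else Blank)"
  by (simp add: clock_def)

lemma act_clock_mark: "act (clock k (int k)) (Bit True, MoveR) = clock (Suc k) (int (Suc k))"
  by (auto simp: clock_def fun_eq_iff)

lemma act_clock_move:
  "act (clock k h) (scan (clock k h), MoveL) = clock k (h - 1)"
  "act (clock k h) (scan (clock k h), Stay) = clock k h"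
  by (auto simp: clock_def fun_eq_iff)

text \<open>Since accepting states of \<open>V\<close> are dead, the clocked machine halts as soon
  as \<open>V\<close> accepts, even with marks left on the clock.\<close>

locale clocked_machine =
  fixes M V :: ntm
  assumes M: "is_NTM M" and V: "is_NTM V"
    and dead: "\<And>q a ss. q \<in> accepting V \<Longrightarrow> delta V q a ss = {}"
begin

abbreviation "U \<equiv> clocked M V"

lemma is_NTM_clocked: "is_NTM U"
  unfolding is_NTM_def
proof (intro conjI ballI allI)
  fix p a ss x
  assume p: "p \<in> states U" and ss: "ss \<in> scannable U" and x: "x \<in> delta U p a ss"
  from ss obtain s rest where ss_eq: "ss = s # rest" "length rest = tapes M + tapes V"
    and s: "s \<in> alphabet U" and rest: "set rest \<subseteq> alphabet U"
    unfolding scannable_def by (cases ss) auto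
  define us vs where "us = take (tapes M) rest" and "vs = drop (tapes M) rest"
  have ss1: "ss = s # us @ vs" and us: "length us = tapes M" and vs: "length vs = tapes V"
    using ss_eq unfolding us_def vs_def by auto
  have sub: "set us \<subseteq> alphabet U" "set vs \<subseteq> alphabet U"
    using rest unfolding us_def vs_def by (meson set_take_subset set_drop_subset order_trans)+
  note D = clocked_delta[OF us, of V]
  from p consider q where "p = to_nat (Timing q)" "q \<in> states M" | "p = to_nat Rewinding"
    | q b where "p = to_nat (Running q b)" "q \<in> states V"
    by auto
  then show "case x of (q', d, as) \<Rightarrow> q' \<in> states U \<and> length as = tapes U \<and>
      fst ` set as \<subseteq> alphabet U"
  proof cases
    case 1
    have usM: "us \<in> scannable M" using x unfolding 1 ss1 D by (auto split: if_splits)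
    show ?thesis
    proof (cases "delta M q a us = {}")
      case True
      then show ?thesis using x usM s sub us vs unfolding 1 ss1 D by (auto simp: image_Un)
    next
      case False
      with x usM obtain q' d as where y: "(q', d, as) \<in> delta M q a us"
        "x = (to_nat (Timing q'), d, (Bit True, MoveR) # as @ hold vs)"
        unfolding 1 ss1 D by auto
      show ?thesis using is_NTM_deltaD[OF M 1(2) usM y(1)] sub vs
        unfolding y(2) by (auto simp: image_Un)
    qed
  next
    case 2
    have "start V \<in> states V" using V by (auto simp: is_NTM_def)
    then show ?thesis using x s sub us vs unfolding 2 ss1 D by (auto split: if_splits)
  next
    case 3
    then obtain q' d as where vsV: "vs \<in> scannable V" and y: "(q', d, as) \<in> delta V q a vs"
        "x = (to_nat (Running q' (\<not> b)), d, (s, if b then MoveL else Stay) # hold us @ as)"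
      using x unfolding 3 ss1 D by (auto split: if_splits)
    show ?thesis using is_NTM_deltaD[OF V 3(2) vsV y(1)] sub s us
        image_eqI[of "Running q' (\<not> b)" "case_prod Running" "(q', \<not> b)" "states V \<times> UNIV"]
      unfolding y(2) by (auto simp: image_Un)
  qed
next
  have "case_prod Running ` (accepting V \<times> UNIV) \<subseteq> case_prod Running ` (states V \<times> UNIV)"
    using V unfolding is_NTM_def by (intro image_mono) blast
  then show "accepting U \<subseteq> states U" unfolding clocked_simps by blast
qed (use M V in \<open>auto simp: is_NTM_def intro!: finite_imageI finite_cartesian_product\<close>)

definition blanks :: "tape list" where
  "blanks = replicate (tapes V) (\<lambda>_. Blank, 0)"

text \<open>The bound on \<open>n\<close> in \<open>Running\<close> adds up \<open>k\<close> steps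
  of timing, one for turning round, at most \<open>length w + 1\<close> for rewinding and one for
  starting \<open>V\<close>, which gives \<open>k + length w + 3\<close>; then two for every mark
  already passed, and one more in the middle of such a pair.\<close>

inductive clock_inv :: "bool list \<Rightarrow> nat \<Rightarrow> config \<Rightarrow> bool" for w where
  Timing: "runs M w n (q, i, um) \<Longrightarrow>
    clock_inv w n (to_nat (Timing q), i, clock n (int n) # um @ blanks)"
| Rewinding: "runs M w k (q, j, um) \<Longrightarrow> i \<le> length w + 1 \<Longrightarrow>
    n + i \<le> k + length w + 2 \<Longrightarrow>
    clock_inv w n (to_nat Rewinding, i, clock k (int k - 1) # um @ blanks)"
| Running: "runs M w k (q0, j, um) \<Longrightarrow> reaches V w (q, i, vt) \<Longrightarrow>
    -1 \<le> h \<Longrightarrow> int n \<le> int k + int (length w) + 3 + 2 * (int k - 1 - h) + (if b then 1 else 0) \<Longrightarrow>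
    (b \<Longrightarrow> 0 \<le> h) \<Longrightarrow>
    clock_inv w n (to_nat (Running q b), i, clock k h # um @ vt)"

lemma M_lengths:
  assumes "runs M w k (q, i, um)"
  shows "length um = tapes M" "map scan um \<in> scannable M"
  using well_formed_reachable[OF M assms] well_formed_scannable by (auto simp: well_formed_def)

lemma V_lengths:
  assumes "reaches V w (q, i, vt)"
  shows "length vt = tapes V" "map scan vt \<in> scannable V" "q \<in> states V"
proof -
  obtain k where "runs V w k (q, i, vt)" using assms by (meson rtranclp_power)
  from well_formed_reachable[OF V this] show "length vt = tapes V" "map scan vt \<in> scannable V" "q \<in> states V"
    using well_formed_scannable by (auto simp: well_formed_def)
qed

lemma initial_clocked:
  "initial U = (to_nat (Timing (start M)), 0, clock 0 (int 0) # replicate (tapes M) (\<lambda>_. Blank, 0) @ blanks)"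
  by (auto simp: initial_def clock_def blanks_def replicate_add)

lemma clock_inv_initial: "clock_inv w 0 (initial U)"
  unfolding initial_clocked by (rule Timing) (simp add: initial_def)

lemma initial_V: "initial V = (start V, 0, blanks)"
  by (simp add: initial_def blanks_def)

lemma clock_inv_step:
  assumes "clock_inv w n c" "step U w c c'"
  shows "clock_inv w (Suc n) c'"
  using assms(1)
proof cases
  case (Timing q i um)
  note l = M_lengths[OF Timing(2)]
  from assms(2) obtain p' d as where s:
    "(p', d, as) \<in> delta U (to_nat (Timing q)) (input_at w i)
       (scan (clock n (int n)) # map scan um @ map scan blanks)"
    "c' = (p', move_input w d i, map2 act (clock n (int n) # um @ blanks) as)"
    unfolding Timing(1) by (auto simp: step.simps)
  show ?thesis
  proof (cases "delta M q (input_at w i) (map scan um) = {}")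
    case True
    then have "p' = to_nat Rewinding" "d = Stay"
      "as = (scan (clock n (int n)), MoveL) # hold (map scan um) @ hold (map scan blanks)"
      using s(1) l by (simp_all add: clocked_delta(1))
    then have "c' = (to_nat Rewinding, i, clock n (int n - 1) # um @ blanks)"
      unfolding s(2) by (simp add: act_clock_move move_input_def del: act.simps)
    then show ?thesis
      using clock_inv.Rewinding[OF Timing(2), of i "Suc n"] input_head_le[OF Timing(2)] by simp
  next
    case False
    then obtain q' as' where y: "(q', d, as') \<in> delta M q (input_at w i) (map scan um)"
      "p' = to_nat (Timing q')" "as = (Bit True, MoveR) # as' @ hold (map scan blanks)"
      using s(1) l by (auto simp: clocked_delta(1))
    have "length as' = tapes M"
      using well_formed_reachable[OF M Timing(2)] is_NTM_deltaD[OF M _ l(2) y(1)]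
      by (simp add: well_formed_def)
    then have "c' = (to_nat (Timing q'), move_input w d i, clock (Suc n) (int (Suc n)) # map2 act um as' @ blanks)"
      unfolding s(2) y using l by (simp add: act_clock_mark del: act.simps of_nat_Suc)
    moreover have "runs M w (Suc n) (q', move_input w d i, map2 act um as')"
      using Timing(2) step.intros[OF y(1)] by auto
    ultimately show ?thesis using clock_inv.Timing by metis
  qed
next
  case (Rewinding k q j um i)
  note l = M_lengths[OF Rewinding(2)]
  from assms(2) obtain p' d as where s:
    "(p', d, as) \<in> delta U (to_nat Rewinding) (input_at w i)
       (scan (clock k (int k - 1)) # map scan um @ map scan blanks)"
    "c' = (p', move_input w d i, map2 act (clock k (int k - 1) # um @ blanks) as)"
    unfolding Rewinding(1) by (auto simp: step.simps)
  have as: "as = (scan (clock k (int k - 1)), Stay) # hold (map scan um) @ hold (map scan blanks)"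
    using s(1) l by (auto simp: clocked_delta(2) split: if_splits)
  have ts: "map2 act (clock k (int k - 1) # um @ blanks) as = clock k (int k - 1) # um @ blanks"
    unfolding as by (simp add: act_clock_move del: act.simps)
  show ?thesis
  proof (cases "i = 0")
    case True
    then have p: "p' = to_nat (Running (start V) False)" "d = Stay"
      using s(1) l by (auto simp: clocked_delta(2) input_at_def)
    have "c' = (to_nat (Running (start V) False), 0, clock k (int k - 1) # um @ blanks)"
      unfolding s(2) ts p by (simp add: move_input_def True)
    moreover have "clock_inv w (Suc n) (to_nat (Running (start V) False), 0, clock k (int k - 1) # um @ blanks)"
      by (rule clock_inv.Running[OF Rewinding(2)]) (use Rewinding(4) in \<open>auto simp: initial_V\<close>)
    ultimately show ?thesis by simp
  next
    case False
    then have p: "p' = to_nat Rewinding" "d = MoveL"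
      using s(1) l by (auto simp: clocked_delta(2) input_at_def split: if_splits)
    have "c' = (to_nat Rewinding, i - 1, clock k (int k - 1) # um @ blanks)"
      unfolding s(2) ts p by (simp add: move_input_def)
    moreover have "clock_inv w (Suc n) (to_nat Rewinding, i - 1, clock k (int k - 1) # um @ blanks)"
      by (rule clock_inv.Rewinding[OF Rewinding(2)]) (use Rewinding(3,4) False in auto)
    ultimately show ?thesis by simp
  qed
next
  case (Running k q0 j um q i vt h b)
  note l = M_lengths[OF Running(2)] V_lengths[OF Running(3)]
  from assms(2) obtain p' d as where s:
    "(p', d, as) \<in> delta U (to_nat (Running q b)) (input_at w i)
       (scan (clock k h) # map scan um @ map scan vt)"
    "c' = (p', move_input w d i, map2 act (clock k h # um @ vt) as)"
    unfolding Running(1) by (auto simp: step.simps)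
  from s(1) l have mark: "scan (clock k h) = Bit True"
    by (auto simp: clocked_delta(3) split: if_splits)
  from s(1) l mark obtain q' as' where y: "(q', d, as') \<in> delta V q (input_at w i) (map scan vt)"
    "p' = to_nat (Running q' (\<not> b))"
    "as = (scan (clock k h), if b then MoveL else Stay) # hold (map scan um) @ as'"
    by (auto simp: clocked_delta(3))
  have c': "c' = (to_nat (Running q' (\<not> b)), move_input w d i,
      clock k (if b then h - 1 else h) # um @ map2 act vt as')"
    unfolding s(2) y by (simp add: act_clock_move map2_append del: act.simps zip_append map_append)
  have h: "0 \<le> h" using mark by (auto simp: scan_clock split: if_splits)
  have "reaches V w (q', move_input w d i, map2 act vt as')"
    using Running(3) step.intros[OF y(1)] by (rule rtranclp.rtrancl_into_rtrancl)
  then show ?thesis unfolding c'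
    by (rule clock_inv.Running[OF Running(2)]) (use h Running(5) in auto)
qed

lemma clock_inv_run:
  assumes "runs U w n c"
  shows "clock_inv w n c"
  using assms
proof (induction n arbitrary: c)
  case 0
  then show ?case using clock_inv_initial by simp
next
  case (Suc n)
  then obtain b where "runs U w n b" "step U w b c" by auto
  then show ?case using Suc.IH clock_inv_step by blast
qed

text \<open>\<open>M\<close> makes at most \<open>B\<close> steps, and each of its marks is worth
  two steps of \<open>V\<close>; this is the origin of \<open>3 * B\<close>.\<close>

lemma clocked_runtime:
  assumes B: "\<And>k c. runs M w k c \<Longrightarrow> k \<le> B"
    and "runs U w n c"
  shows "n \<le> 3 * B + length w + 4"
  using clock_inv_run[OF assms(2)]
proof cases
  case Timing
  then show ?thesis using B by fastforce
next
  case (Rewinding k)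
  then show ?thesis using B[OF Rewinding(2)] by simp
next
  case (Running k q0 j um q i vt h b)
  then show ?thesis using B[OF Running(2)] by (auto split: if_splits)
qed

text \<open>Cutting off computations of \<open>V\<close> can only remove words, whatever the clock
  does.\<close>

lemma clocked_sound:
  assumes "w \<in> language U"
  shows "\<exists>q i vt. reaches V w (q, i, vt) \<and> q \<in> accepting V"
proof -
  obtain p i ts where p: "reaches U w (p, i, ts)" "p \<in> accepting U"
    using assms unfolding language_def halts_in_def by blast
  obtain n where "runs U w n (p, i, ts)"
    using p(1) by (meson rtranclp_power)
  from clock_inv_run[OF this] show ?thesis
    by cases (use p(2) in \<open>auto, blast\<close>)
qed

lemma timing_run:
  assumes "runs M w n (q, i, um)"
  shows "reaches U w (to_nat (Timing q), i, clock n (int n) # um @ blanks)"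
  using assms
proof (induction n arbitrary: q i um)
  case 0
  then show ?case by (auto simp: initial_clocked initial_def[of M])
next
  case (Suc n)
  then obtain q0 i0 um0 where c0: "runs M w n (q0, i0, um0)"
    and s: "step M w (q0, i0, um0) (q, i, um)" by auto
  note l = M_lengths[OF c0]
  from s obtain d as where y: "(q, d, as) \<in> delta M q0 (input_at w i0) (map scan um0)"
    "i = move_input w d i0" "um = map2 act um0 as" by (auto simp: step.simps)
  have len: "length as = tapes M"
    using well_formed_reachable[OF M c0] is_NTM_deltaD[OF M _ l(2) y(1)]
    by (simp add: well_formed_def)
  have mem: "(to_nat (Timing q), d, (Bit True, MoveR) # as @ hold (map scan blanks)) \<in>
      delta U (to_nat (Timing q0)) (input_at w i0) (map scan (clock n (int n) # um0 @ blanks))"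
    using y(1) l by (force simp: clocked_delta(1))
  have "step U w (to_nat (Timing q0), i0, clock n (int n) # um0 @ blanks)
      (to_nat (Timing q), i, clock (Suc n) (int (Suc n)) # um @ blanks)"
    using step.intros[OF mem] l len unfolding y
    by (simp add: act_clock_mark del: act.simps of_nat_Suc)
  with Suc.IH[OF c0] show ?case by (rule rtranclp.rtrancl_into_rtrancl)
qed

lemma rewinding_run:
  assumes "runs M w k (q, j, um)"
  shows "(step U w)\<^sup>*\<^sup>* (to_nat Rewinding, i, clock k (int k - 1) # um @ blanks)
    (to_nat (Running (start V) False), 0, clock k (int k - 1) # um @ blanks)"
proof (induction i)
  case 0
  note l = M_lengths[OF assms]
  have mem: "(to_nat (Running (start V) False), Stay,
      (scan (clock k (int k - 1)), Stay) # hold (map scan um) @ hold (map scan blanks)) \<in>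
      delta U (to_nat Rewinding) (input_at w 0) (map scan (clock k (int k - 1) # um @ blanks))"
    using l by (simp add: clocked_delta(2) input_at_def)
  show ?case using step.intros[OF mem]
    by (auto simp: act_clock_move move_input_def simp del: act.simps)
next
  case (Suc i)
  note l = M_lengths[OF assms]
  have mem: "(to_nat Rewinding, MoveL,
      (scan (clock k (int k - 1)), Stay) # hold (map scan um) @ hold (map scan blanks)) \<in>
      delta U (to_nat Rewinding) (input_at w (Suc i)) (map scan (clock k (int k - 1) # um @ blanks))"
    using l by (simp add: clocked_delta(2) input_at_def)
  have "step U w (to_nat Rewinding, Suc i, clock k (int k - 1) # um @ blanks)
      (to_nat Rewinding, i, clock k (int k - 1) # um @ blanks)"
    using step.intros[OF mem]
    by (simp add: act_clock_move move_input_def del: act.simps)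
  with Suc.IH show ?case by (rule converse_rtranclp_into_rtranclp[rotated])
qed

text \<open>After \<open>j\<close> steps of \<open>V\<close> the clock head has retreated by
  \<open>j div 2\<close> cells, so it still scans a mark as long as
  \<open>j < 2 * k\<close>.\<close>

lemma running_run:
  assumes k: "runs M w k (q0, j0, um)"
    and "runs V w j (q, i, vt)" and "j \<le> 2 * k"
  shows "(step U w)\<^sup>*\<^sup>* (to_nat (Running (start V) False), 0, clock k (int k - 1) # um @ blanks)
    (to_nat (Running q (odd j)), i, clock k (int k - 1 - int (j div 2)) # um @ vt)"
  using assms(2,3)
proof (induction j arbitrary: q i vt)
  case 0
  then show ?case by (auto simp: initial_V)
next
  case (Suc j)
  then obtain q1 i1 vt1 where c1: "runs V w j (q1, i1, vt1)"
    and s: "step V w (q1, i1, vt1) (q, i, vt)" by auto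
  note l = M_lengths[OF k] V_lengths[OF relpowp_rtranclp[OF c1]]
  let ?h = "int k - 1 - int (j div 2)"
  from s obtain d as where y: "(q, d, as) \<in> delta V q1 (input_at w i1) (map scan vt1)"
    "i = move_input w d i1" "vt = map2 act vt1 as" by (auto simp: step.simps)
  have mark: "scan (clock k ?h) = Bit True"
    using Suc.prems(2) by (auto simp: scan_clock)
  have mem: "(to_nat (Running q (\<not> odd j)), d,
      (scan (clock k ?h), if odd j then MoveL else Stay) # hold (map scan um) @ as) \<in>
      delta U (to_nat (Running q1 (odd j))) (input_at w i1) (map scan (clock k ?h # um @ vt1))"
    using y(1) l mark by (force simp: clocked_delta(3))
  have h: "(if odd j then ?h - 1 else ?h) = int k - 1 - int (Suc j div 2)"
    by (auto elim!: oddE evenE)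
  have "act (clock k ?h) (scan (clock k ?h), if odd j then MoveL else Stay) =
      clock k (int k - 1 - int (Suc j div 2))"
    unfolding h[symmetric] by (simp add: act_clock_move del: act.simps)
  then have "step U w (to_nat (Running q1 (odd j)), i1, clock k ?h # um @ vt1)
      (to_nat (Running q (odd (Suc j))), i, clock k (int k - 1 - int (Suc j div 2)) # um @ vt)"
    using step.intros[OF mem] unfolding y
    by (simp add: map2_append del: act.simps zip_append map_append)
  moreover have "(step U w)\<^sup>*\<^sup>* (to_nat (Running (start V) False), 0, clock k (int k - 1) # um @ blanks)
    (to_nat (Running q1 (odd j)), i1, clock k ?h # um @ vt1)"
    using Suc.IH[OF c1] Suc.prems(2) by simp
  ultimately show ?case by (rule rtranclp.rtrancl_into_rtrancl[rotated])
qed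

lemma clocked_complete:
  assumes k: "runs M w k (q0, i0, um)" and halt: "\<nexists>c. step M w (q0, i0, um) c"
    and "runs V w j (q, i, vt)" "q \<in> accepting V" "j \<le> 2 * k"
  shows "w \<in> language U"
proof -
  note l = M_lengths[OF k] V_lengths[OF relpowp_rtranclp[OF assms(3)]]
  have "delta M q0 (input_at w i0) (map scan um) = {}"
    using halt step.intros by fastforce
  then have mem: "(to_nat Rewinding, Stay,
      (scan (clock k (int k)), MoveL) # hold (map scan um) @ hold (map scan blanks)) \<in>
      delta U (to_nat (Timing q0)) (input_at w i0) (map scan (clock k (int k) # um @ blanks))"
    using l by (simp add: clocked_delta(1))
  have "step U w (to_nat (Timing q0), i0, clock k (int k) # um @ blanks)
      (to_nat Rewinding, i0, clock k (int k - 1) # um @ blanks)"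
    using step.intros[OF mem]
    by (simp add: act_clock_move move_input_def del: act.simps)
  then have "reaches U w (to_nat (Running q (odd j)), i, clock k (int k - 1 - int (j div 2)) # um @ vt)"
    using timing_run[OF k] rewinding_run[OF k, of i0] running_run[OF k assms(3,5)]
    by (meson rtranclp.rtrancl_into_rtrancl rtranclp_trans)
  moreover have "\<not> step U w (to_nat (Running q (odd j)), i, clock k (int k - 1 - int (j div 2)) # um @ vt) c" for c
    using dead[OF assms(4)] l by (auto simp: step.simps clocked_delta(3))
  moreover have "to_nat (Running q (odd j)) \<in> accepting U"
    using assms(4) by auto
  ultimately show ?thesis
    unfolding language_def halts_in_def by blast
qed

end

text \<open>The two implications leave open the words that \<open>V\<close> accepts, but only by
  longer computations. This gap does no harm, because the reduction produces words that
  \<open>V\<close> either accepts in time or does not accept at all.\<close>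

lemma clocked_universal_language:
  assumes tb: "time_bound f" and tc: "time_constructible f"
    and V: "is_NTM V" and dead: "\<And>q a ss. q \<in> accepting V \<Longrightarrow> delta V q a ss = {}"
  shows "\<exists>L\<in>NTIME f. \<forall>w.
    (w \<in> L \<longrightarrow> (\<exists>q i ts. reaches V w (q, i, ts) \<and> q \<in> accepting V)) \<and>
    ((\<exists>k q i ts. runs V w k (q, i, ts) \<and> q \<in> accepting V \<and> k \<le> 2 * f (length w))
       \<longrightarrow> w \<in> L)"
proof -
  obtain M j where DM: "is_DTM M" "j < tapes M" "runs_in_time_O M f"
    and ones: "\<And>w q i ts. halts_in M w (q, i, ts) \<Longrightarrow> holds_ones (ts ! j) (f (length w))"
    using tc unfolding time_constructible_def by blast
  have N: "is_NTM M" using DM(1) unfolding is_DTM_def by blast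
  interpret clocked_machine M V
    by unfold_locales (use N V dead in auto)
  obtain c where c: "\<And>w k e. runs M w k e \<Longrightarrow> k \<le> c * f (length w) + c"
    using DM(3) unfolding runs_in_time_O_iff[OF tb] by blast
  have "runs_in_time_O U f"
    unfolding runs_in_time_O_iff[OF tb]
  proof (intro exI allI impI)
    fix w k e assume "runs U w k e"
    from clocked_runtime[OF c this]
    have "k \<le> 3 * (c * f (length w) + c) + length w + 4" .
    moreover have "length w \<le> f (length w)" using tb unfolding time_bound_def by blast
    ultimately show "k \<le> (3 * c + 4) * f (length w) + (3 * c + 4)" by (simp add: algebra_simps)
  qed
  then have "language U \<in> NTIME f"
    using is_NTM_clocked unfolding NTIME_def by blast
  moreover have "w \<in> language U" if w: "runs V w k (q, i, ts)" "q \<in> accepting V"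
    "k \<le> 2 * f (length w)" for w k q i ts
  proof -
    obtain n e where n: "runs M w n e" "\<nexists>c'. step M w e c'"
      using halting_run_exists[of M w "c * f (length w) + c"] c by blast
    obtain q0 i0 um where e: "e = (q0, i0, um)" by (cases e)
    have "halts_in M w (q0, i0, um)"
      using n(2) e relpowp_rtranclp[OF n(1)] unfolding halts_in_def by blast
    from card_holds_ones[OF ones[OF this]] have "f (length w) \<le> n"
      using nonblank_cells_le_steps[OF N _ DM(2)] n(1) e by metis
    then show ?thesis
      using clocked_complete[OF n(1)[unfolded e] n(2)[unfolded e] w(1,2)] w(3) by simp
  qed
  ultimately show ?thesis
    using clocked_sound by (intro bexI[of _ "language U"] allI conjI impI) metis+
qed

section \<open>A universal machine\<close>

text \<open>The input of the universal machine is itself the program: operations on single bits of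
  single tapes, a separator and an accepting instruction. Jumps have no address; \<open>Sep\<close>
  lets the machine continue behind any separator it likes, and wrong choices are refuted by
  tests.\<close>

datatype token = Nop | Sep | Acc | PushT nat bool | LeftT nat | TestT nat bool

text \<open>Tape \<open>s\<close> owns the five numbers from \<open>5 * s + 3\<close> to
  \<open>5 * s + 7\<close>. Hence the tokens that need only tapes below \<open>d\<close> are exactly
  those with numbers below \<open>5 * d + 3\<close>.\<close>

fun token_number :: "token \<Rightarrow> nat" where
  "token_number Nop = 0"
| "token_number Sep = 1"
| "token_number Acc = 2"
| "token_number (PushT s b) = 5 * s + (if b then 4 else 3)"
| "token_number (LeftT s) = 5 * s + 5"
| "token_number (TestT s b) = 5 * s + (if b then 7 else 6)"

lemma inj_token_number: "token_number t = token_number t' \<Longrightarrow> t = t'"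
  by (cases t; cases t'; simp split: if_splits; presburger)

text \<open>In this unary code a token is recognised by counting in the finite control, and every
  \<open>False\<close> ends a token, so that a freely wandering head can always find a token
  boundary.\<close>

definition token_code :: "token list \<Rightarrow> bool list" where
  "token_code ts = concat (map (\<lambda>t. replicate (token_number t) True @ [False]) ts)"

abbreviation code_length :: "token list \<Rightarrow> nat" where
  "code_length ts \<equiv> length (token_code ts)"

lemma token_code_simps [simp]:
  "token_code [] = []"
  "token_code (t # ts) = replicate (token_number t) True @ False # token_code ts"
  "token_code (ts @ ts') = token_code ts @ token_code ts'"
  by (auto simp: token_code_def)

fun token_action :: "token \<Rightarrow> symbol list \<Rightarrow> (symbol \<times> direction) list option" where
  "token_action (PushT s b) ss = Some ((hold ss)[s := (Bit b, MoveR)])"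
| "token_action (LeftT s) ss = Some ((hold ss)[s := (ss ! s, MoveL)])"
| "token_action (TestT s b) ss = (if ss ! s = Bit b then Some (hold ss) else None)"
| "token_action _ ss = Some (hold ss)"

text \<open>\<open>Exec c\<close> has read \<open>c\<close> ones of the current token.
  \<open>Free\<close> wanders over the input and can stop only by stepping right from a
  \<open>False\<close>; \<open>Must\<close> then insists that the token entered is
  \<open>Sep\<close>, whose code is \<open>True\<close> followed by \<open>False\<close>.\<close>

datatype universal_state = Exec nat | Must nat | Free | Accepted

instance universal_state :: countable
  by countable_datatype

fun token_next :: "token \<Rightarrow> universal_state \<times> direction" where
  "token_next Sep = (Free, Stay)"
| "token_next Acc = (Accepted, Stay)"
| "token_next _ = (Exec 0, MoveR)"

fun universal_delta ::
  "nat \<Rightarrow> universal_state \<Rightarrow> input_symbol \<Rightarrow> symbol list \<Rightarrow> (nat \<times> direction \<times> (symbol \<times> direction) list) set" where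
  "universal_delta d (Exec c) LeftEnd ss = (if c = 0 then {(to_nat (Exec 0), MoveR, hold ss)} else {})"
| "universal_delta d (Exec c) (In True) ss =
     (if c < 5 * d + 3 then {(to_nat (Exec (Suc c)), MoveR, hold ss)} else {})"
| "universal_delta d (Exec c) (In False) ss =
     {(to_nat (fst (token_next t)), snd (token_next t), as) | t as.
        token_number t = c \<and> c < 5 * d + 3 \<and> token_action t ss = Some as}"
| "universal_delta d (Must c) (In b) ss =
     (if c = 0 \<and> b then {(to_nat (Must 1), MoveR, hold ss)}
      else if c = 1 \<and> \<not> b then {(to_nat (Exec 0), MoveR, hold ss)} else {})"
| "universal_delta d Free (In b) ss =
     {(to_nat Free, MoveL, hold ss), (to_nat Free, MoveR, hold ss)} \<union>
       (if b then {} else {(to_nat (Must 0), MoveR, hold ss)})"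
| "universal_delta d _ _ ss = {}"

definition universal_states :: "nat \<Rightarrow> universal_state set" where
  "universal_states d = Exec ` {..5 * d + 3} \<union> {Must 0, Must 1, Free, Accepted}"

definition universal :: "nat \<Rightarrow> ntm" where
  "universal d = \<lparr>
     tapes = d,
     states = to_nat ` universal_states d,
     alphabet = {Blank, Bit True, Bit False},
     start = to_nat (Exec 0),
     accepting = {to_nat Accepted},
     delta = \<lambda>p. universal_delta d (from_nat p)\<rparr>"

lemma universal_simps [simp]:
  "tapes (universal d) = d"
  "states (universal d) = to_nat ` universal_states d"
  "alphabet (universal d) = {Blank, Bit True, Bit False}"
  "start (universal d) = to_nat (Exec 0)"
  "accepting (universal d) = {to_nat Accepted}"
  "delta (universal d) (to_nat p) = universal_delta d p"
  by (auto simp: universal_def)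

lemma universal_dead: "q \<in> accepting (universal d) \<Longrightarrow> delta (universal d) q a ss = {}"
  by (auto simp: universal_def)

lemma token_action_Some:
  assumes "token_action t ss = Some as" "set ss \<subseteq> {Blank, Bit True, Bit False}"
  shows "length as = length ss \<and> fst ` set as \<subseteq> {Blank, Bit True, Bit False}"
proof -
  have upd: "fst ` set ((hold ss)[s := x]) \<subseteq> insert (fst x) (set ss)" for s x
    using set_update_subset_insert[of "hold ss" s x] by force
  have nth: "(hold ss)[s := (ss ! s, MoveL)] = hold ss" if "\<not> s < length ss" for s
    using that by (intro list_update_beyond) simp
  show ?thesis
  proof (cases t)
    case (PushT s b)
    then show ?thesis using assms upd[of s "(Bit b, MoveR)"] by (cases b) auto
  next
    case (LeftT s)
    then have as: "as = (hold ss)[s := (ss ! s, MoveL)]" using assms by simp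
    show ?thesis
    proof (cases "s < length ss")
      case True
      then have "ss ! s \<in> set ss" by simp
      with upd[of s "(ss ! s, MoveL)"] have "fst ` set as \<subseteq> set ss" unfolding as by auto
      then show ?thesis using assms(2) as by auto
    next
      case False
      show ?thesis unfolding as nth[OF False] using assms(2) by auto
    qed
  qed (use assms in \<open>auto split: if_splits\<close>)
qed

lemma is_NTM_universal: "is_NTM (universal d)"
  unfolding is_NTM_def
proof (intro conjI ballI allI)
  fix p a ss x
  assume p: "p \<in> states (universal d)" and ss: "ss \<in> scannable (universal d)"
    and x: "x \<in> delta (universal d) p a ss"
  from p obtain q where q: "p = to_nat q" "q \<in> universal_states d" by auto
  have ss': "length ss = d" "set ss \<subseteq> {Blank, Bit True, Bit False}"
    using ss by (auto simp: scannable_def)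
  have next_state: "fst (token_next t) \<in> universal_states d" for t
    by (cases t) (auto simp: universal_states_def)
  have mem: "Exec 0 \<in> universal_states d" "Must 0 \<in> universal_states d" "Must 1 \<in> universal_states d"
    "Free \<in> universal_states d" "\<And>c. c < 5 * d + 3 \<Longrightarrow> Exec (Suc c) \<in> universal_states d"
    by (auto simp: universal_states_def)
  have x': "x \<in> universal_delta d q a ss" using x q by simp
  show "case x of (q', e, as) \<Rightarrow> q' \<in> states (universal d) \<and>
      length as = tapes (universal d) \<and> fst ` set as \<subseteq> alphabet (universal d)"
  proof (cases "\<exists>c. q = Exec c \<and> a = In False")
    case True
    then obtain t as where "x = (to_nat (fst (token_next t)), snd (token_next t), as)"
      "token_action t ss = Some as"
      using x' by auto
    then show ?thesis using token_action_Some[OF _ ss'(2)] next_state ss'(1) by auto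
  next
    case False
    then have "\<exists>p' e. x = (to_nat p', e, hold ss) \<and> p' \<in> universal_states d"
      using x' mem by (cases "(d, q, a, ss)" rule: universal_delta.cases) (auto split: if_splits)
    then show ?thesis using ss' by auto
  qed
qed (auto simp: universal_states_def)

section \<open>Abstract execution of token lists\<close>

definition token_exec :: "token \<Rightarrow> tape list \<Rightarrow> tape list option" where
  "token_exec t ts = map_option (map2 act ts) (token_action t (map scan ts))"

fun run_tokens :: "token list \<Rightarrow> tape list \<Rightarrow> tape list option" where
  "run_tokens [] ts = Some ts"
| "run_tokens (t # v) ts = Option.bind (token_exec t ts) (run_tokens v)"

lemma run_tokens_append: "run_tokens (u @ v) ts = Option.bind (run_tokens u ts) (run_tokens v)"
  by (induction u arbitrary: ts) (auto split: Option.bind_splits)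

lemma input_at_token:
  assumes "toks = u @ t # v" "c \<le> token_number t"
  shows "input_at (token_code toks) (Suc (code_length u + c)) = In (c < token_number t)"
  using assms by (auto simp: input_at_def nth_append)

lemma input_at_token_end:
  "input_at (token_code toks) (Suc (code_length toks)) = RightEnd"
  by (auto simp: input_at_def)

text \<open>It recovers a splitting of the token list from a bare head position, at the moment when
  the wandering of \<open>Free\<close> stops.\<close>

lemma False_ends_token:
  assumes "p < code_length toks" "\<not> token_code toks ! p"
  shows "\<exists>u v. toks = u @ v \<and> Suc p = code_length u"
  using assms
proof (induction toks arbitrary: p)
  case (Cons t toks)
  consider "p < token_number t" | "p = token_number t" | "p > token_number t" by linarith
  then show ?case
  proof cases
    case 1
    then show ?thesis using Cons.prems by (auto simp: nth_append)
  next
    case 2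
    then show ?thesis by (intro exI[of _ "[t]"] exI[of _ toks]) auto
  next
    case 3
    then obtain r where r: "p = Suc (token_number t) + r" using less_imp_Suc_add by fastforce
    with Cons.prems have "r < code_length toks" "\<not> token_code toks ! r"
      by (auto simp: nth_append)
    from Cons.IH[OF this] obtain u v where "toks = u @ v" "Suc r = code_length u" by blast
    then show ?thesis by (intro exI[of _ "t # u"] exI[of _ v]) (auto simp: r)
  qed
qed auto

text \<open>Execution without head positions: the list holds the tokens still ahead, and a separator
  is left only by a jump behind some separator of \<open>toks\<close>.\<close>

inductive token_reach :: "token list \<Rightarrow> tape list \<Rightarrow> token list \<Rightarrow> tape list \<Rightarrow> bool"
  for toks ts0 where
  init: "token_reach toks ts0 toks ts0"
| tok: "token_reach toks ts0 (t # v) ts \<Longrightarrow> t \<noteq> Sep \<Longrightarrow> t \<noteq> Acc \<Longrightarrow> token_exec t ts = Some ts' \<Longrightarrow>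
    token_reach toks ts0 v ts'"
| jump: "token_reach toks ts0 (Sep # v) ts \<Longrightarrow> toks = u @ Sep # v' \<Longrightarrow> token_reach toks ts0 v' ts"

definition empty_tapes :: "nat \<Rightarrow> tape list" where
  "empty_tapes d = replicate d (\<lambda>_. Blank, 0)"

text \<open>During \<open>Free\<close> the position is unrestricted; what is kept is that the
  wandering started at a separator, which is all that \<open>jump\<close> requires.\<close>

inductive universal_inv :: "token list \<Rightarrow> nat \<Rightarrow> config \<Rightarrow> bool" for toks d where
  Start: "universal_inv toks d (to_nat (Exec 0), 0, empty_tapes d)"
| Exec: "token_reach toks (empty_tapes d) v ts \<Longrightarrow> toks = u @ v \<Longrightarrow>
    c = 0 \<or> (\<exists>t v'. v = t # v' \<and> c \<le> token_number t) \<Longrightarrow>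
    universal_inv toks d (to_nat (Exec c), Suc (code_length u + c), ts)"
| Must: "token_reach toks (empty_tapes d) (Sep # v0) ts \<Longrightarrow> toks = u @ v \<Longrightarrow>
    c = 0 \<or> (\<exists>t v'. v = t # v' \<and> c \<le> token_number t) \<Longrightarrow>
    universal_inv toks d (to_nat (Must c), Suc (code_length u + c), ts)"
| Free: "token_reach toks (empty_tapes d) (Sep # v0) ts \<Longrightarrow> universal_inv toks d (to_nat Free, i, ts)"
| Accepted: "token_reach toks (empty_tapes d) (Acc # v0) ts \<Longrightarrow>
    universal_inv toks d (to_nat Accepted, i, ts)"

lemma move_input_token:
  assumes "toks = u @ t # v" "c \<le> token_number t"
  shows "move_input (token_code toks) MoveR (Suc (code_length u + c)) =
    Suc (code_length u + Suc c)"
  using assms by (auto simp: move_input_def)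

lemma universal_inv_step:
  assumes "universal_inv toks d c" "step (universal d) (token_code toks) c c'"
  shows "universal_inv toks d c'"
  using assms(1)
proof cases
  case Start
  have "c' = (to_nat (Exec 0), 1, empty_tapes d)"
    using assms(2) by (auto simp: step.simps Start input_at_def move_input_def)
  then show ?thesis
    using universal_inv.Exec[OF token_reach.init[of toks "empty_tapes d"], of "[]" 0] by simp
next
  case (Exec v ts u c0)
  show ?thesis
  proof (cases v)
    case Nil
    then have "c0 = 0" "toks = u" using Exec by auto
    then show ?thesis using assms(2) input_at_token_end[of toks]
      by (auto simp: step.simps Exec(1))
  next
    case (Cons t v')
    have c0: "c0 \<le> token_number t" using Exec Cons by auto
    have toks: "toks = u @ t # v'" using Exec Cons by simp
    note a = input_at_token[OF toks c0] and m = move_input_token[OF toks c0]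
    show ?thesis
    proof (cases "c0 < token_number t")
      case True
      have "c' = (to_nat (Exec (Suc c0)), Suc (code_length u + Suc c0), ts)"
        using assms(2) a m True by (auto simp: step.simps Exec(1) split: if_splits)
      then show ?thesis
        using universal_inv.Exec[OF Exec(2,3), of "Suc c0"] Cons True by simp
    next
      case False
      then obtain as where as: "token_action t (map scan ts) = Some as"
        "c' = (to_nat (fst (token_next t)), move_input (token_code toks) (snd (token_next t))
            (Suc (code_length u + c0)), map2 act ts as)"
        using assms(2) a c0 inj_token_number by (auto simp: step.simps Exec(1))
      have ex: "token_exec t ts = Some (map2 act ts as)"
        using as by (simp add: token_exec_def)
      have c0_eq: "c0 = token_number t" using False c0 by simp
      consider "t = Sep" | "t = Acc" | "t \<noteq> Sep" "t \<noteq> Acc" by blast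
      then show ?thesis
      proof cases
        case 1
        then show ?thesis using as universal_inv.Free[of toks d v' ts] Exec(2) Cons by auto
      next
        case 2
        then show ?thesis using as universal_inv.Accepted[of toks d v' ts] Exec(2) Cons by auto
      next
        case 3
        then have "token_next t = (Exec 0, MoveR)" by (cases t) auto
        then have "c' = (to_nat (Exec 0), Suc (code_length (u @ [t]) + 0), map2 act ts as)"
          using as m c0_eq by simp
        moreover have "token_reach toks (empty_tapes d) v' (map2 act ts as)"
          using token_reach.tok[OF _ 3 ex] Exec(2) Cons by simp
        ultimately show ?thesis
          using universal_inv.Exec[of toks d v' _ "u @ [t]" 0] toks by simp
      qed
    qed
  qed
next
  case (Must v0 ts u v c0)
  show ?thesis
  proof (cases v)
    case Nil
    then have "c0 = 0" "toks = u" using Must by auto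
    then show ?thesis using assms(2) input_at_token_end[of toks]
      by (auto simp: step.simps Must(1))
  next
    case (Cons t v')
    have c0: "c0 \<le> token_number t" using Must Cons by auto
    have toks: "toks = u @ t # v'" using Must Cons by simp
    note a = input_at_token[OF toks c0] and m = move_input_token[OF toks c0]
    show ?thesis
    proof (cases "c0 < token_number t")
      case True
      have "c' = (to_nat (Must (Suc c0)), Suc (code_length u + Suc c0), ts)"
        using assms(2) a m True by (auto simp: step.simps Must(1) split: if_splits)
      then show ?thesis
        using universal_inv.Must[OF Must(2,3), of "Suc c0"] Cons True by simp
    next
      case False
      then have c0_eq: "c0 = token_number t" using c0 by simp
      have c': "c' = (to_nat (Exec 0), Suc (code_length u + Suc c0), ts)" and "c0 = 1"
        using assms(2) a m False by (auto simp: step.simps Must(1) split: if_splits)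
      then have "t = Sep" using c0_eq inj_token_number[of t Sep] by simp
      then have "token_reach toks (empty_tapes d) v' ts"
        using token_reach.jump[OF Must(2)] toks by blast
      moreover have "c' = (to_nat (Exec 0), Suc (code_length (u @ [t]) + 0), ts)"
        using c' c0_eq by simp
      ultimately show ?thesis
        using universal_inv.Exec[of toks d v' _ "u @ [t]" 0] toks by simp
    qed
  qed
next
  case (Free v0 ts i)
  show ?thesis
  proof (cases "input_at (token_code toks) i")
    case (In b)
    then have i: "0 < i" "i \<le> code_length toks" "b = token_code toks ! (i - 1)"
      by (auto simp: input_at_def split: if_splits)
    consider k where "c' = (to_nat Free, k, ts)"
      | "\<not> b" "c' = (to_nat (Must 0), move_input (token_code toks) MoveR i, ts)"
      using assms(2) In by (auto simp: step.simps Free(1) move_input_def split: if_splits)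
    then show ?thesis
    proof cases
      case 1
      then show ?thesis using universal_inv.Free[OF Free(2)] by simp
    next
      case 2
      have "i - 1 < code_length toks" "\<not> token_code toks ! (i - 1)" using i 2(1) by auto
      from False_ends_token[OF this]
      obtain u v where uv: "toks = u @ v" "Suc (i - 1) = code_length u" by blast
      then have "c' = (to_nat (Must 0), Suc (code_length u + 0), ts)"
        using 2 i by (simp add: move_input_def)
      then show ?thesis using universal_inv.Must[OF Free(2) uv(1), of 0] by simp
    qed
  qed (use assms(2) in \<open>auto simp: step.simps Free(1)\<close>)
next
  case (Accepted v0 ts i)
  then show ?thesis using assms(2) by (auto simp: step.simps)
qed

lemma universal_sound:
  assumes "reaches (universal d) (token_code toks) (q, i, ts)"
    and "q \<in> accepting (universal d)"
  shows "\<exists>v ts. token_reach toks (empty_tapes d) (Acc # v) ts"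
proof -
  have "universal_inv toks d (q, i, ts)"
    using assms(1)
  proof (induction rule: rtranclp_induct)
    case base
    then show ?case using universal_inv.Start by (simp add: initial_def empty_tapes_def)
  qed (use universal_inv_step in blast)
  then show ?thesis by cases (use assms(2) in auto)
qed

section \<open>Programs of the universal machine\<close>

text \<open>The exact length of a jump depends on direction and distance; working with upper bounds
  allows the costs of the pieces to be added.\<close>

definition steps_le :: "('a \<Rightarrow> 'a \<Rightarrow> bool) \<Rightarrow> nat \<Rightarrow> 'a \<Rightarrow> 'a \<Rightarrow> bool" where
  "steps_le S n a b \<longleftrightarrow> (\<exists>k\<le>n. (S ^^ k) a b)"

lemma steps_le_relpowp: "(S ^^ n) a b \<Longrightarrow> steps_le S n a b"
  by (auto simp: steps_le_def)

lemma steps_le_step: "S a b \<Longrightarrow> steps_le S 1 a b"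
  by (rule steps_le_relpowp) (simp only: relpowp_1)

lemma steps_le_refl: "steps_le S n a a"
  unfolding steps_le_def by (rule exI[of _ 0]) simp

lemma steps_le_mono: "steps_le S n a b \<Longrightarrow> n \<le> n' \<Longrightarrow> steps_le S n' a b"
  unfolding steps_le_def using le_trans by blast

lemma steps_le_trans: "steps_le S n a b \<Longrightarrow> steps_le S n' b c \<Longrightarrow> steps_le S (n + n') a c"
  unfolding steps_le_def by (metis add_mono relpowp_trans)

definition plain_tokens :: "nat \<Rightarrow> token list \<Rightarrow> bool" where
  "plain_tokens d v \<longleftrightarrow> Sep \<notin> set v \<and> Acc \<notin> set v \<and> (\<forall>t\<in>set v. token_number t < 5 * d + 3)"

lemma plain_tokens_simps [simp]:
  "plain_tokens d []"
  "plain_tokens d (t # v) \<longleftrightarrow> t \<noteq> Sep \<and> t \<noteq> Acc \<and> token_number t < 5 * d + 3 \<and> plain_tokens d v"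
  "plain_tokens d (u @ v) \<longleftrightarrow> plain_tokens d u \<and> plain_tokens d v"
  by (auto simp: plain_tokens_def)

lemma universal_step:
  assumes "(to_nat q', e, as) \<in> universal_delta d q (input_at w i) (map scan ts)"
  shows "step (universal d) w (to_nat q, i, ts) (to_nat q', move_input w e i, map2 act ts as)"
  by (rule step.intros) (use assms in simp)

section \<open>Time needed to execute token lists and jumps\<close>

abbreviation univ_within :: "nat \<Rightarrow> token list \<Rightarrow> nat \<Rightarrow> config \<Rightarrow> config \<Rightarrow> bool" where
  "univ_within d toks \<equiv> steps_le (step (universal d) (token_code toks))"

lemma read_ones:
  assumes "toks = u @ t # v" "token_number t < 5 * d + 3" "c \<le> token_number t"
  shows "univ_within d toks c (to_nat (Exec 0), Suc (code_length u), ts)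
    (to_nat (Exec c), Suc (code_length u + c), ts)"
  using assms(3)
proof (induction c)
  case 0
  then show ?case by (simp add: steps_le_refl)
next
  case (Suc c)
  have "step (universal d) (token_code toks) (to_nat (Exec c), Suc (code_length u + c), ts)
      (to_nat (Exec (Suc c)), move_input (token_code toks) MoveR (Suc (code_length u + c)), map2 act ts (hold (map scan ts)))"
    by (rule universal_step)
      (use input_at_token[OF assms(1), of c] Suc.prems assms(2) in simp)
  then show ?case
    using steps_le_trans[OF Suc.IH steps_le_step] move_input_token[OF assms(1), of c] Suc.prems
    by simp
qed

lemma exec_token:
  assumes "toks = u @ t # v" "token_number t < 5 * d + 3" "token_exec t ts = Some ts'"
  shows "univ_within d toks (Suc (token_number t)) (to_nat (Exec 0), Suc (code_length u), ts)
    (to_nat (fst (token_next t)),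
      move_input (token_code toks) (snd (token_next t)) (Suc (code_length u + token_number t)), ts')"
proof -
  obtain as where as: "token_action t (map scan ts) = Some as" "ts' = map2 act ts as"
    using assms(3) by (auto simp: token_exec_def)
  have "step (universal d) (token_code toks) (to_nat (Exec (token_number t)), Suc (code_length u + token_number t), ts)
    (to_nat (fst (token_next t)),
      move_input (token_code toks) (snd (token_next t)) (Suc (code_length u + token_number t)), map2 act ts as)"
    by (rule universal_step)
      (use input_at_token[OF assms(1), of "token_number t"] assms(2) as in auto)
  from steps_le_trans[OF read_ones[OF assms(1,2) le_refl] steps_le_step[of "step (universal d) (token_code toks)", OF this]]
  show ?thesis by (simp add: as)
qed

lemma exec_plain_token:
  assumes "toks = u @ t # v" "token_number t < 5 * d + 3" "token_exec t ts = Some ts'"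
    and "t \<noteq> Sep" "t \<noteq> Acc"
  shows "univ_within d toks (code_length [t]) (to_nat (Exec 0), Suc (code_length u), ts)
    (to_nat (Exec 0), Suc (code_length (u @ [t])), ts')"
proof -
  have "token_next t = (Exec 0, MoveR)" using assms(4,5) by (cases t) auto
  with exec_token[OF assms(1-3)] move_input_token[OF assms(1) le_refl] show ?thesis
    by simp
qed

lemma exec_tokens:
  assumes "toks = u @ r @ v" "plain_tokens d r" "run_tokens r ts = Some ts'"
  shows "univ_within d toks (code_length r) (to_nat (Exec 0), Suc (code_length u), ts)
    (to_nat (Exec 0), Suc (code_length (u @ r)), ts')"
  using assms
proof (induction r arbitrary: u ts)
  case Nil
  then show ?case by (simp add: steps_le_refl)
next
  case (Cons t r)
  then obtain ts1 where ts1: "token_exec t ts = Some ts1" "run_tokens r ts1 = Some ts'"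
    by (auto split: Option.bind_splits)
  have "univ_within d toks (code_length [t]) (to_nat (Exec 0), Suc (code_length u), ts)
    (to_nat (Exec 0), Suc (code_length (u @ [t])), ts1)"
    by (rule exec_plain_token) (use Cons.prems ts1 in auto)
  from steps_le_trans[OF this Cons.IH[of "u @ [t]" ts1]] Cons.prems ts1 show ?case by simp
qed

lemma free_left:
  "i + k \<le> code_length toks \<Longrightarrow> 0 < i \<Longrightarrow>
    univ_within d toks k (to_nat Free, i + k, ts) (to_nat Free, i, ts)"
proof (induction k)
  case 0
  then show ?case by (simp add: steps_le_refl)
next
  case (Suc k)
  then have IH: "univ_within d toks k (to_nat Free, i + k, ts) (to_nat Free, i, ts)"
    by simp
  have "step (universal d) (token_code toks) (to_nat Free, i + Suc k, ts)
      (to_nat Free, move_input (token_code toks) MoveL (i + Suc k), map2 act ts (hold (map scan ts)))"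
    by (rule universal_step) (use Suc.prems in \<open>auto simp: input_at_def\<close>)
  then have "step (universal d) (token_code toks) (to_nat Free, i + Suc k, ts) (to_nat Free, i + k, ts)"
    by (simp add: move_input_def)
  from steps_le_trans[OF steps_le_step[of "step (universal d) (token_code toks)", OF this] IH]
  show ?case by simp
qed

lemma free_right:
  "i + k \<le> code_length toks \<Longrightarrow> 0 < i \<Longrightarrow>
    univ_within d toks k (to_nat Free, i, ts) (to_nat Free, i + k, ts)"
proof (induction k)
  case 0
  then show ?case by (simp add: steps_le_refl)
next
  case (Suc k)
  then have IH: "univ_within d toks k (to_nat Free, i, ts) (to_nat Free, i + k, ts)"
    by simp
  have "step (universal d) (token_code toks) (to_nat Free, i + k, ts)
      (to_nat Free, move_input (token_code toks) MoveR (i + k), map2 act ts (hold (map scan ts)))"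
    by (rule universal_step) (use Suc.prems in \<open>auto simp: input_at_def\<close>)
  then have "step (universal d) (token_code toks) (to_nat Free, i + k, ts) (to_nat Free, i + Suc k, ts)"
    using Suc.prems by (simp add: move_input_def)
  from steps_le_trans[OF IH steps_le_step[of "step (universal d) (token_code toks)", OF this]]
  show ?case by simp
qed

lemma free_move:
  assumes "lo \<le> i" "i \<le> lo + len" "lo \<le> j" "j \<le> lo + len" "0 < lo" "lo + len \<le> code_length toks"
  shows "univ_within d toks len (to_nat Free, i, ts) (to_nat Free, j, ts)"
proof (cases "i \<le> j")
  case True
  with free_right[of i "j - i"] assms have "univ_within d toks (j - i) (to_nat Free, i, ts) (to_nat Free, j, ts)"
    by simp
  then show ?thesis by (rule steps_le_mono) (use assms in simp)
next
  case False
  with free_left[of j "i - j"] assms have "univ_within d toks (i - j) (to_nat Free, i, ts) (to_nat Free, j, ts)"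
    by simp
  then show ?thesis by (rule steps_le_mono) (use assms in simp)
qed

text \<open>Two steps read \<open>Sep\<close>, at most \<open>len\<close> lead to the closing
  \<open>False\<close> of the token in front of the target, and three more leave it and verify the
  target. The walk stays between \<open>lo\<close> and \<open>lo + len\<close>, so that the cost
  depends on this stretch only and not on the length of the whole input.\<close>

lemma jump_to_Sep:
  assumes toks: "toks = u @ Sep # v" "toks = u' @ Sep # v'"
    and "lo \<le> code_length u" "code_length u + 2 \<le> lo + len"
    and "lo \<le> code_length u'" "code_length u' \<le> lo + len"
    and "0 < lo" "lo + len \<le> code_length toks"
  shows "univ_within d toks (len + 5) (to_nat (Exec 0), Suc (code_length u), ts)
    (to_nat (Exec 0), Suc (code_length (u' @ [Sep])), ts)"
proof -
  let ?p = "code_length u'"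
  \<comment> \<open>A jump enters through the closing \<open>False\<close> of a preceding token, so
    its target cannot be the first token of the input. This is where a nonempty \<open>ini\<close>
    is used later.\<close>
  have u': "u' \<noteq> []" using assms by auto
  have 1: "univ_within d toks 2 (to_nat (Exec 0), Suc (code_length u), ts)
      (to_nat Free, Suc (code_length u + 1), ts)"
    using exec_token[OF toks(1), of d ts ts] by (simp add: token_exec_def move_input_def numeral_2_eq_2)
  have 2: "univ_within d toks len (to_nat Free, Suc (code_length u + 1), ts) (to_nat Free, ?p, ts)"
    by (rule free_move[of lo]) (use assms in auto)
  have "input_at (token_code toks) ?p = In False"
  proof -
    obtain u0 t where "u' = u0 @ [t]" using u' by (cases u' rule: rev_cases) auto
    then have "toks = u0 @ t # Sep # v'" "?p = Suc (code_length u0 + token_number t)"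
      using toks by auto
    with input_at_token[OF this(1) le_refl] show ?thesis by simp
  qed
  then have "step (universal d) (token_code toks) (to_nat Free, ?p, ts)
      (to_nat (Must 0), move_input (token_code toks) MoveR ?p, map2 act ts (hold (map scan ts)))"
    by (intro universal_step) simp
  then have 3: "univ_within d toks 1 (to_nat Free, ?p, ts) (to_nat (Must 0), Suc ?p, ts)"
    using toks(2) by (intro steps_le_step) (simp add: move_input_def)
  have "step (universal d) (token_code toks) (to_nat (Must 0), Suc ?p, ts)
      (to_nat (Must 1), move_input (token_code toks) MoveR (Suc ?p), map2 act ts (hold (map scan ts)))"
    using input_at_token[OF toks(2), of 0] by (intro universal_step) simp
  then have 4: "univ_within d toks 1 (to_nat (Must 0), Suc ?p, ts) (to_nat (Must 1), Suc (Suc ?p), ts)"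
    using move_input_token[OF toks(2), of 0] by (intro steps_le_step) simp
  have "step (universal d) (token_code toks) (to_nat (Must 1), Suc (Suc ?p), ts)
      (to_nat (Exec 0), move_input (token_code toks) MoveR (Suc (Suc ?p)), map2 act ts (hold (map scan ts)))"
    using input_at_token[OF toks(2), of 1] by (intro universal_step) simp
  then have 5: "univ_within d toks 1 (to_nat (Must 1), Suc (Suc ?p), ts) (to_nat (Exec 0), Suc (Suc (Suc ?p)), ts)"
    using move_input_token[OF toks(2), of 1] by (intro steps_le_step) simp
  show ?thesis
    using steps_le_trans[OF 1 steps_le_trans[OF 2 steps_le_trans[OF 3 steps_le_trans[OF 4 5]]]]
    by (simp add: numeral_eq_Suc)
qed

abbreviation separated :: "token list list \<Rightarrow> token list" where
  "separated rules \<equiv> concat (map (\<lambda>r. r @ [Sep]) rules)"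

text \<open>Whatever follows a separator is a rule or \<open>fin\<close>, so that each jump selects
  a rule to apply or the final test. \<open>pad\<close> stands behind \<open>Acc\<close>; free of
  separators, it offers no jump a target.\<close>

definition program :: "token list \<Rightarrow> token list list \<Rightarrow> token list \<Rightarrow> token list \<Rightarrow> token list" where
  "program ini rules fin pad = ini @ Sep # separated rules @ fin @ Acc # pad"

text \<open>This is the stretch in which all jumps take place. It leaves out \<open>ini\<close>,
  which will grow with the simulated input, and \<open>pad\<close>.\<close>

definition table_length :: "token list list \<Rightarrow> token list \<Rightarrow> nat" where
  "table_length rules fin = code_length (Sep # separated rules @ fin @ [Acc])"

locale token_program =
  fixes d :: nat and ini :: "token list" and rules :: "token list list" and fin pad :: "token list"
  assumes ini: "plain_tokens d ini" "ini \<noteq> []"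
    and rules: "\<And>r. r \<in> set rules \<Longrightarrow> plain_tokens d r"
    and fin: "plain_tokens d fin"
    and pad: "set pad \<subseteq> {Nop}"
begin

abbreviation "toks \<equiv> program ini rules fin pad"
abbreviation "tlen \<equiv> table_length rules fin"

definition rule_rel :: "tape list \<Rightarrow> tape list \<Rightarrow> bool" where
  "rule_rel ts ts' \<longleftrightarrow> (\<exists>r\<in>set rules. run_tokens r ts = Some ts')"

lemma concat_Sep: "\<exists>x. Sep # separated rs = x @ [Sep]"
  by (cases rs rule: rev_cases) auto

lemma rule_occurs:
  assumes "r \<in> set rules"
  shows "\<exists>x v. toks = (ini @ x) @ Sep # r @ Sep # v \<and> code_length (x @ Sep # r @ [Sep]) \<le> tlen"
proof -
  obtain rs1 rs2 where rs: "rules = rs1 @ r # rs2" using assms by (meson split_list)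
  obtain x where x: "Sep # separated rs1 = x @ [Sep]"
    using concat_Sep by blast
  let ?v = "separated rs2 @ fin @ [Acc]"
  have 1: "Sep # separated rules @ fin @ [Acc] = (x @ [Sep]) @ r @ Sep # ?v"
    unfolding x[symmetric] by (simp add: rs)
  then have "toks = (ini @ x) @ Sep # r @ Sep # ?v @ pad"
    by (simp add: program_def)
  moreover have "code_length (x @ Sep # r @ [Sep]) \<le> tlen"
    unfolding table_length_def 1 by simp
  ultimately show ?thesis by blast
qed

lemma fin_occurs:
  "\<exists>x. toks = (ini @ x) @ Sep # fin @ Acc # pad \<and> code_length (x @ Sep # fin @ [Acc]) \<le> tlen"
proof -
  obtain x where x: "Sep # separated rules = x @ [Sep]"
    using concat_Sep by blast
  have 1: "Sep # separated rules @ fin @ [Acc] = (x @ [Sep]) @ fin @ [Acc]"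
    unfolding x[symmetric] by simp
  then have "toks = (ini @ x) @ Sep # fin @ Acc # pad"
    by (simp add: program_def)
  moreover have "code_length (x @ Sep # fin @ [Acc]) \<le> tlen"
    unfolding table_length_def 1 by simp
  ultimately show ?thesis by blast
qed

lemma length_program: "code_length ini + tlen \<le> code_length toks"
  by (simp add: program_def table_length_def)

lemma length_ini_pos: "0 < code_length ini"
  using ini(2) by (cases ini) auto

text \<open>Between two rules the machine is about to read some separator of the table. One further
  rule costs a jump of at most \<open>tlen + 5\<close> steps and an execution of at most
  \<open>tlen\<close>.\<close>

lemma rules_run:
  assumes "run_tokens ini (empty_tapes d) = Some ts1" "(rule_rel ^^ k) ts1 ts2"
  shows "\<exists>x v. toks = (ini @ x) @ Sep # v \<and> code_length (x @ [Sep]) \<le> tlen \<and>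
    univ_within d toks (1 + code_length ini + k * (2 * tlen + 5))
      (initial (universal d)) (to_nat (Exec 0), Suc (code_length (ini @ x)), ts2)"
  using assms(2)
proof (induction k arbitrary: ts2)
  case 0
  have "step (universal d) (token_code toks) (initial (universal d)) (to_nat (Exec 0), 1, empty_tapes d)"
    using universal_step[of "Exec 0" MoveR "hold (map scan (empty_tapes d))" d "Exec 0" "token_code toks" 0 "empty_tapes d"]
      act_hold[of "empty_tapes d"]
    by (simp add: initial_def empty_tapes_def input_at_def move_input_def)
  moreover have "univ_within d toks (code_length ini) (to_nat (Exec 0), Suc (code_length []), empty_tapes d)
      (to_nat (Exec 0), Suc (code_length ([] @ ini)), ts1)"
    by (rule exec_tokens[OF _ ini(1) assms(1)]) (simp add: program_def)
  ultimately have "univ_within d toks (1 + code_length ini) (initial (universal d))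
      (to_nat (Exec 0), Suc (code_length (ini @ [])), ts1)"
    using steps_le_trans[OF steps_le_step] by simp
  moreover have "toks = (ini @ []) @ Sep # separated rules @ fin @ Acc # pad"
    by (simp add: program_def)
  moreover have "code_length ([] @ [Sep]) \<le> tlen" by (simp add: table_length_def)
  ultimately show ?case using 0 by (intro exI[of _ "[]"] exI[of _ "separated rules @ fin @ Acc # pad"]) simp
next
  case (Suc k)
  then obtain tsk where k: "(rule_rel ^^ k) ts1 tsk" and "rule_rel tsk ts2" by auto
  then obtain r where r: "r \<in> set rules" "run_tokens r tsk = Some ts2"
    unfolding rule_rel_def by blast
  obtain x v where x: "toks = (ini @ x) @ Sep # v" "code_length (x @ [Sep]) \<le> tlen"
    "univ_within d toks (1 + code_length ini + k * (2 * tlen + 5))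
      (initial (universal d)) (to_nat (Exec 0), Suc (code_length (ini @ x)), tsk)"
    using Suc.IH[OF k] by blast
  obtain y v' where y: "toks = (ini @ y) @ Sep # r @ Sep # v'" "code_length (y @ Sep # r @ [Sep]) \<le> tlen"
    using rule_occurs[OF r(1)] by blast
  have 1: "univ_within d toks (tlen + 5) (to_nat (Exec 0), Suc (code_length (ini @ x)), tsk)
      (to_nat (Exec 0), Suc (code_length ((ini @ y) @ [Sep])), tsk)"
    by (rule jump_to_Sep[OF x(1) y(1), of "code_length ini"])
      (use x y length_ini_pos length_program in auto)
  have 2: "univ_within d toks (code_length r) (to_nat (Exec 0), Suc (code_length ((ini @ y) @ [Sep])), tsk)
      (to_nat (Exec 0), Suc (code_length (((ini @ y) @ [Sep]) @ r)), ts2)"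
    by (rule exec_tokens[OF _ rules[OF r(1)] r(2)]) (use y in simp)
  from steps_le_trans[OF x(3) steps_le_trans[OF 1 2]]
  have "univ_within d toks (1 + code_length ini + Suc k * (2 * tlen + 5))
      (initial (universal d)) (to_nat (Exec 0), Suc (code_length (ini @ (y @ Sep # r))), ts2)"
    unfolding append_assoc append.simps by (rule steps_le_mono) (use y(2) in simp)
  then show ?case
    by (intro exI[of _ "y @ Sep # r"] exI[of _ v']) (use y in simp)
qed

lemma program_complete:
  assumes "run_tokens ini (empty_tapes d) = Some ts1" "(rule_rel ^^ k) ts1 ts2"
    and "run_tokens fin ts2 = Some ts3"
  shows "\<exists>n q i ts. runs (universal d) (token_code toks) n (q, i, ts) \<and>
    q \<in> accepting (universal d) \<and> n \<le> code_length ini + Suc k * (2 * tlen + 5) + 4"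
proof -
  obtain x v where x: "toks = (ini @ x) @ Sep # v" "code_length (x @ [Sep]) \<le> tlen"
    "univ_within d toks (1 + code_length ini + k * (2 * tlen + 5))
      (initial (universal d)) (to_nat (Exec 0), Suc (code_length (ini @ x)), ts2)"
    using rules_run[OF assms(1,2)] by blast
  obtain y where y: "toks = (ini @ y) @ Sep # fin @ Acc # pad" "code_length (y @ Sep # fin @ [Acc]) \<le> tlen"
    using fin_occurs by blast
  have 1: "univ_within d toks (tlen + 5) (to_nat (Exec 0), Suc (code_length (ini @ x)), ts2)
      (to_nat (Exec 0), Suc (code_length ((ini @ y) @ [Sep])), ts2)"
    by (rule jump_to_Sep[OF x(1) y(1), of "code_length ini"])
      (use x y length_ini_pos length_program in auto)
  have 2: "univ_within d toks (code_length fin) (to_nat (Exec 0), Suc (code_length ((ini @ y) @ [Sep])), ts2)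
      (to_nat (Exec 0), Suc (code_length (((ini @ y) @ [Sep]) @ fin)), ts3)"
    by (rule exec_tokens[OF _ fin assms(3)]) (use y in simp)
  have 3: "\<exists>i. univ_within d toks 3 (to_nat (Exec 0), Suc (code_length (((ini @ y) @ [Sep]) @ fin)), ts3)
      (to_nat Accepted, i, ts3)"
    using exec_token[of toks "((ini @ y) @ [Sep]) @ fin" Acc pad d ts3 ts3] y(1)
    by (auto simp: token_exec_def numeral_eq_Suc)
  then obtain i where 3: "univ_within d toks 3 (to_nat (Exec 0), Suc (code_length (((ini @ y) @ [Sep]) @ fin)), ts3)
      (to_nat Accepted, i, ts3)" by blast
  have "univ_within d toks (code_length ini + Suc k * (2 * tlen + 5) + 4)
      (initial (universal d)) (to_nat Accepted, i, ts3)"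
    by (rule steps_le_mono[OF steps_le_trans[OF x(3) steps_le_trans[OF 1 steps_le_trans[OF 2 3]]]])
      (use y(2) in simp)
  then show ?thesis unfolding steps_le_def by fastforce
qed

section \<open>Soundness of token programs\<close>

lemma Sep_decomposition:
  assumes "Sep # separated rs @ tail = u @ Sep # v"
    and "\<And>r. r \<in> set rs \<Longrightarrow> Sep \<notin> set r" "Sep \<notin> set tail"
  shows "v = tail \<or> (\<exists>r\<in>set rs. \<exists>v'. v = r @ Sep # v')"
  using assms
proof (induction rs arbitrary: u)
  case Nil
  show ?case
  proof (cases u)
    case (Cons a u')
    then have "tail = u' @ Sep # v" using Nil by simp
    then show ?thesis using Nil(3) by auto
  qed (use Nil in simp)
next
  case (Cons r rs)
  show ?case
  proof (cases u)
    case Nil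
    then show ?thesis using Cons.prems by auto
  next
    case (Cons a u')
    then have eq: "r @ (Sep # separated rs @ tail) = u' @ Sep # v"
      using Cons.prems by simp
    then obtain us where "(r = u' @ us \<and> us @ Sep # separated rs @ tail = Sep # v) \<or>
        (r @ us = u' \<and> Sep # separated rs @ tail = us @ Sep # v)"
      unfolding append_eq_append_conv2 by blast
    then show ?thesis
    proof
      assume a: "r = u' @ us \<and> us @ Sep # separated rs @ tail = Sep # v"
      have "Sep \<notin> set us" using a Cons.prems(2)[of r] by auto
      then have "us = []" using a by (cases us) auto
      then have "Sep # separated rs @ tail = [] @ Sep # v" using a by simp
      from Cons.IH[OF this] Cons.prems(2,3) show ?thesis by auto
    next
      assume "r @ us = u' \<and> Sep # separated rs @ tail = us @ Sep # v"
      then have "Sep # separated rs @ tail = us @ Sep # v" by blast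
      from Cons.IH[OF this] Cons.prems(2,3) show ?thesis by auto
    qed
  qed
qed

text \<open>Neither \<open>ini\<close> nor a rule nor \<open>fin\<close> nor \<open>pad\<close>
  contains a separator, so each separator is one that \<open>program\<close> inserts.\<close>

lemma after_Sep:
  assumes "toks = u @ Sep # v"
  shows "v = fin @ Acc # pad \<or> (\<exists>r\<in>set rules. \<exists>v'. v = r @ Sep # v')"
proof -
  have noSep: "Sep \<notin> set (fin @ Acc # pad)" using fin pad by (auto simp: plain_tokens_def)
  have "\<exists>u'. Sep # separated rules @ fin @ Acc # pad = u' @ Sep # v"
  proof -
    have eq: "ini @ (Sep # separated rules @ fin @ Acc # pad) = u @ Sep # v"
      using assms by (simp add: program_def)
    then obtain us where "(ini = u @ us \<and> us @ Sep # separated rules @ fin @ Acc # pad = Sep # v) \<or>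
        (ini @ us = u \<and> Sep # separated rules @ fin @ Acc # pad = us @ Sep # v)"
      unfolding append_eq_append_conv2 by blast
    then show ?thesis
    proof
      assume a: "ini = u @ us \<and> us @ Sep # separated rules @ fin @ Acc # pad = Sep # v"
      have "Sep \<notin> set us" using a ini by (auto simp: plain_tokens_def)
      then have "us = []" using a by (cases us) auto
      then show ?thesis using a by (intro exI[of _ "[]"]) simp
    qed blast
  qed
  then show ?thesis
    using Sep_decomposition[of rules "fin @ Acc # pad" _ v] rules noSep by (auto simp: plain_tokens_def)
qed

text \<open>The list \<open>v\<close> behind the next separator stays arbitrary, because a separator
  is left only by a jump, and \<open>after_Sep\<close> then tells where the jump lands.\<close>

inductive program_inv :: "token list \<Rightarrow> tape list \<Rightarrow> bool" where
  in_ini: "ini = p @ q \<Longrightarrow> run_tokens p (empty_tapes d) = Some ts \<Longrightarrow> program_inv (q @ Sep # v) ts"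
| in_rule: "r \<in> set rules \<Longrightarrow> r = p @ q \<Longrightarrow> run_tokens ini (empty_tapes d) = Some ts1 \<Longrightarrow>
    rule_rel\<^sup>*\<^sup>* ts1 ts2 \<Longrightarrow> run_tokens p ts2 = Some ts \<Longrightarrow> program_inv (q @ Sep # v) ts"
| in_fin: "fin = p @ q \<Longrightarrow> run_tokens ini (empty_tapes d) = Some ts1 \<Longrightarrow>
    rule_rel\<^sup>*\<^sup>* ts1 ts2 \<Longrightarrow> run_tokens p ts2 = Some ts \<Longrightarrow> program_inv (q @ Acc # pad) ts"

lemma program_inv_Sep:
  assumes "program_inv (Sep # v) ts"
  shows "\<exists>ts1. run_tokens ini (empty_tapes d) = Some ts1 \<and> rule_rel\<^sup>*\<^sup>* ts1 ts"
  using assms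
proof cases
  case (in_ini p q v0)
  then have "q = []" using ini(1) by (cases q) (auto simp: plain_tokens_def)
  then show ?thesis using in_ini by auto
next
  case (in_rule r p q ts1 ts2 v0)
  then have "q = []" using rules[of r] by (cases q) (auto simp: plain_tokens_def)
  then have "rule_rel ts2 ts" using in_rule unfolding rule_rel_def by auto
  then show ?thesis using in_rule by (meson rtranclp.rtrancl_into_rtrancl)
next
  case (in_fin p q ts1 ts2)
  have False using in_fin fin
    by (cases q) (auto simp: plain_tokens_def)
  then show ?thesis ..
qed

lemma token_reach_inv:
  assumes "token_reach toks (empty_tapes d) v ts"
  shows "program_inv v ts"
  using assms
proof (induction rule: token_reach.induct)
  case init
  show ?case unfolding program_def
    by (rule program_inv.in_ini[of "[]"]) auto
next
  case (tok t v ts ts')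
  from tok.IH show ?case
  proof cases
    case (in_ini p q v0)
    then obtain q' where q: "q = t # q'" using tok.hyps by (cases q) auto
    have "run_tokens (p @ [t]) (empty_tapes d) = Some ts'"
      using in_ini tok.hyps by (simp add: run_tokens_append)
    then show ?thesis using program_inv.in_ini[of "p @ [t]" q' ts' v0] in_ini q by simp
  next
    case (in_rule r p q ts1 ts2 v0)
    then obtain q' where q: "q = t # q'" using tok.hyps by (cases q) auto
    have "run_tokens (p @ [t]) ts2 = Some ts'"
      using in_rule tok.hyps by (simp add: run_tokens_append)
    then show ?thesis using program_inv.in_rule[of r "p @ [t]" q' ts1 ts2 ts' v0] in_rule q by simp
  next
    case (in_fin p q ts1 ts2)
    then obtain q' where q: "q = t # q'" using tok.hyps by (cases q) auto
    have "run_tokens (p @ [t]) ts2 = Some ts'"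
      using in_fin tok.hyps by (simp add: run_tokens_append)
    then show ?thesis using program_inv.in_fin[of "p @ [t]" q' ts1 ts2 ts'] in_fin q by simp
  qed
next
  case (jump v ts u v')
  obtain ts1 where ts1: "run_tokens ini (empty_tapes d) = Some ts1" "rule_rel\<^sup>*\<^sup>* ts1 ts"
    using program_inv_Sep[OF jump.IH] by blast
  from after_Sep[OF jump.hyps(2)] show ?case
  proof
    assume "v' = fin @ Acc # pad"
    then show ?thesis using program_inv.in_fin[of "[]" fin ts1 ts ts] ts1 by simp
  next
    assume "\<exists>r\<in>set rules. \<exists>v''. v' = r @ Sep # v''"
    then show ?thesis using program_inv.in_rule[of _ "[]" _ ts1 ts ts] ts1 by fastforce
  qed
qed

lemma program_sound:
  assumes "reaches (universal d) (token_code toks) (q, i, ts)"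
    and "q \<in> accepting (universal d)"
  shows "\<exists>ts1 ts2 ts3. run_tokens ini (empty_tapes d) = Some ts1 \<and> rule_rel\<^sup>*\<^sup>* ts1 ts2 \<and>
    run_tokens fin ts2 = Some ts3"
proof -
  obtain v ts where "token_reach toks (empty_tapes d) (Acc # v) ts"
    using universal_sound[OF assms] by blast
  from token_reach_inv[OF this] show ?thesis
  proof cases
    case (in_ini p q v0)
    have False using in_ini ini(1)
      by (cases q) (auto simp: plain_tokens_def)
    then show ?thesis ..
  next
    case (in_rule r p q ts1 ts2 v0)
    have False using in_rule rules[of r] by (cases q) (auto simp: plain_tokens_def)
    then show ?thesis ..
  next
    case (in_fin p q ts1 ts2)
    have "q = []" using in_fin fin
      by (cases q) (auto simp: plain_tokens_def)
    then show ?thesis using in_fin by auto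
  qed
qed

end

section \<open>Stack operations on coded symbols\<close>

text \<open>The head is on the cell above the top of the stack. From the head on, the tape may hold
  anything: popped bits stay there until they are overwritten. The blanks below the bottom make a
  pop from the empty stack fail.\<close>

definition stack_tape :: "tape \<Rightarrow> bool list \<Rightarrow> bool" where
  "stack_tape T bs \<longleftrightarrow>
     (\<forall>i. fst T (snd T - 1 - int i) = (if i < length bs then Bit (bs ! i) else Blank))"

lemma stack_tape_push:
  assumes "stack_tape T bs"
  shows "stack_tape (act T (Bit b, MoveR)) (b # bs)"
proof -
  obtain t h where T: "T = (t, h)" by (cases T)
  have "(t(h := Bit b)) (h - int i) = (if i < Suc (length bs) then Bit ((b # bs) ! i) else Blank)" for i
  proof (cases i)
    case (Suc j)
    have "t (h - 1 - int j) = (if j < length bs then Bit (bs ! j) else Blank)"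
      using assms by (auto simp: stack_tape_def T)
    moreover have "h - 1 - int j = h - int i" using Suc by simp
    ultimately show ?thesis using Suc by simp
  qed simp
  then show ?thesis by (simp add: stack_tape_def T)
qed

lemma stack_tape_left:
  assumes "stack_tape T bs"
  shows "scan (act T (scan T, MoveL)) = (case bs of [] \<Rightarrow> Blank | b # _ \<Rightarrow> Bit b)"
    and "stack_tape (act T (scan T, MoveL)) (tl bs)"
proof -
  obtain t h where T: "T = (t, h)" by (cases T)
  have t: "t (h - 1 - int i) = (if i < length bs then Bit (bs ! i) else Blank)" for i
    using assms by (auto simp: stack_tape_def T)
  show "scan (act T (scan T, MoveL)) = (case bs of [] \<Rightarrow> Blank | b # _ \<Rightarrow> Bit b)"
    using t[of 0] by (cases bs) (auto simp: T)
  have "t (h - 1 - 1 - int i) = (if i < length (tl bs) then Bit (tl bs ! i) else Blank)" for i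
    using t[of "Suc i"] by (cases bs) (auto simp: algebra_simps)
  then show "stack_tape (act T (scan T, MoveL)) (tl bs)"
    by (simp add: stack_tape_def T)
qed

definition stack_tapes :: "nat \<Rightarrow> tape list \<Rightarrow> (nat \<Rightarrow> bool list) \<Rightarrow> bool" where
  "stack_tapes d ts \<sigma> \<longleftrightarrow> length ts = d \<and> (\<forall>s<d. stack_tape (ts ! s) (\<sigma> s))"

lemma stack_tapes_update:
  assumes "stack_tapes d ts \<sigma>" "stack_tape T bs"
  shows "stack_tapes d (ts[s := T]) (\<sigma>(s := bs))"
  using assms by (auto simp: stack_tapes_def nth_list_update)

lemma stack_tapes_empty: "stack_tapes d (empty_tapes d) (\<lambda>_. [])"
  by (auto simp: stack_tapes_def stack_tape_def empty_tapes_def)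

lemma map2_act_update:
  "map2 act ts ((hold (map scan ts))[s := x]) = ts[s := act (ts ! s) x]"
  if "s < length ts"
  using that by (intro nth_equalityI) (auto simp: nth_list_update hold_def)

lemma token_exec_simps:
  assumes "s < length ts"
  shows "token_exec (PushT s b) ts = Some (ts[s := act (ts ! s) (Bit b, MoveR)])"
    and "token_exec (LeftT s) ts = Some (ts[s := act (ts ! s) (scan (ts ! s), MoveL)])"
    and "token_exec (TestT s b) ts = (if scan (ts ! s) = Bit b then Some ts else None)"
  using assms by (simp_all add: token_exec_def map2_act_update)

fun strip_prefix :: "'a list \<Rightarrow> 'a list \<Rightarrow> 'a list option" where
  "strip_prefix [] ys = Some ys"
| "strip_prefix (x # xs) [] = None"
| "strip_prefix (x # xs) (y # ys) = (if x = y then strip_prefix xs ys else None)"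

definition pop_tokens :: "nat \<Rightarrow> bool list \<Rightarrow> token list" where
  "pop_tokens s bs = concat (map (\<lambda>b. [LeftT s, TestT s b]) bs)"

text \<open>\<open>rel_option\<close> states at once that the tokens fail exactly when the abstract
  operation fails and that the results correspond otherwise; soundness and completeness thus come
  from one induction.\<close>

lemma run_pop_tokens:
  assumes "stack_tapes d ts \<sigma>" "s < d"
  shows "rel_option (\<lambda>ts' bs'. stack_tapes d ts' (\<sigma>(s := bs')))
    (run_tokens (pop_tokens s bs) ts) (strip_prefix bs (\<sigma> s))"
  using assms(1)
proof (induction bs arbitrary: ts \<sigma>)
  case Nil
  have "\<sigma>(s := \<sigma> s) = \<sigma>" by simp
  with Nil show ?case unfolding pop_tokens_def by (simp del: fun_upd_apply)
next
  case (Cons b bs)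
  have s: "s < length ts" "stack_tape (ts ! s) (\<sigma> s)"
    using Cons.prems assms(2) by (auto simp: stack_tapes_def)
  let ?T = "act (ts ! s) (scan (ts ! s), MoveL)"
  have run: "run_tokens (pop_tokens s (b # bs)) ts =
      (if scan ?T = Bit b then run_tokens (pop_tokens s bs) (ts[s := ?T]) else None)"
    using s(1) by (simp add: pop_tokens_def token_exec_simps)
  show ?case
  proof (cases "\<sigma> s")
    case Nil
    then show ?thesis unfolding run using stack_tape_left(1)[OF s(2)] by simp
  next
    case (Cons y ys)
    have "stack_tapes d (ts[s := ?T]) (\<sigma>(s := ys))"
      using stack_tapes_update[OF Cons.prems stack_tape_left(2)[OF s(2)]] Cons by simp
    from Cons.IH[OF this] show ?thesis
      unfolding run using stack_tape_left(1)[OF s(2)] Cons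
      by (simp add: fun_upd_upd fun_upd_same del: fun_upd_apply)
  qed
qed

lemma run_push_tokens:
  assumes "stack_tapes d ts \<sigma>" "s < d"
  shows "\<exists>ts'. run_tokens (map (PushT s) bs) ts = Some ts' \<and> stack_tapes d ts' (\<sigma>(s := rev bs @ \<sigma> s))"
  using assms(1)
proof (induction bs arbitrary: ts \<sigma>)
  case Nil
  then show ?case by simp
next
  case (Cons b bs)
  have s: "s < length ts" "stack_tape (ts ! s) (\<sigma> s)"
    using Cons.prems assms(2) by (auto simp: stack_tapes_def)
  have "run_tokens (map (PushT s) (b # bs)) ts =
      run_tokens (map (PushT s) bs) (ts[s := act (ts ! s) (Bit b, MoveR)])"
    using s(1) by (simp add: token_exec_simps)
  moreover have "(\<sigma>(s := b # \<sigma> s))(s := rev bs @ (\<sigma>(s := b # \<sigma> s)) s) =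
      \<sigma>(s := rev (b # bs) @ \<sigma> s)"
    by (simp add: fun_eq_iff)
  ultimately show ?case
    using Cons.IH[OF stack_tapes_update[OF Cons.prems stack_tape_push[OF s(2), of b], of s]] by metis
qed

section \<open>Stack operations over a countable alphabet\<close>

datatype 'g op = Push nat 'g | Pop nat 'g

fun op_stack :: "'g op \<Rightarrow> nat" where
  "op_stack (Push s g) = s"
| "op_stack (Pop s g) = s"

fun exec_op :: "'g op \<Rightarrow> (nat \<Rightarrow> 'g list) \<Rightarrow> (nat \<Rightarrow> 'g list) option" where
  "exec_op (Push s g) \<sigma> = Some (\<sigma>(s := g # \<sigma> s))"
| "exec_op (Pop s g) \<sigma> =
     (case \<sigma> s of [] \<Rightarrow> None | x # xs \<Rightarrow> if x = g then Some (\<sigma>(s := xs)) else None)"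

fun exec_ops :: "'g op list \<Rightarrow> (nat \<Rightarrow> 'g list) \<Rightarrow> (nat \<Rightarrow> 'g list) option" where
  "exec_ops [] \<sigma> = Some \<sigma>"
| "exec_ops (x # xs) \<sigma> = Option.bind (exec_op x \<sigma>) (exec_ops xs)"

lemma exec_ops_append: "exec_ops (u @ v) \<sigma> = Option.bind (exec_ops u \<sigma>) (exec_ops v)"
  by (induction u arbitrary: \<sigma>) (auto split: Option.bind_splits)

text \<open>The code is prefix-free and stored with its first bit on top of the stack, so the bits of
  a stack determine its symbols and a pop can be checked bit by bit.\<close>
definition symbol_code :: "'g :: countable \<Rightarrow> bool list" where
  "symbol_code g = replicate (to_nat g) True @ [False]"

definition stack_code :: "('g :: countable) list \<Rightarrow> bool list" where
  "stack_code gs = concat (map symbol_code gs)"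

lemma strip_replicate:
  "strip_prefix (replicate n True @ [False]) (replicate m True @ False # ys) =
    (if n = m then Some ys else None)"
proof (induction n arbitrary: m)
  case 0
  then show ?case by (cases m) auto
next
  case (Suc n)
  then show ?case by (cases m) auto
qed

lemma strip_symbol_code:
  "strip_prefix (symbol_code g) (stack_code xs) =
    (case xs of [] \<Rightarrow> None | x # xs' \<Rightarrow> if x = g then Some (stack_code xs') else None)"
proof (cases xs)
  case Nil
  then show ?thesis by (cases "to_nat g") (auto simp: stack_code_def symbol_code_def)
next
  case (Cons x xs')
  then show ?thesis
    using strip_replicate[of "to_nat g" "to_nat x" "stack_code xs'"]
    by (auto simp: stack_code_def symbol_code_def)
qed

text \<open>A push writes the code in reverse, so that its first bit ends up on top, where a pop
  begins its comparison.\<close>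

fun op_tokens :: "('g :: countable) op \<Rightarrow> token list" where
  "op_tokens (Push s g) = map (PushT s) (rev (symbol_code g))"
| "op_tokens (Pop s g) = pop_tokens s (symbol_code g)"

definition ops_tokens :: "('g :: countable) op list \<Rightarrow> token list" where
  "ops_tokens xs = concat (map op_tokens xs)"

definition represents :: "nat \<Rightarrow> tape list \<Rightarrow> (nat \<Rightarrow> ('g :: countable) list) \<Rightarrow> bool" where
  "represents d ts \<sigma> \<longleftrightarrow> stack_tapes d ts (\<lambda>s. stack_code (\<sigma> s))"

lemma stack_code_update: "(\<lambda>s'. stack_code ((\<sigma>(s := gs)) s')) = (\<lambda>s'. stack_code (\<sigma> s'))(s := stack_code gs)"
  by auto

lemma run_op_tokens:
  assumes "represents d ts \<sigma>" "op_stack x < d"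
  shows "rel_option (represents d) (run_tokens (op_tokens x) ts) (exec_op x \<sigma>)"
proof (cases x)
  case (Push s g)
  then have "s < d" using assms(2) by simp
  from run_push_tokens[OF assms(1)[unfolded represents_def] this, of "rev (symbol_code g)"]
  obtain ts' where "run_tokens (op_tokens x) ts = Some ts'"
    "stack_tapes d ts' ((\<lambda>s. stack_code (\<sigma> s))(s := symbol_code g @ stack_code (\<sigma> s)))"
    using Push by auto
  then show ?thesis
    using Push stack_code_update[of \<sigma> s "g # \<sigma> s"] by (simp add: represents_def stack_code_def)
next
  case (Pop s g)
  then have "s < d" using assms(2) by simp
  from run_pop_tokens[OF assms(1)[unfolded represents_def] this, of "symbol_code g"] show ?thesis
    using Pop unfolding strip_symbol_code
    by (cases "\<sigma> s") (auto simp: represents_def stack_code_update[symmetric] option.rel_sel split: if_splits)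
qed

lemma run_ops_tokens:
  assumes "represents d ts \<sigma>" "\<And>x. x \<in> set xs \<Longrightarrow> op_stack x < d"
  shows "rel_option (represents d) (run_tokens (ops_tokens xs) ts) (exec_ops xs \<sigma>)"
  using assms
proof (induction xs arbitrary: ts \<sigma>)
  case Nil
  then show ?case by (simp add: ops_tokens_def)
next
  case (Cons x xs)
  have run: "run_tokens (ops_tokens (x # xs)) ts =
      Option.bind (run_tokens (op_tokens x) ts) (run_tokens (ops_tokens xs))"
    by (simp add: ops_tokens_def run_tokens_append)
  have "rel_option (represents d) (run_tokens (op_tokens x) ts) (exec_op x \<sigma>)"
    using Cons.prems by (intro run_op_tokens) auto
  then show ?case
  proof (cases rule: option.rel_cases)
    case None
    then show ?thesis unfolding run by simp
  next
    case (Some ts' \<sigma>')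
    then have "rel_option (represents d) (run_tokens (ops_tokens xs) ts') (exec_ops xs \<sigma>')"
      using Cons by simp
    then show ?thesis unfolding run using Some by simp
  qed
qed

lemma plain_pop_tokens: "s < d \<Longrightarrow> plain_tokens d (pop_tokens s bs)"
  by (auto simp: plain_tokens_def pop_tokens_def)

lemma plain_ops_tokens:
  assumes "\<And>x. x \<in> set xs \<Longrightarrow> op_stack x < d"
  shows "plain_tokens d (ops_tokens xs)"
proof -
  have "plain_tokens d (op_tokens x)" if "op_stack x < d" for x :: "'a op"
    using that plain_pop_tokens by (cases x) (auto simp: plain_tokens_def)
  then show ?thesis using assms
    by (induction xs) (auto simp: ops_tokens_def)
qed

lemma run_Nops: "run_tokens (replicate n Nop) ts = Some ts"
  by (induction n) (auto simp: token_exec_def)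

definition ops_rel :: "'g op list list \<Rightarrow> (nat \<Rightarrow> 'g list) \<Rightarrow> (nat \<Rightarrow> 'g list) \<Rightarrow> bool" where
  "ops_rel rules \<sigma> \<sigma>' \<longleftrightarrow> (\<exists>r\<in>set rules. exec_ops r \<sigma> = Some \<sigma>')"

text \<open>\<open>ini\<close> is a token list and not a list of stack operations, because the
  loading of the input will be interspersed with padding.\<close>

locale stack_program =
  fixes d :: nat and ini :: "token list" and rules :: "('g :: countable) op list list"
    and fin :: "'g op list" and pad :: "token list" and ts1 :: "tape list" and \<sigma>1 :: "nat \<Rightarrow> 'g list"
  assumes ini: "plain_tokens d ini" "ini \<noteq> []"
    and rules_bound: "\<And>r x. r \<in> set rules \<Longrightarrow> x \<in> set r \<Longrightarrow> op_stack x < d"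
    and fin_bound: "\<And>x. x \<in> set fin \<Longrightarrow> op_stack x < d"
    and pad: "set pad \<subseteq> {Nop}"
    and run_ini: "run_tokens ini (empty_tapes d) = Some ts1" "represents d ts1 \<sigma>1"
begin

sublocale token_program d ini "map ops_tokens rules" "ops_tokens fin" pad
  by unfold_locales (use ini pad in \<open>auto intro!: plain_ops_tokens intro: rules_bound fin_bound\<close>)

lemma rule_rel_represents:
  assumes "represents d ts \<sigma>"
  shows "rule_rel ts ts' \<Longrightarrow> \<exists>\<sigma>'. ops_rel rules \<sigma> \<sigma>' \<and> represents d ts' \<sigma>'"
    and "ops_rel rules \<sigma> \<sigma>' \<Longrightarrow> \<exists>ts'. rule_rel ts ts' \<and> represents d ts' \<sigma>'"
proof -
  have *: "rel_option (represents d) (run_tokens (ops_tokens r) ts) (exec_ops r \<sigma>)" if "r \<in> set rules" for r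
    using run_ops_tokens[OF assms] rules_bound[OF that] by blast
  show "\<exists>\<sigma>'. ops_rel rules \<sigma> \<sigma>' \<and> represents d ts' \<sigma>'" if rr: "rule_rel ts ts'"
  proof -
    obtain r where r: "r \<in> set rules" "run_tokens (ops_tokens r) ts = Some ts'"
      using rr by (auto simp: rule_rel_def)
    from *[OF r(1)] r(2) obtain \<sigma>' where "exec_ops r \<sigma> = Some \<sigma>'" "represents d ts' \<sigma>'"
      by (cases "exec_ops r \<sigma>") auto
    with r show ?thesis by (auto simp: ops_rel_def)
  qed
  show "\<exists>ts'. rule_rel ts ts' \<and> represents d ts' \<sigma>'" if oo: "ops_rel rules \<sigma> \<sigma>'"
  proof -
    obtain r where r: "r \<in> set rules" "exec_ops r \<sigma> = Some \<sigma>'"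
      using oo by (auto simp: ops_rel_def)
    from *[OF r(1)] r(2) obtain ts' where "run_tokens (ops_tokens r) ts = Some ts'" "represents d ts' \<sigma>'"
      by (cases "run_tokens (ops_tokens r) ts") auto
    with r show ?thesis by (auto simp: rule_rel_def)
  qed
qed

lemma stack_program_sound:
  assumes "reaches (universal d) (token_code toks) (q, i, ts)"
    and "q \<in> accepting (universal d)"
  shows "\<exists>\<sigma>2. (ops_rel rules)\<^sup>*\<^sup>* \<sigma>1 \<sigma>2 \<and> exec_ops fin \<sigma>2 \<noteq> None"
proof -
  obtain ts2 ts3 where ts2: "rule_rel\<^sup>*\<^sup>* ts1 ts2" "run_tokens (ops_tokens fin) ts2 = Some ts3"
    using program_sound[OF assms] run_ini by auto
  from ts2(1) have "\<exists>\<sigma>2. (ops_rel rules)\<^sup>*\<^sup>* \<sigma>1 \<sigma>2 \<and> represents d ts2 \<sigma>2"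
  proof (induction rule: rtranclp_induct)
    case base
    then show ?case using run_ini by blast
  next
    case (step y z)
    then show ?case using rule_rel_represents(1) by (meson rtranclp.rtrancl_into_rtrancl)
  qed
  then obtain \<sigma>2 where s: "(ops_rel rules)\<^sup>*\<^sup>* \<sigma>1 \<sigma>2" "represents d ts2 \<sigma>2" by blast
  from run_ops_tokens[of d ts2 \<sigma>2 fin, OF s(2) fin_bound] ts2(2) have "exec_ops fin \<sigma>2 \<noteq> None"
    by (cases "exec_ops fin \<sigma>2") auto
  with s show ?thesis by blast
qed

lemma stack_program_complete:
  assumes "(ops_rel rules ^^ k) \<sigma>1 \<sigma>2" "exec_ops fin \<sigma>2 \<noteq> None"
  shows "\<exists>n q i ts. runs (universal d) (token_code toks) n (q, i, ts) \<and>
    q \<in> accepting (universal d) \<and> n \<le> code_length ini + Suc k * (2 * tlen + 5) + 4"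
proof -
  have "\<exists>ts2. (rule_rel ^^ k) ts1 ts2 \<and> represents d ts2 \<sigma>2"
    by (rule relpowp_simulation[where R = "\<lambda>\<sigma> ts. represents d ts \<sigma>", OF _ run_ini(2) assms(1)])
      (rule rule_rel_represents(2))
  then obtain ts2 where ts2: "(rule_rel ^^ k) ts1 ts2" "represents d ts2 \<sigma>2" by blast
  from run_ops_tokens[of d ts2 \<sigma>2 fin, OF ts2(2) fin_bound] assms(2) obtain ts3 where "run_tokens (ops_tokens fin) ts2 = Some ts3"
    by (cases "run_tokens (ops_tokens fin) ts2") auto
  from program_complete[OF run_ini(1) ts2(1) this] show ?thesis .
qed

end

section \<open>Transcripts of computations\<close>

text \<open>A transition records what it reads as well as what it does; only thus can a single tape
  be compared with it in isolation.\<close>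

type_synonym transition =
  "nat \<times> input_symbol \<times> symbol list \<times> nat \<times> direction \<times> (symbol \<times> direction) list"

datatype cell = InS input_symbol | Wk symbol

fun source :: "transition \<Rightarrow> nat" where
  "source (q, a, ss, q', d, as) = q"

fun target :: "transition \<Rightarrow> nat" where
  "target (q, a, ss, q', d, as) = q'"

definition transitions :: "ntm \<Rightarrow> transition set" where
  "transitions M = {(q, a, ss, q', d, as). q \<in> states M \<and> ss \<in> scannable M \<and> (q', d, as) \<in> delta M q a ss}"

text \<open>A pseudo-transition that changes nothing; it records that the machine accepts and halts.\<close>
definition final_transitions :: "ntm \<Rightarrow> transition set" where
  "final_transitions M = {(q, a, ss, q', d, as).
     q \<in> accepting M \<and> ss \<in> scannable M \<and> delta M q a ss = {} \<and> q' = q \<and> d = Stay \<and> as = hold ss}"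

text \<open>For the same state and scanned symbols, the one kind needs \<open>delta\<close> nonempty
  and the other empty. So a final transition inside a transcript is recognisable as such.\<close>

lemma transitions_disjoint: "transitions M \<inter> final_transitions M = {}"
  unfolding transitions_def final_transitions_def by blast

lemma finite_direction: "finite (UNIV :: direction set)"
proof -
  have *: "(UNIV :: direction set) = {MoveL, Stay, MoveR}" using direction.exhaust by blast
  show ?thesis unfolding * by simp
qed

lemma finite_input_symbol: "finite (UNIV :: input_symbol set)"
proof -
  have *: "(UNIV :: input_symbol set) = {LeftEnd, RightEnd, In True, In False}"
  proof (intro UNIV_eq_I)
    show "a \<in> {LeftEnd, RightEnd, In True, In False}" for a by (cases a) auto
  qed
  show ?thesis unfolding * by simp
qed

lemma finite_scannable: "is_NTM M \<Longrightarrow> finite (scannable M)"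
  unfolding scannable_def is_NTM_def using finite_lists_length_eq[of "alphabet M" "tapes M"]
  by (simp add: conj_commute)

lemma finite_transitions:
  assumes "is_NTM M"
  shows "finite (transitions M)"
proof (rule finite_subset)
  let ?A = "{as. set as \<subseteq> alphabet M \<times> UNIV \<and> length as = tapes M} :: (symbol \<times> direction) list set"
  show "transitions M \<subseteq> states M \<times> UNIV \<times> scannable M \<times> states M \<times> UNIV \<times> ?A"
    using is_NTM_deltaD[OF assms] by (fastforce simp: transitions_def)
  have "finite ?A"
    using assms finite_direction by (intro finite_lists_length_eq) (auto simp: is_NTM_def)
  then show "finite (states M \<times> (UNIV :: input_symbol set) \<times> scannable M \<times> states M \<times> (UNIV :: direction set) \<times> ?A)"
    using assms finite_direction finite_input_symbol finite_scannable[OF assms]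
    by (intro finite_cartesian_product) (auto simp: is_NTM_def)
qed

lemma finite_final_transitions:
  assumes "is_NTM M"
  shows "finite (final_transitions M)"
proof (rule finite_subset)
  show "final_transitions M \<subseteq> (\<lambda>(q, a, ss). (q, a, ss, q, Stay, hold ss)) ` (states M \<times> UNIV \<times> scannable M)"
    using assms by (auto simp: final_transitions_def is_NTM_def image_iff)
  show "finite ((\<lambda>(q, a, ss). (q, a, ss, q, Stay, hold ss)) ` (states M \<times> (UNIV :: input_symbol set) \<times> scannable M))"
    using assms finite_input_symbol finite_scannable[OF assms]
    by (intro finite_imageI finite_cartesian_product) (auto simp: is_NTM_def)
qed

text \<open>Tape 0 is the input tape and tape \<open>j + 1\<close> the work tape with index \<open>j\<close>. The view of a transition from a
  tape consists of the symbol read, the symbol written and the effective move.\<close>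

fun input_direction :: "input_symbol \<Rightarrow> direction \<Rightarrow> direction" where
  "input_direction LeftEnd MoveL = Stay"
| "input_direction RightEnd MoveR = Stay"
| "input_direction _ d = d"

fun view :: "nat \<Rightarrow> transition \<Rightarrow> cell \<times> cell \<times> direction" where
  "view 0 (q, a, ss, q', d, as) = (InS a, InS a, input_direction a d)"
| "view (Suc j) (q, a, ss, q', d, as) = (Wk (ss ! j), Wk (fst (as ! j)), snd (as ! j))"

fun cells :: "ntm \<Rightarrow> nat \<Rightarrow> cell set" where
  "cells M 0 = range InS"
| "cells M (Suc j) = Wk ` alphabet M"

lemma finite_cells: "is_NTM M \<Longrightarrow> finite (cells M j)"
  using finite_input_symbol by (cases j) (auto simp: is_NTM_def)

text \<open>A tape segment is a pair of stacks: the cells left of the head, nearest first, and the cells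
  from the head on.\<close>
fun tape_move :: "cell set \<Rightarrow> cell \<times> cell \<times> direction \<Rightarrow> cell list \<times> cell list \<Rightarrow> (cell list \<times> cell list) option" where
  "tape_move S (a, b, d) (l, []) = None"
| "tape_move S (a, b, d) (l, x # r) = (if x \<noteq> a then None else
     (case d of MoveR \<Rightarrow> Some (b # l, r) | Stay \<Rightarrow> Some (l, b # r)
      | MoveL \<Rightarrow> (case l of [] \<Rightarrow> None | y # l' \<Rightarrow> if y \<in> S then Some (l', y # b # r) else None)))"

fun tape_moves :: "cell set \<Rightarrow> (cell \<times> cell \<times> direction) list \<Rightarrow> cell list \<times> cell list \<Rightarrow> (cell list \<times> cell list) option" where
  "tape_moves S [] z = Some z"
| "tape_moves S (v # vs) z = Option.bind (tape_move S v z) (tape_moves S vs)"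

lemma tape_moves_append:
  "tape_moves S (us @ vs) z = Option.bind (tape_moves S us z) (tape_moves S vs)"
  by (induction us arbitrary: z) (auto split: Option.bind_splits)

definition input_cells :: "bool list \<Rightarrow> cell list" where
  "input_cells w = map InS (LeftEnd # map In w @ [RightEnd])"

lemma length_input_cells [simp]: "length (input_cells w) = length w + 2"
  by (simp add: input_cells_def)

lemma nth_input_cells: "i \<le> length w + 1 \<Longrightarrow> input_cells w ! i = InS (input_at w i)"
  by (auto simp: input_cells_def input_at_def nth_Cons' nth_append)

text \<open>On a work tape the segment has to agree with the tape only as far as it reaches, and
  \<open>tape_move\<close> fails at its ends. A segment guessed too short can thus lose a
  computation but never admits a wrong one.\<close>

fun tape_rep :: "bool list \<Rightarrow> nat \<Rightarrow> cell list \<times> cell list \<Rightarrow> config \<Rightarrow> bool" where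
  "tape_rep w 0 z (q, i, ts) \<longleftrightarrow>
     i \<le> length w + 1 \<and> z = (rev (take i (input_cells w)), drop i (input_cells w))"
| "tape_rep w (Suc j) z (q, i, ts) \<longleftrightarrow>
     (\<forall>n<length (fst z). fst z ! n = Wk (fst (ts ! j) (snd (ts ! j) - 1 - int n))) \<and>
     (\<forall>n<length (snd z). snd z ! n = Wk (fst (ts ! j) (snd (ts ! j) + int n)))"

text \<open>The input segment is the entire tape between the markers, and
  \<open>input_direction\<close> turns a move beyond a marker into \<open>Stay\<close>; so the only
  cause of failure is a wrong symbol.\<close>

lemma input_move:
  assumes "i \<le> length w + 1"
  defines "z \<equiv> (rev (take i (input_cells w)), drop i (input_cells w))"
  shows "tape_move (range InS) (InS a, InS a, input_direction a d) z =
    (if a = input_at w i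
     then Some (rev (take (move_input w d i) (input_cells w)), drop (move_input w d i) (input_cells w))
     else None)"
proof -
  have i: "i < length (input_cells w)" using assms(1) by simp
  have r: "drop i (input_cells w) = InS (input_at w i) # drop (Suc i) (input_cells w)"
    using Cons_nth_drop_Suc[OF i] nth_input_cells[OF assms(1)] by simp
  have l: "rev (take (Suc i) (input_cells w)) = InS (input_at w i) # rev (take i (input_cells w))"
    using take_Suc_conv_app_nth[OF i] nth_input_cells[OF assms(1)] by simp
  show ?thesis
  proof (cases "a = input_at w i")
    case False
    then show ?thesis unfolding z_def r by simp
  next
    case True
    consider (stay) "input_direction a d = Stay" "move_input w d i = i"
      | (right) "input_direction a d = MoveR" "move_input w d i = Suc i"
      | (left) "input_direction a d = MoveL" "0 < i" "move_input w d i = i - 1"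
      using assms(1) True
      by (cases d; cases a) (auto simp: move_input_def input_at_def split: if_splits)
    then show ?thesis
    proof cases
      case stay
      then show ?thesis unfolding z_def r using True r by simp
    next
      case right
      then show ?thesis unfolding z_def r using True l by simp
    next
      case left
      then obtain k where k: "i = Suc k" by (cases i) auto
      have "k < length (input_cells w)" "k \<le> length w + 1" using i k by auto
      then have "rev (take i (input_cells w)) = InS (input_at w k) # rev (take k (input_cells w))"
        "drop k (input_cells w) = InS (input_at w k) # drop i (input_cells w)"
        using take_Suc_conv_app_nth[of k "input_cells w"] nth_input_cells[of k w]
          Cons_nth_drop_Suc[of k "input_cells w"] k by auto
      then show ?thesis unfolding z_def r using True left r k by simp
    qed
  qed
qed

lemma work_move_sound:
  assumes rep: "\<forall>n<length l. l ! n = Wk (t (h - 1 - int n))" "\<forall>n<length r. r ! n = Wk (t (h + int n))"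
    and mv: "tape_move S (Wk a, Wk b, d) (l, r) = Some (l', r')"
    and T': "act (t, h) (b, d) = (t', h')"
  shows "a = t h" "\<forall>n<length l'. l' ! n = Wk (t' (h' - 1 - int n))" "\<forall>n<length r'. r' ! n = Wk (t' (h' + int n))"
proof -
  obtain r0 where r: "r = Wk a # r0" using mv by (cases r) (auto split: if_splits)
  show "a = t h" using rep(2) r by force
  have r0: "r0 ! n = Wk (t (h + 1 + int n))" if "n < length r0" for n
    using rep(2)[rule_format, of "Suc n"] that r by (simp add: algebra_simps)
  have t': "t' = t(h := b)" using T' by simp
  show "\<forall>n<length l'. l' ! n = Wk (t' (h' - 1 - int n))"
  proof (cases d)
    case MoveR
    have "(Wk b # l) ! n = Wk ((t(h := b)) (h - int n))" if "n < Suc (length l)" for n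
      using that rep(1)[rule_format, of "n - 1"] by (cases n) (auto simp: algebra_simps)
    moreover have "l' = Wk b # l" "h' - 1 = h" using MoveR mv T' unfolding r by auto
    ultimately show ?thesis unfolding t' by (metis length_Cons)
  next
    case Stay
    then show ?thesis using mv rep(1) T' unfolding r t' by auto
  next
    case MoveL
    then obtain y l0 where y: "l = y # l0" "l' = l0" "h' = h - 1"
      using mv T' unfolding r by (cases l) (auto split: if_splits)
    have "l0 ! n = Wk ((t(h := b)) (h - 1 - 1 - int n))" if "n < length l0" for n
      using that rep(1)[rule_format, of "Suc n"] y(1) by (auto simp: algebra_simps)
    then show ?thesis unfolding y t' by blast
  qed
  show "\<forall>n<length r'. r' ! n = Wk (t' (h' + int n))"
  proof (cases d)
    case MoveR
    then show ?thesis using mv T' r0 unfolding r t' by auto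
  next
    case Stay
    then have "r' = Wk b # r0" "h' = h" using mv T' unfolding r by auto
    moreover have "(Wk b # r0) ! n = Wk ((t(h := b)) (h + int n))" if "n < Suc (length r0)" for n
      using that r0[of "n - 1"] by (cases n) (auto simp: algebra_simps)
    ultimately show ?thesis unfolding t' by simp
  next
    case MoveL
    then obtain y l0 where y: "l = y # l0" "r' = y # Wk b # r0" "h' = h - 1"
      using mv T' unfolding r by (cases l) (auto split: if_splits)
    have "(y # Wk b # r0) ! n = Wk ((t(h := b)) (h - 1 + int n))" if "n < length (y # Wk b # r0)" for n
    proof -
      consider "n = 0" | "n = 1" | m where "n = Suc (Suc m)" by (metis One_nat_def not0_implies_Suc)
      then show ?thesis
      proof cases
        case 1
        then show ?thesis using rep(1) y(1) by force
      next
        case 2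
        then show ?thesis by simp
      next
        case (3 m)
        then show ?thesis using r0[of m] that by (simp add: algebra_simps)
      qed
    qed
    then show ?thesis unfolding y t' by blast
  qed
qed

text \<open>A move takes at most one cell away from either side, so enough spare cells at the start
  outlast the whole transcript.\<close>

lemma work_move_complete:
  assumes rep: "\<forall>n<length l. l ! n = Wk (t (h - 1 - int n))" "\<forall>n<length r. r ! n = Wk (t (h + int n))"
    and S: "range t \<subseteq> A"
    and len: "Suc n \<le> length l" "Suc (Suc n) \<le> length r"
  shows "\<exists>l' r'. tape_move (Wk ` A) (Wk (t h), Wk b, d) (l, r) = Some (l', r') \<and>
    n \<le> length l' \<and> Suc n \<le> length r'"
proof -
  obtain x r0 where r: "r = x # r0" using len by (cases r) auto
  obtain y l0 where l: "l = y # l0" using len by (cases l) auto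
  have "x = Wk (t h)" using rep(2) r by force
  moreover have "y \<in> Wk ` A" using rep(1) l S by force
  ultimately show ?thesis using len unfolding r l by (cases d) auto
qed

fun next_config :: "bool list \<Rightarrow> transition \<Rightarrow> config \<Rightarrow> config" where
  "next_config w (q, a, ss, q', d, as) (p, i, ts) = (q', move_input w d i, map2 act ts as)"

fun reads :: "bool list \<Rightarrow> transition \<Rightarrow> config \<Rightarrow> nat \<Rightarrow> bool" where
  "reads w (q, a, ss, q', d, as) (p, i, ts) 0 \<longleftrightarrow> a = input_at w i"
| "reads w (q, a, ss, q', d, as) (p, i, ts) (Suc j) \<longleftrightarrow> ss ! j = scan (ts ! j)"

lemma tape_move_sound:
  assumes e: "e = (q, a, ss, q', d, as)" "length as = k" and c: "c = (p, i, ts)" "length ts = k" and j: "j \<le> k"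
    and rep: "tape_rep w j z c" and mv: "tape_move (cells M j) (view j e) z = Some z'"
  shows "reads w e c j" "tape_rep w j z' (next_config w e c)"
proof -
  have "reads w e c j \<and> tape_rep w j z' (next_config w e c)"
  proof (cases j)
    case 0
    have i: "i \<le> length w + 1" "z = (rev (take i (input_cells w)), drop i (input_cells w))"
      using rep 0 c by auto
    then show ?thesis
      using mv input_move[OF i(1), of a d] move_input_le[OF i(1)] 0 c e by (auto split: if_splits)
  next
    case (Suc j')
    obtain t h where th: "ts ! j' = (t, h)" by (cases "ts ! j'")
    obtain t' h' where th': "act (t, h) (as ! j') = (t', h')" by (cases "act (t, h) (as ! j')")
    obtain l r where z: "z = (l, r)" by (cases z)
    obtain l' r' where z': "z' = (l', r')" by (cases z')
    have j': "j' < length ts" "j' < length as" using j Suc e c by auto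
    have "map2 act ts as ! j' = (t', h')" using j' th th' by simp
    moreover note work_move_sound[of l t h r "cells M j" "ss ! j'" "fst (as ! j')" "snd (as ! j')" l' r' t' h']
    ultimately show ?thesis
      using rep mv th th' unfolding Suc c e z z' by simp
  qed
  then show "reads w e c j" "tape_rep w j z' (next_config w e c)" by auto
qed

section \<open>Transcripts versus computations\<close>

fun chain :: "nat \<Rightarrow> transition list \<Rightarrow> nat \<Rightarrow> bool" where
  "chain q [] q' \<longleftrightarrow> q = q'"
| "chain q (e # es) q' \<longleftrightarrow> source e = q \<and> chain (target e) es q'"

lemma reads_all:
  assumes "e = (q, a, ss, q', d, as)" "c = (p, i, ts)" "length ss = k" "length ts = k"
    and "\<And>j. j \<le> k \<Longrightarrow> reads w e c j"
  shows "a = input_at w i" "ss = map scan ts"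
proof -
  show "a = input_at w i" using assms(5)[of 0] assms(1,2) by simp
  show "ss = map scan ts"
  proof (rule nth_equalityI)
    fix j assume "j < length ss"
    then show "ss ! j = map scan ts ! j" using assms(5)[of "Suc j"] assms by simp
  qed (use assms in simp)
qed

text \<open>The tapes interact only through the recorded transitions. If each tape by itself
  confirms the symbol that a transition claims to read there, all the claims hold together and the
  transition is a genuine step. This is why the tapes may be checked one after the other.\<close>

lemma transcript_sound:
  assumes M: "is_NTM M" and run: "reaches M w c" and wf: "well_formed M c"
    and es: "set es \<subseteq> transitions M" "ef \<in> final_transitions M" "chain (fst c) es (source ef)"
    and rep: "\<And>j. j \<le> tapes M \<Longrightarrow> tape_rep w j (z j) c \<and>
      tape_moves (cells M j) (map (view j) (es @ [ef])) (z j) \<noteq> None"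
  shows "w \<in> language M"
  using run wf es rep
proof (induction es arbitrary: c z)
  case Nil
  obtain q i ts where c: "c = (q, i, ts)" by (cases c)
  obtain a ss where ef: "ef = (q, a, ss, q, Stay, hold ss)" "q \<in> accepting M" "ss \<in> scannable M" "delta M q a ss = {}"
    using Nil c by (auto simp: final_transitions_def)
  have len: "length ss = tapes M" "length ts = tapes M"
    using ef(3) Nil.prems(2) c by (auto simp: scannable_def well_formed_def)
  have "reads w ef c j" if jk: "j \<le> tapes M" for j
  proof -
    obtain z' where "tape_move (cells M j) (view j ef) (z j) = Some z'"
      using Nil.prems(6)[OF jk] by (cases "tape_move (cells M j) (view j ef) (z j)") auto
    then show ?thesis
      using tape_move_sound(1)[OF ef(1) _ c len(2) jk] Nil.prems(6)[OF jk] len by simp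
  qed
  from reads_all[OF ef(1) c len this] have "a = input_at w i" "ss = map scan ts" by auto
  then have "\<not> step M w c c'" for c'
    using ef(4) c by (auto simp: step.simps)
  then show ?case
    using Nil.prems(1) ef(2) c unfolding language_def halts_in_def by blast
next
  case (Cons e es)
  obtain q i ts where c: "c = (q, i, ts)" by (cases c)
  obtain a ss q' d as where e: "e = (q, a, ss, q', d, as)" "ss \<in> scannable M" "(q', d, as) \<in> delta M q a ss"
    using Cons.prems(3,5) c by (auto simp: transitions_def)
  have q: "q \<in> states M" using Cons.prems(2) c by (auto simp: well_formed_def)
  have len: "length ss = tapes M" "length ts = tapes M" "length as = tapes M"
    using e(2) Cons.prems(2) c is_NTM_deltaD[OF M q e(2,3)] by (auto simp: scannable_def well_formed_def)
  have "\<exists>z'. tape_move (cells M j) (view j e) (z j) = Some z' \<and>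
      tape_moves (cells M j) (map (view j) (es @ [ef])) z' \<noteq> None" if "j \<le> tapes M" for j
    using Cons.prems(6)[OF that] by (cases "tape_move (cells M j) (view j e) (z j)") auto
  then obtain z' where z': "\<And>j. j \<le> tapes M \<Longrightarrow> tape_move (cells M j) (view j e) (z j) = Some (z' j)"
    "\<And>j. j \<le> tapes M \<Longrightarrow> tape_moves (cells M j) (map (view j) (es @ [ef])) (z' j) \<noteq> None"
    by metis
  have snd: "reads w e c j" "tape_rep w j (z' j) (next_config w e c)" if "j \<le> tapes M" for j
    using tape_move_sound[OF e(1) len(3) c len(2) that _ z'(1)[OF that]] Cons.prems(6)[OF that] by auto
  from reads_all[OF e(1) c len(1,2) snd(1)] have "a = input_at w i" "ss = map scan ts" by auto
  then have st: "step M w c (next_config w e c)"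
    using e c step.intros by auto
  show ?case
  proof (rule Cons.IH)
    show "reaches M w (next_config w e c)"
      using Cons.prems(1) st by (rule rtranclp.rtrancl_into_rtrancl)
    show "well_formed M (next_config w e c)" using well_formed_step[OF M st Cons.prems(2)] .
    show "chain (fst (next_config w e c)) es (source ef)" using Cons.prems(5) e c by simp
  qed (use Cons.prems snd z' in auto)
qed

lemma tape_move_complete:
  assumes M: "is_NTM M" and wf: "well_formed M c" and c: "c = (q, i, ts)"
    and e: "e = (q, input_at w i, map scan ts, q', d, as)" and len: "length as = tapes M"
    and rep: "tape_rep w j z c" and j: "j \<le> tapes M"
    and room: "0 < j \<Longrightarrow> Suc n \<le> length (fst z) \<and> Suc (Suc n) \<le> length (snd z)"
  shows "\<exists>z'. tape_move (cells M j) (view j e) z = Some z' \<and> tape_rep w j z' (next_config w e c) \<and>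
    (0 < j \<longrightarrow> n \<le> length (fst z') \<and> Suc n \<le> length (snd z'))"
proof -
  have lts: "length ts = tapes M" "\<forall>T\<in>set ts. range (fst T) \<subseteq> alphabet M"
    using wf c by (auto simp: well_formed_def)
  have "\<exists>z'. tape_move (cells M j) (view j e) z = Some z' \<and>
    (0 < j \<longrightarrow> n \<le> length (fst z') \<and> Suc n \<le> length (snd z'))"
  proof (cases j)
    case 0
    then show ?thesis using rep input_move[of i w "input_at w i" d] c e by auto
  next
    case (Suc j')
    obtain t h where th: "ts ! j' = (t, h)" by (cases "ts ! j'")
    obtain l r where z: "z = (l, r)" by (cases z)
    have j': "j' < length ts" using j Suc lts by auto
    then have "range t \<subseteq> alphabet M" using lts(2) th nth_mem by fastforce
    from work_move_complete[of l t h r, OF _ _ this, of n "fst (as ! j')" "snd (as ! j')"]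
    show ?thesis using rep room j' th unfolding Suc c e z by auto
  qed
  then show ?thesis using tape_move_sound(2)[OF e len c lts(1) j rep] by blast
qed

text \<open>One transcript has to serve all tapes, hence the quantifier over \<open>j\<close> and
  \<open>z\<close> behind the existential one. It has \<open>n + 1\<close> entries; each may use up
  a cell on either side, and the right half contains the scanned cell as well.\<close>

lemma transcript_complete:
  assumes M: "is_NTM M" and "well_formed M c" and "(step M w ^^ n) c cf" and "\<nexists>c'. step M w cf c'"
    and "fst cf \<in> accepting M"
  shows "\<exists>es ef. length es = n \<and> set es \<subseteq> transitions M \<and> ef \<in> final_transitions M \<and>
    chain (fst c) es (source ef) \<and>
    (\<forall>j z. j \<le> tapes M \<longrightarrow> tape_rep w j z c \<longrightarrow>
       (0 < j \<longrightarrow> Suc n \<le> length (fst z) \<and> Suc (Suc n) \<le> length (snd z)) \<longrightarrow>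
       tape_moves (cells M j) (map (view j) (es @ [ef])) z \<noteq> None)"
  using assms(2,3)
proof (induction n arbitrary: c)
  case 0
  then have cf: "cf = c" by simp
  obtain q i ts where c: "c = (q, i, ts)" by (cases c)
  let ?ef = "(q, input_at w i, map scan ts, q, Stay, hold (map scan ts))"
  have sc: "map scan ts \<in> scannable M" using 0(1) c well_formed_scannable by blast
  have "delta M q (input_at w i) (map scan ts) = {}"
    using assms(4) step.intros unfolding cf c by fastforce
  then have "?ef \<in> final_transitions M"
    using assms(5) sc unfolding cf c by (simp add: final_transitions_def)
  moreover have "tape_moves (cells M j) (map (view j) ([] @ [?ef])) z \<noteq> None"
    if "j \<le> tapes M" "tape_rep w j z c" "0 < j \<longrightarrow> Suc 0 \<le> length (fst z) \<and> Suc (Suc 0) \<le> length (snd z)" for j z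
  proof -
    have "length (hold (map scan ts)) = tapes M" using 0(1) c by (simp add: well_formed_def)
    from tape_move_complete[where n = 0, OF M 0(1) c refl[of ?ef] this that(2,1)] that(3)
    show ?thesis by auto
  qed
  ultimately show ?case using c by (intro exI[of _ "[]"] exI[of _ ?ef]) auto
next
  case (Suc n)
  obtain c1 where st: "step M w c c1" and run: "(step M w ^^ n) c1 cf"
    using Suc.prems(2) by (metis relpowp_Suc_D2)
  have wf1: "well_formed M c1" using well_formed_step[OF M st Suc.prems(1)] .
  obtain q i ts where c: "c = (q, i, ts)" by (cases c)
  obtain q' d as where e: "(q', d, as) \<in> delta M q (input_at w i) (map scan ts)"
    "c1 = (q', move_input w d i, map2 act ts as)"
    using st c by (auto simp: step.simps)
  let ?e = "(q, input_at w i, map scan ts, q', d, as)"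
  have sc: "map scan ts \<in> scannable M" "q \<in> states M"
    using Suc.prems(1) c well_formed_scannable by (blast, simp add: well_formed_def)
  have len: "length as = tapes M" using is_NTM_deltaD[OF M sc(2,1) e(1)] by simp
  obtain es ef where IH: "length es = n" "set es \<subseteq> transitions M" "ef \<in> final_transitions M"
    "chain (fst c1) es (source ef)"
    "\<And>j z. j \<le> tapes M \<Longrightarrow> tape_rep w j z c1 \<Longrightarrow>
       (0 < j \<longrightarrow> Suc n \<le> length (fst z) \<and> Suc (Suc n) \<le> length (snd z)) \<Longrightarrow>
       tape_moves (cells M j) (map (view j) (es @ [ef])) z \<noteq> None"
    using Suc.IH[OF wf1 run] by blast
  have "tape_moves (cells M j) (map (view j) ((?e # es) @ [ef])) z \<noteq> None"
    if j: "j \<le> tapes M" "tape_rep w j z c"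
      and room: "0 < j \<longrightarrow> Suc (Suc n) \<le> length (fst z) \<and> Suc (Suc (Suc n)) \<le> length (snd z)" for j z
  proof -
    obtain z' where "tape_move (cells M j) (view j ?e) z = Some z'" "tape_rep w j z' (next_config w ?e c)"
      "0 < j \<longrightarrow> Suc n \<le> length (fst z') \<and> Suc (Suc n) \<le> length (snd z')"
      using tape_move_complete[where n = "Suc n", OF M Suc.prems(1) c refl[of ?e] len j(2,1)] room by blast
    then show ?thesis using IH(5)[OF j(1), of z'] e(2) c by simp
  qed
  moreover have "?e \<in> transitions M" using sc e(1) by (simp add: transitions_def)
  ultimately show ?case using IH(1-4) c e(2)
    by (intro exI[of _ "?e # es"] exI[of _ ef]) auto
qed

section \<open>A stack program that checks transcripts\<close>

instance direction :: countable by countable_datatype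
instance input_symbol :: countable by countable_datatype
instance symbol :: countable by countable_datatype
instance cell :: countable by countable_datatype

datatype store_symbol = Begin | Guess nat | Shift | Check nat | Back nat | Load nat | Fill nat
  | Tr transition | Cell cell | Bot

instance store_symbol :: countable by countable_datatype

type_synonym store_config =
  "store_symbol \<times> store_symbol list \<times> store_symbol list \<times> store_symbol list \<times> store_symbol list"

definition store :: "store_symbol list \<Rightarrow> store_symbol list \<Rightarrow> store_symbol list \<Rightarrow> store_symbol list \<Rightarrow>
    store_symbol list \<Rightarrow> nat \<Rightarrow> store_symbol list" where
  "store Z A B L R = (\<lambda>s. if s = 0 then Z else if s = 1 then A else if s = 2 then B
     else if s = 3 then L else if s = 4 then R else [])"

lemma store_nth [simp]:
  "store Z A B L R 0 = Z" "store Z A B L R (Suc 0) = A" "store Z A B L R 2 = B"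
  "store Z A B L R 3 = L" "store Z A B L R 4 = R"
  by (auto simp: store_def)

lemma store_upd [simp]:
  "(store Z A B L R)(0 := X) = store X A B L R" "(store Z A B L R)(Suc 0 := X) = store Z X B L R"
  "(store Z A B L R)(2 := X) = store Z A X L R" "(store Z A B L R)(3 := X) = store Z A B X R"
  "(store Z A B L R)(4 := X) = store Z A B L X"
  by (auto simp: store_def fun_eq_iff)

fun stack_move :: "cell set \<Rightarrow> cell \<times> cell \<times> direction \<Rightarrow> store_symbol list \<Rightarrow> store_symbol list \<Rightarrow>
    store_symbol list \<Rightarrow> store_symbol list \<Rightarrow> bool" where
  "stack_move S (a, b, d) L R L' R' \<longleftrightarrow> (\<exists>r. R = Cell a # r \<and>
     (case d of MoveR \<Rightarrow> L' = Cell b # L \<and> R' = r | Stay \<Rightarrow> L' = L \<and> R' = Cell b # r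
      | MoveL \<Rightarrow> \<exists>y\<in>S. L = Cell y # L' \<and> R' = Cell y # Cell b # r))"

text \<open>A left move carries the neighbouring cell from stack 3 to stack 4, but a pop has to name
  the symbol it removes: hence one rule for each \<open>y\<close> in \<open>S\<close>. The
  restriction to \<open>S\<close> in \<open>tape_move\<close> mirrors this.\<close>

fun move_ops :: "cell set \<Rightarrow> cell \<times> cell \<times> direction \<Rightarrow> store_symbol op list set" where
  "move_ops S (a, b, d) = (case d of
     MoveR \<Rightarrow> {[Pop 4 (Cell a), Push 3 (Cell b)]}
   | Stay \<Rightarrow> {[Pop 4 (Cell a), Push 4 (Cell b)]}
   | MoveL \<Rightarrow> (\<lambda>y. [Pop 4 (Cell a), Push 4 (Cell b), Pop 3 (Cell y), Push 4 (Cell y)]) ` S)"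

lemma move_ops_iff:
  "(\<exists>m\<in>move_ops S v. exec_ops m (store Z A B L R) = Some \<sigma>) \<longleftrightarrow>
   (\<exists>L' R'. stack_move S v L R L' R' \<and> \<sigma> = store Z A B L' R')"
proof -
  obtain a b d where v: "v = (a, b, d)" by (cases v)
  show ?thesis
  proof (cases d)
    case MoveL
    show ?thesis
    proof (cases R)
      case (Cons x r)
      then show ?thesis using MoveL v by (cases L) auto
    qed (use v MoveL in auto)
  qed (cases R; auto simp: v)+
qed

text \<open>The program guesses an accepting transcript backwards onto stack 1 and then checks it against
  one tape at a time. A check moves the transcript to stack 2 and keeps the tape on stacks 3 and 4;
  the symbol \<^term>\<open>Bot\<close> protects what earlier checks left there. Stack 0 holds the control state.\<close>

locale transcript_program =
  fixes M :: ntm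
  assumes M: "is_NTM M"
begin

text \<open>The chaining of states is enforced while guessing, since \<open>Guess q\<close>
  remembers the source of the transition guessed last; the checks then look at tape contents only.
  \<open>Check\<close> changes to \<open>Back\<close> only at a final transition.
  \<open>Load (Suc (tapes M))\<close> has no outgoing rule and signals that all tapes have
  passed.\<close>

inductive_set guarded_rules :: "(store_symbol \<times> store_symbol op list \<times> store_symbol) set" where
  start: "e \<in> final_transitions M \<Longrightarrow> (Begin, [Push 1 (Tr e)], Guess (source e)) \<in> guarded_rules"
| guess: "e \<in> transitions M \<Longrightarrow> (Guess (target e), [Push 1 (Tr e)], Guess (source e)) \<in> guarded_rules"
| guessed: "(Guess (start M), [], Shift) \<in> guarded_rules"
| shift: "a \<noteq> LeftEnd \<Longrightarrow>
    (Shift, [Pop 3 (Cell (InS a)), Push 4 (Cell (InS a))], Shift) \<in> guarded_rules"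
| shifted: "(Shift, [Pop 3 (Cell (InS LeftEnd)), Push 4 (Cell (InS LeftEnd))], Check 0) \<in> guarded_rules"
| check: "j \<le> tapes M \<Longrightarrow> e \<in> transitions M \<Longrightarrow> m \<in> move_ops (cells M j) (view j e) \<Longrightarrow>
    (Check j, Pop 1 (Tr e) # Push 2 (Tr e) # m, Check j) \<in> guarded_rules"
| checked: "j \<le> tapes M \<Longrightarrow> e \<in> final_transitions M \<Longrightarrow> m \<in> move_ops (cells M j) (view j e) \<Longrightarrow>
    (Check j, Pop 1 (Tr e) # Push 2 (Tr e) # m, Back j) \<in> guarded_rules"
| unwind: "j \<le> tapes M \<Longrightarrow> e \<in> transitions M \<union> final_transitions M \<Longrightarrow>
    (Back j, [Pop 2 (Tr e), Push 1 (Tr e)], Back j) \<in> guarded_rules"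
| unwound: "j \<le> tapes M \<Longrightarrow> (Back j, [Pop 2 Bot, Push 2 Bot], Load (Suc j)) \<in> guarded_rules"
| load: "0 < j \<Longrightarrow> j \<le> tapes M \<Longrightarrow> (Load j, [Push 3 Bot, Push 4 Bot], Fill j) \<in> guarded_rules"
| fill: "0 < j \<Longrightarrow> j \<le> tapes M \<Longrightarrow>
    (Fill j, [Push 3 (Cell (Wk Blank)), Push 4 (Cell (Wk Blank))], Fill j) \<in> guarded_rules"
| filled: "0 < j \<Longrightarrow> j \<le> tapes M \<Longrightarrow> (Fill j, [], Check j) \<in> guarded_rules"

definition rule_ops :: "store_symbol op list set" where
  "rule_ops = (\<lambda>(z, ops, z'). Pop 0 z # ops @ [Push 0 z']) ` guarded_rules"

inductive store_step :: "store_config \<Rightarrow> store_config \<Rightarrow> bool" where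
  start: "e \<in> final_transitions M \<Longrightarrow>
    store_step (Begin, A, B, L, R) (Guess (source e), Tr e # A, B, L, R)"
| guess: "e \<in> transitions M \<Longrightarrow>
    store_step (Guess (target e), A, B, L, R) (Guess (source e), Tr e # A, B, L, R)"
| guessed: "store_step (Guess (start M), A, B, L, R) (Shift, A, B, L, R)"
| shift: "a \<noteq> LeftEnd \<Longrightarrow>
    store_step (Shift, A, B, Cell (InS a) # L, R) (Shift, A, B, L, Cell (InS a) # R)"
| shifted: "store_step (Shift, A, B, Cell (InS LeftEnd) # L, R) (Check 0, A, B, L, Cell (InS LeftEnd) # R)"
| check: "j \<le> tapes M \<Longrightarrow> e \<in> transitions M \<Longrightarrow> stack_move (cells M j) (view j e) L R L' R' \<Longrightarrow>
    store_step (Check j, Tr e # A, B, L, R) (Check j, A, Tr e # B, L', R')"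
| checked: "j \<le> tapes M \<Longrightarrow> e \<in> final_transitions M \<Longrightarrow> stack_move (cells M j) (view j e) L R L' R' \<Longrightarrow>
    store_step (Check j, Tr e # A, B, L, R) (Back j, A, Tr e # B, L', R')"
| unwind: "j \<le> tapes M \<Longrightarrow> e \<in> transitions M \<union> final_transitions M \<Longrightarrow>
    store_step (Back j, A, Tr e # B, L, R) (Back j, Tr e # A, B, L, R)"
| unwound: "j \<le> tapes M \<Longrightarrow> store_step (Back j, A, Bot # B, L, R) (Load (Suc j), A, Bot # B, L, R)"
| load: "0 < j \<Longrightarrow> j \<le> tapes M \<Longrightarrow> store_step (Load j, A, B, L, R) (Fill j, A, B, Bot # L, Bot # R)"
| fill: "0 < j \<Longrightarrow> j \<le> tapes M \<Longrightarrow> store_step (Fill j, A, B, L, R)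
    (Fill j, A, B, Cell (Wk Blank) # L, Cell (Wk Blank) # R)"
| filled: "0 < j \<Longrightarrow> j \<le> tapes M \<Longrightarrow> store_step (Fill j, A, B, L, R) (Check j, A, B, L, R)"

fun store_of :: "store_config \<Rightarrow> nat \<Rightarrow> store_symbol list" where
  "store_of (z, A, B, L, R) = store [z] A B L R"

text \<open>The control symbol is popped first and replaced last, so the operations in between see
  stack 0 empty.\<close>

lemma guarded_exec:
  "exec_ops (Pop 0 z # ops @ [Push 0 z']) (store [x] A B L R) = Some \<sigma> \<longleftrightarrow>
   x = z \<and> (\<exists>\<sigma>'. exec_ops ops (store [] A B L R) = Some \<sigma>' \<and> \<sigma> = \<sigma>'(0 := z' # \<sigma>' 0))"
  by (auto simp: exec_ops_append split: Option.bind_splits)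

lemma rule_ops_step:
  assumes "r \<in> rule_ops" "exec_ops r (store_of c) = Some \<sigma>"
  shows "\<exists>c'. store_step c c' \<and> \<sigma> = store_of c'"
proof -
  obtain x A B L R where c: "c = (x, A, B, L, R)" by (cases c)
  obtain z ops z' where r: "(z, ops, z') \<in> guarded_rules" "r = Pop 0 z # ops @ [Push 0 z']"
    using assms(1) by (auto simp: rule_ops_def)
  obtain \<sigma>' where x: "x = z" and ex: "exec_ops ops (store [] A B L R) = Some \<sigma>'" and \<sigma>: "\<sigma> = \<sigma>'(0 := z' # \<sigma>' 0)"
    using assms(2) unfolding r(2) c store_of.simps guarded_exec by blast
  have concl: "\<exists>c'. store_step c c' \<and> \<sigma> = store_of c'"
    if "store_step (z, A, B, L, R) (z', A', B', L', R')" "\<sigma>' = store [] A' B' L' R'" for A' B' L' R'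
    using that unfolding c x \<sigma> by (intro exI[of _ "(z', A', B', L', R')"]) simp
  from r(1) show ?thesis
  proof cases
    case (shift a)
    then obtain L' where "L = Cell (InS a) # L'" using ex by (cases L) (auto split: if_splits)
    then show ?thesis using shift ex by (intro concl) (auto intro: store_step.intros)
  next
    case shifted
    then obtain L' where "L = Cell (InS LeftEnd) # L'" using ex by (cases L) (auto split: if_splits)
    then show ?thesis using shifted ex by (intro concl) (auto intro: store_step.intros)
  next
    case (check j e m)
    then obtain A' where A: "A = Tr e # A'" using ex by (cases A) (auto split: if_splits)
    then have "exec_ops m (store [] A' (Tr e # B) L R) = Some \<sigma>'" using ex check by simp
    then obtain L' R' where "stack_move (cells M j) (view j e) L R L' R'" "\<sigma>' = store [] A' (Tr e # B) L' R'"
      using move_ops_iff check(6) by metis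
    then show ?thesis using check A by (intro concl) (auto intro: store_step.intros simp del: stack_move.simps)
  next
    case (checked j e m)
    then obtain A' where A: "A = Tr e # A'" using ex by (cases A) (auto split: if_splits)
    then have "exec_ops m (store [] A' (Tr e # B) L R) = Some \<sigma>'" using ex checked by simp
    then obtain L' R' where "stack_move (cells M j) (view j e) L R L' R'" "\<sigma>' = store [] A' (Tr e # B) L' R'"
      using move_ops_iff checked(6) by metis
    then show ?thesis using checked A by (intro concl) (auto intro: store_step.intros simp del: stack_move.simps)
  next
    case (unwind j e)
    then obtain B' where "B = Tr e # B'" using ex by (cases B) (auto split: if_splits)
    then show ?thesis using unwind ex by (intro concl) (auto intro: store_step.intros)
  next
    case (unwound j)
    then obtain B' where "B = Bot # B'" using ex by (cases B) (auto split: if_splits)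
    then show ?thesis using unwound ex by (intro concl) (auto intro: store_step.intros)
  qed (rule concl; use ex in \<open>auto intro: store_step.intros\<close>)+
qed

lemma step_rule_ops:
  assumes "store_step c c'"
  shows "\<exists>r\<in>rule_ops. exec_ops r (store_of c) = Some (store_of c')"
proof -
  have concl: "\<exists>r\<in>rule_ops. exec_ops r (store_of (z, A, B, L, R)) = Some (store_of (z', A', B', L', R'))"
    if "(z, ops, z') \<in> guarded_rules" "exec_ops ops (store [] A B L R) = Some (store [] A' B' L' R')"
    for z ops z' A B L R A' B' L' R'
  proof
    show "Pop 0 z # ops @ [Push 0 z'] \<in> rule_ops" using that(1) by (force simp: rule_ops_def)
    show "exec_ops (Pop 0 z # ops @ [Push 0 z']) (store_of (z, A, B, L, R)) = Some (store_of (z', A', B', L', R'))"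
      unfolding store_of.simps guarded_exec using that(2) by simp
  qed
  from assms show ?thesis
  proof cases
    case (start e A B L R)
    show ?thesis unfolding start(1,2) by (rule concl[OF guarded_rules.start]) (use start in auto)
  next
    case (guess e A B L R)
    show ?thesis unfolding guess(1,2) by (rule concl[OF guarded_rules.guess]) (use guess in auto)
  next
    case (guessed A B L R)
    show ?thesis unfolding guessed(1,2) by (rule concl[OF guarded_rules.guessed]) (use guessed in auto)
  next
    case (shift a A B L R)
    show ?thesis unfolding shift(1,2) by (rule concl[OF guarded_rules.shift]) (use shift in auto)
  next
    case (shifted A B L R)
    show ?thesis unfolding shifted(1,2) by (rule concl[OF guarded_rules.shifted]) (use shifted in auto)
  next
    case (check j e L R L' R' A B)
    obtain m where m: "m \<in> move_ops (cells M j) (view j e)"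
      "exec_ops m (store [] A (Tr e # B) L R) = Some (store [] A (Tr e # B) L' R')"
      using check(5) move_ops_iff by metis
    have "(Check j, Pop 1 (Tr e) # Push 2 (Tr e) # m, Check j) \<in> guarded_rules"
      using guarded_rules.check[OF check(3,4) m(1)] .
    then show ?thesis unfolding check(1,2) by (rule concl) (use m(2) in simp)
  next
    case (checked j e L R L' R' A B)
    obtain m where m: "m \<in> move_ops (cells M j) (view j e)"
      "exec_ops m (store [] A (Tr e # B) L R) = Some (store [] A (Tr e # B) L' R')"
      using checked(5) move_ops_iff by metis
    have "(Check j, Pop 1 (Tr e) # Push 2 (Tr e) # m, Back j) \<in> guarded_rules"
      using guarded_rules.checked[OF checked(3,4) m(1)] .
    then show ?thesis unfolding checked(1,2) by (rule concl) (use m(2) in simp)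
  next
    case (unwind j e A B L R)
    have "(Back j, [Pop 2 (Tr e), Push 1 (Tr e)], Back j) \<in> guarded_rules"
      using guarded_rules.unwind[OF unwind(3,4)] .
    then show ?thesis unfolding unwind(1,2) by (rule concl) simp
  next
    case (unwound j A B L R)
    show ?thesis unfolding unwound(1,2) by (rule concl[OF guarded_rules.unwound]) (use unwound in auto)
  next
    case (load j A B L R)
    show ?thesis unfolding load(1,2) by (rule concl[OF guarded_rules.load]) (use load in auto)
  next
    case (fill j A B L R)
    show ?thesis unfolding fill(1,2) by (rule concl[OF guarded_rules.fill]) (use fill in auto)
  next
    case (filled j A B L R)
    show ?thesis unfolding filled(1,2) by (rule concl[OF guarded_rules.filled]) (use filled in auto)
  qed
qed

lemma finite_move_ops: "finite S \<Longrightarrow> finite (move_ops S v)"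
  by (cases v) (auto split: direction.splits)

text \<open>The rules must be written out in the input of the universal machine. Finiteness rests on
  the finite sets of transitions and, for left moves, on the finite sets
  \<open>cells M j\<close>.\<close>

lemma finite_guarded_rules: "finite guarded_rules"
proof (rule finite_subset)
  show "guarded_rules \<subseteq>(\<lambda>e. (Begin, [Push 1 (Tr e)], Guess (source e))) ` final_transitions M \<union>
     (\<lambda>e. (Guess (target e), [Push 1 (Tr e)], Guess (source e))) ` transitions M \<union>
     {(Guess (start M), [], Shift)} \<union>
     (\<lambda>a. (Shift, [Pop 3 (Cell (InS a)), Push 4 (Cell (InS a))], Shift)) ` (UNIV - {LeftEnd}) \<union>
     {(Shift, [Pop 3 (Cell (InS LeftEnd)), Push 4 (Cell (InS LeftEnd))], Check 0)} \<union>
     (\<Union>j\<in>{..tapes M}. \<Union>e\<in>transitions M.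
        (\<lambda>m. (Check j, Pop 1 (Tr e) # Push 2 (Tr e) # m, Check j)) ` move_ops (cells M j) (view j e)) \<union>
     (\<Union>j\<in>{..tapes M}. \<Union>e\<in>final_transitions M.
        (\<lambda>m. (Check j, Pop 1 (Tr e) # Push 2 (Tr e) # m, Back j)) ` move_ops (cells M j) (view j e)) \<union>
     (\<Union>j\<in>{..tapes M}. (\<lambda>e. (Back j, [Pop 2 (Tr e), Push 1 (Tr e)], Back j)) `
        (transitions M \<union> final_transitions M)) \<union>
     (\<lambda>j. (Back j, [Pop 2 Bot, Push 2 Bot], Load (Suc j))) ` {..tapes M} \<union>
     (\<lambda>j. (Load j, [Push 3 Bot, Push 4 Bot], Fill j)) ` {1..tapes M} \<union>
     (\<lambda>j. (Fill j, [Push 3 (Cell (Wk Blank)), Push 4 (Cell (Wk Blank))], Fill j)) ` {1..tapes M} \<union>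
     (\<lambda>j. (Fill j, [], Check j)) ` {1..tapes M}" (is "_ \<subseteq> ?U")
  proof
    fix x assume "x \<in> guarded_rules"
    moreover obtain z ops z' where "x = (z, ops, z')" by (cases x)
    ultimately have "(z, ops, z') \<in> guarded_rules" "x = (z, ops, z')" by simp_all
    then show "x \<in> ?U"
      by cases (simp_all add: image_iff Suc_le_eq del: move_ops.simps view.simps source.simps target.simps)
  qed
  show "finite ?U"
    by (intro finite_UnI finite_imageI finite_UN_I finite_move_ops finite_cells[OF M]
        finite_transitions[OF M] finite_final_transitions[OF M] finite.emptyI finite.insertI
        finite_atMost finite_atLeastAtMost finite_subset[OF subset_UNIV finite_input_symbol])
qed

lemma finite_rule_ops: "finite rule_ops"
  unfolding rule_ops_def using finite_guarded_rules by (rule finite_imageI)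

lemma move_ops_stack: "m \<in> move_ops S v \<Longrightarrow> x \<in> set m \<Longrightarrow> op_stack x < 5"
  by (cases v) (auto split: direction.splits)

lemma guarded_rules_stack: "(z, ops, z') \<in> guarded_rules \<Longrightarrow> x \<in> set ops \<Longrightarrow> op_stack x < 5"
  by (erule guarded_rules.cases) (auto dest: move_ops_stack)

lemma rule_ops_stack: "r \<in> rule_ops \<Longrightarrow> x \<in> set r \<Longrightarrow> op_stack x < 5"
  unfolding rule_ops_def using guarded_rules_stack by fastforce

end

section \<open>Soundness and completeness of the stack program\<close>

text \<open>Every move begins by popping a \<open>Cell\<close>, so a stack with any other top, or
  none, cannot be read as a continuation of the current segment.\<close>

definition protected :: "store_symbol list \<Rightarrow> bool" where
  "protected xs \<longleftrightarrow> (\<forall>y ys. xs \<noteq> Cell y # ys)"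

lemma protected_simps [simp]: "protected []" "protected (Bot # xs)"
  by (auto simp: protected_def)

lemma stack_move_protected:
  assumes "stack_move S v (map Cell l @ x) (map Cell r @ y) L' R'" "protected x" "protected y"
  shows "\<exists>l' r'. tape_move S v (l, r) = Some (l', r') \<and> L' = map Cell l' @ x \<and> R' = map Cell r' @ y"
proof -
  obtain a b d where v: "v = (a, b, d)" by (cases v)
  obtain rr where rr: "map Cell r @ y = Cell a # rr" using assms(1) v by auto
  then obtain r0 where r: "r = a # r0" using assms(3) by (cases r) (auto simp: protected_def)
  show ?thesis
  proof (cases d)
    case MoveL
    then obtain c where c: "c \<in> S" "map Cell l @ x = Cell c # L'" "R' = Cell c # Cell b # map Cell r0 @ y"
      using assms(1) v r by auto
    then obtain l0 where "l = c # l0" using assms(2) by (cases l) (auto simp: protected_def)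
    then show ?thesis using c v r MoveL by auto
  qed (use assms(1) v r in auto)
qed

lemma stack_move_complete:
  assumes "tape_move S v (l, r) = Some (l', r')"
  shows "stack_move S v (map Cell l @ x) (map Cell r @ y) (map Cell l' @ x) (map Cell r' @ y)"
proof -
  obtain a b d where v: "v = (a, b, d)" by (cases v)
  obtain r0 where r: "r = a # r0" using assms v by (cases r) (auto split: if_splits)
  show ?thesis using assms v r by (cases d; cases l) (auto split: if_splits)
qed

text \<open>For a work tape, \<open>n\<close> is the number of blanks guessed in the
  \<open>Fill\<close> phase on each side.\<close>

definition start_segment :: "bool list \<Rightarrow> nat \<Rightarrow> nat \<Rightarrow> cell list \<times> cell list" where
  "start_segment w j n =
     (if j = 0 then ([], input_cells w) else (replicate n (Wk Blank), replicate n (Wk Blank)))"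

lemma tape_rep_start:
  "j \<le> tapes M \<Longrightarrow> tape_rep w j (start_segment w j n) (initial M)"
  by (cases j) (auto simp: start_segment_def initial_def)

text \<open>The input was pushed from left to right, so its right end is on top of stack 3 and
  \<open>Shift\<close> has to turn it over. The \<open>Bot\<close> on stack 2 tells
  \<open>Back\<close> when the transcript is restored.\<close>

definition initial_store :: "bool list \<Rightarrow> store_config" where
  "initial_store w = (Begin, [], [Bot], map Cell (rev (input_cells w)), [])"

context transcript_program
begin

definition transcript :: "transition list \<Rightarrow> bool" where
  "transcript es \<longleftrightarrow> (\<exists>es' ef. es = es' @ [ef] \<and> set es' \<subseteq> transitions M \<and> ef \<in> final_transitions M \<and>
     chain (start M) es' (source ef))"

definition consistent :: "bool list \<Rightarrow> transition list \<Rightarrow> nat \<Rightarrow> bool" where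
  "consistent w es j \<longleftrightarrow> (\<exists>n. tape_moves (cells M j) (map (view j) es) (start_segment w j n) \<noteq> None)"

lemma consistent_transcript_accepts:
  assumes "transcript es" "\<And>j. j \<le> tapes M \<Longrightarrow> consistent w es j"
  shows "w \<in> language M"
proof -
  obtain es' ef where es: "es = es' @ [ef]" "set es' \<subseteq> transitions M" "ef \<in> final_transitions M"
    "chain (start M) es' (source ef)"
    using assms(1) unfolding transcript_def by blast
  obtain n where n: "\<And>j. j \<le> tapes M \<Longrightarrow>
      tape_moves (cells M j) (map (view j) es) (start_segment w j (n j)) \<noteq> None"
    using assms(2) unfolding consistent_def by metis
  show ?thesis
  proof (rule transcript_sound[OF M rtranclp.rtrancl_refl well_formed_initial[OF M] es(2,3)])
    show "chain (fst (initial M)) es' (source ef)" using es(4) by (simp add: initial_def)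
    show "tape_rep w j (start_segment w j (n j)) (initial M) \<and>
        tape_moves (cells M j) (map (view j) (es' @ [ef])) (start_segment w j (n j)) \<noteq> None"
      if "j \<le> tapes M" for j
      using tape_rep_start[OF that] n[OF that] es(1) by simp
  qed
qed

text \<open>\<open>Check\<close> splits the transcript into the checked part \<open>us\<close>,
  lying reversed on stack 2, and the rest. After a check the contents of stacks 3 and 4 are
  forgotten, for the next segment starts above a fresh \<open>Bot\<close>.\<close>

inductive store_inv :: "bool list \<Rightarrow> store_config \<Rightarrow> bool" for w where
  Begin: "store_inv w (initial_store w)"
| Guess: "set es \<subseteq> transitions M \<Longrightarrow> ef \<in> final_transitions M \<Longrightarrow> chain q es (source ef) \<Longrightarrow>
    store_inv w (Guess q, map Tr (es @ [ef]), [Bot], map Cell (rev (input_cells w)), [])"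
| Shift: "transcript es \<Longrightarrow> input_cells w = rev l @ r \<Longrightarrow>
    store_inv w (Shift, map Tr es, [Bot], map Cell l, map Cell r)"
| Check: "transcript (us @ vs) \<Longrightarrow> (\<And>i. i < j \<Longrightarrow> consistent w (us @ vs) i) \<Longrightarrow>
    tape_moves (cells M j) (map (view j) us) (start_segment w j n) = Some (l, r) \<Longrightarrow>
    protected x \<Longrightarrow> protected y \<Longrightarrow>
    store_inv w (Check j, map Tr vs, rev (map Tr us) @ [Bot], map Cell l @ x, map Cell r @ y)"
| Back: "transcript (us @ vs) \<Longrightarrow> (\<And>i. i \<le> j \<Longrightarrow> consistent w (us @ vs) i) \<Longrightarrow>
    store_inv w (Back j, map Tr vs, rev (map Tr us) @ [Bot], L, R)"
| Load: "transcript es \<Longrightarrow> (\<And>i. i < j \<Longrightarrow> consistent w es i) \<Longrightarrow>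
    store_inv w (Load j, map Tr es, [Bot], L, R)"
| Fill: "transcript es \<Longrightarrow> (\<And>i. i < j \<Longrightarrow> consistent w es i) \<Longrightarrow> 0 < j \<Longrightarrow>
    store_inv w (Fill j, map Tr es, [Bot], map Cell (replicate n (Wk Blank)) @ Bot # x,
      map Cell (replicate n (Wk Blank)) @ Bot # y)"

text \<open>\<open>Check\<close> stops at whatever final transition it meets. That this is the last
  entry shows that no part of the transcript escapes the check.\<close>

lemma transcript_final_last:
  assumes "transcript (us @ e # vs)" "e \<in> final_transitions M"
  shows "vs = []"
proof (rule ccontr)
  assume "vs \<noteq> []"
  obtain es' ef where es: "us @ e # vs = es' @ [ef]" "set es' \<subseteq> transitions M"
    using assms(1) unfolding transcript_def by blast
  have "us @ e # butlast vs = es'"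
    using es(1) \<open>vs \<noteq> []\<close> by (metis append_is_Nil_conv butlast.simps(2) butlast_append butlast_snoc list.distinct(1))
  then have "e \<in> transitions M" using es(2) by auto
  then show False using assms(2) transitions_disjoint by blast
qed

lemma store_inv_step:
  assumes "store_inv w c" "store_step c c'"
  shows "store_inv w c'"
  using assms(1)
proof cases
  case Begin
  from assms(2) show ?thesis unfolding Begin initial_store_def
  proof cases
    case (start e)
    then show ?thesis using store_inv.Guess[of "[]" e "source e" w] by simp
  qed
next
  case (Guess es ef q)
  from assms(2) show ?thesis unfolding Guess(1)
  proof cases
    case (guess e)
    then show ?thesis using store_inv.Guess[of "e # es" ef "source e" w] Guess by simp
  next
    case guessed
    have "transcript (es @ [ef])" using Guess guessed unfolding transcript_def by blast
    then show ?thesis using store_inv.Shift[of "es @ [ef]" w "rev (input_cells w)" "[]"] guessed by simp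
  qed
next
  case (Shift es l r)
  from assms(2) show ?thesis unfolding Shift(1)
  proof cases
    case (shift a L)
    then obtain l0 where "l = InS a # l0" "L = map Cell l0" by (cases l) auto
    then show ?thesis using store_inv.Shift[of es w l0 "InS a # r"] Shift shift by simp
  next
    case (shifted L)
    then obtain l0 where l: "l = InS LeftEnd # l0" "L = map Cell l0" by (cases l) auto
    \<comment> \<open>\<open>LeftEnd\<close> occurs only once, so \<open>Shift\<close> ends exactly
      when the whole input lies on stack 4.\<close>
    have "l0 = []"
    proof (rule ccontr)
      assume "l0 \<noteq> []"
      then have "InS LeftEnd \<in> set (tl (input_cells w))"
        using Shift(3) l(1) by (cases "rev l0") auto
      then show False by (auto simp: input_cells_def)
    qed
    then show ?thesis
      using store_inv.Check[of "[]" es 0 w 0 "[]" "InS LeftEnd # r" "[]" "[]"] Shift shifted l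
      by (simp add: start_segment_def)
  qed
next
  case (Check us vs j n l r x y)
  from assms(2) show ?thesis unfolding Check(1)
  proof cases
    case (check e L' R' A)
    then obtain vs' where vs: "vs = e # vs'" "A = map Tr vs'" by (cases vs) auto
    from stack_move_protected[OF check(5) Check(5,6)]
    obtain l' r' where mv: "tape_move (cells M j) (view j e) (l, r) = Some (l', r')"
      "L' = map Cell l' @ x" "R' = map Cell r' @ y" by blast
    then show ?thesis
      using store_inv.Check[of "us @ [e]" vs' j w n l' r' x y] Check check vs
      by (simp add: tape_moves_append)
  next
    case (checked e L' R' A)
    then obtain vs' where vs: "vs = e # vs'" "A = map Tr vs'" by (cases vs) auto
    from stack_move_protected[OF checked(5) Check(5,6)]
    obtain l' r' where mv: "tape_move (cells M j) (view j e) (l, r) = Some (l', r')" by blast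
    have "vs' = []" using transcript_final_last[of us e vs'] Check(2) vs checked(4) by simp
    then have "consistent w (us @ vs) j"
      using mv Check(4) vs(1) unfolding consistent_def
      by (intro exI[of _ n]) (simp add: tape_moves_append)
    then have "consistent w (us @ vs) i" if "i \<le> j" for i
      using Check(3) that by (cases "i = j") auto
    then show ?thesis
      using store_inv.Back[of "us @ [e]" vs' j w L' R'] Check(2) checked vs by simp
  qed
next
  case (Back us vs j L R)
  from assms(2) show ?thesis unfolding Back(1)
  proof cases
    case (unwind e B)
    then obtain us' where "us = us' @ [e]" "B = rev (map Tr us') @ [Bot]"
      by (cases us rule: rev_cases) auto
    then show ?thesis using store_inv.Back[of us' "e # vs" j w L R] Back unwind by simp
  next
    case (unwound B)
    then have "us = []" "B = []" by (cases us rule: rev_cases; simp)+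
    then show ?thesis using store_inv.Load[of vs "Suc j" w L R] Back unwound by simp
  qed
next
  case (Load es j L R)
  from assms(2) show ?thesis unfolding Load(1)
  proof cases
    case load
    then show ?thesis using store_inv.Fill[of es j w 0 L R] Load by simp
  qed
next
  case (Fill es j n x y)
  from assms(2) show ?thesis unfolding Fill(1)
  proof cases
    case fill
    then show ?thesis using store_inv.Fill[of es j w "Suc n" x y] Fill by simp
  next
    case filled
    then show ?thesis
      using store_inv.Check[of "[]" es j w n "replicate n (Wk Blank)" "replicate n (Wk Blank)" "Bot # x" "Bot # y"] Fill
      by (simp add: start_segment_def)
  qed
qed

lemma store_sound:
  assumes "store_step\<^sup>*\<^sup>* (initial_store w) (Load (Suc (tapes M)), A, B, L, R)"
  shows "w \<in> language M"
proof -
  have "store_inv w (Load (Suc (tapes M)), A, B, L, R)"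
    using assms
  proof (induction rule: rtranclp_induct)
    case base
    then show ?case by (rule store_inv.Begin)
  qed (use store_inv_step in blast)
  then show ?thesis
  proof cases
    case Begin
    then show ?thesis by (simp add: initial_store_def)
  next
    case (Load es)
    then show ?thesis using consistent_transcript_accepts by simp
  qed
qed

section \<open>Completeness in linearly many steps\<close>

abbreviation "store_le \<equiv> steps_le store_step"

lemma guess_run:
  assumes "set es \<subseteq> transitions M" "chain q es q'"
  shows "store_le (length es) (Guess q', A, B, L, R) (Guess q, map Tr es @ A, B, L, R)"
  using assms
proof (induction es arbitrary: q)
  case Nil
  then show ?case by (simp add: steps_le_refl)
next
  case (Cons e es)
  have IH: "store_le (length es) (Guess q', A, B, L, R) (Guess (target e), map Tr es @ A, B, L, R)"
    using Cons by simp
  have "store_step (Guess (target e), map Tr es @ A, B, L, R)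
      (Guess (source e), Tr e # map Tr es @ A, B, L, R)"
    using Cons.prems by (intro store_step.guess) simp
  from steps_le_trans[OF IH steps_le_step[of store_step, OF this]] Cons.prems(2)
  show ?case by simp
qed

lemma shift_run:
  assumes "LeftEnd \<notin> set as"
  shows "store_le (length as) (Shift, A, B, map Cell (map InS as) @ L, R)
    (Shift, A, B, L, rev (map Cell (map InS as)) @ R)"
  using assms
proof (induction as arbitrary: R)
  case Nil
  then show ?case by (simp add: steps_le_refl)
next
  case (Cons a as)
  have "store_step (Shift, A, B, Cell (InS a) # map Cell (map InS as) @ L, R)
      (Shift, A, B, map Cell (map InS as) @ L, Cell (InS a) # R)"
    using Cons.prems by (intro store_step.shift) auto
  from steps_le_trans[OF steps_le_step[of store_step, OF this] Cons.IH[of "Cell (InS a) # R"]] Cons.prems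
  show ?case by simp
qed

lemma check_run:
  assumes "j \<le> tapes M" "set us \<subseteq> transitions M"
    and "tape_moves (cells M j) (map (view j) us) (l, r) = Some (l', r')"
  shows "store_le (length us) (Check j, map Tr us @ A, B, map Cell l @ x, map Cell r @ y)
    (Check j, A, rev (map Tr us) @ B, map Cell l' @ x, map Cell r' @ y)"
  using assms
proof (induction us arbitrary: l r B)
  case Nil
  then show ?case by (simp add: steps_le_refl)
next
  case (Cons e us)
  obtain l1 r1 where 1: "tape_move (cells M j) (view j e) (l, r) = Some (l1, r1)"
    "tape_moves (cells M j) (map (view j) us) (l1, r1) = Some (l', r')"
    using Cons.prems(3) by (auto split: Option.bind_splits)
  have "store_step (Check j, Tr e # map Tr us @ A, B, map Cell l @ x, map Cell r @ y)
      (Check j, map Tr us @ A, Tr e # B, map Cell l1 @ x, map Cell r1 @ y)"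
    using Cons.prems by (intro store_step.check stack_move_complete[OF 1(1)]) auto
  from steps_le_trans[OF steps_le_step[of store_step, OF this] Cons.IH[OF Cons.prems(1) _ 1(2), of "Tr e # B"]] Cons.prems
  show ?case by simp
qed

lemma unwind_run:
  assumes "j \<le> tapes M" "set us \<subseteq> transitions M \<union> final_transitions M"
  shows "store_le (length us) (Back j, A, map Tr us @ B, L, R) (Back j, rev (map Tr us) @ A, B, L, R)"
  using assms
proof (induction us arbitrary: A)
  case Nil
  then show ?case by (simp add: steps_le_refl)
next
  case (Cons e us)
  have "store_step (Back j, A, Tr e # map Tr us @ B, L, R) (Back j, Tr e # A, map Tr us @ B, L, R)"
    using Cons.prems by (intro store_step.unwind) auto
  from steps_le_trans[OF steps_le_step[of store_step, OF this] Cons.IH[OF Cons.prems(1), of "Tr e # A"]] Cons.prems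
  show ?case by simp
qed

lemma fill_run:
  assumes "0 < j" "j \<le> tapes M"
  shows "store_le n (Fill j, A, B, L, R)
    (Fill j, A, B, map Cell (replicate n (Wk Blank)) @ L, map Cell (replicate n (Wk Blank)) @ R)"
proof (induction n)
  case 0
  then show ?case by (simp add: steps_le_refl)
next
  case (Suc n)
  from steps_le_trans[OF Suc.IH steps_le_step[of store_step, OF store_step.fill[OF assms]]]
  show ?case by simp
qed

text \<open>The count is \<open>length es\<close> steps forward, one for the final transition,
  \<open>length es + 1\<close> back and one for meeting \<open>Bot\<close>.\<close>

lemma pass_run:
  assumes j: "j \<le> tapes M" and es: "set es \<subseteq> transitions M" "ef \<in> final_transitions M"
    and mv: "tape_moves (cells M j) (map (view j) (es @ [ef])) (l, r) \<noteq> None"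
  shows "\<exists>L R. store_le (2 * length es + 3)
    (Check j, map Tr (es @ [ef]), [Bot], map Cell l @ x, map Cell r @ y)
    (Load (Suc j), map Tr (es @ [ef]), [Bot], L, R)"
proof -
  obtain l1 r1 where 1: "tape_moves (cells M j) (map (view j) es) (l, r) = Some (l1, r1)"
    using mv by (cases "tape_moves (cells M j) (map (view j) es) (l, r)") (auto simp: tape_moves_append)
  obtain l2 r2 where 2: "tape_move (cells M j) (view j ef) (l1, r1) = Some (l2, r2)"
    using mv 1 by (cases "tape_move (cells M j) (view j ef) (l1, r1)") (auto simp: tape_moves_append)
  have A: "store_le (length es) (Check j, map Tr (es @ [ef]), [Bot], map Cell l @ x, map Cell r @ y)
      (Check j, [Tr ef], rev (map Tr es) @ [Bot], map Cell l1 @ x, map Cell r1 @ y)"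
    using check_run[OF j es(1) 1, of "[Tr ef]" "[Bot]"] by simp
  have B: "store_le 1 (Check j, [Tr ef], rev (map Tr es) @ [Bot], map Cell l1 @ x, map Cell r1 @ y)
      (Back j, [], Tr ef # rev (map Tr es) @ [Bot], map Cell l2 @ x, map Cell r2 @ y)"
    by (intro steps_le_step store_step.checked[OF j es(2)] stack_move_complete[OF 2])
  have C: "store_le (length es + 1) (Back j, [], Tr ef # rev (map Tr es) @ [Bot], map Cell l2 @ x, map Cell r2 @ y)
      (Back j, map Tr (es @ [ef]), [Bot], map Cell l2 @ x, map Cell r2 @ y)"
    using unwind_run[OF j, of "ef # rev es" "[]" "[Bot]"] es by (auto simp: rev_map)
  have D: "store_le 1 (Back j, map Tr (es @ [ef]), [Bot], map Cell l2 @ x, map Cell r2 @ y)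
      (Load (Suc j), map Tr (es @ [ef]), [Bot], map Cell l2 @ x, map Cell r2 @ y)"
    by (intro steps_le_step store_step.unwound[OF j])
  have "store_le (length es + (1 + ((length es + 1) + 1)))
    (Check j, map Tr (es @ [ef]), [Bot], map Cell l @ x, map Cell r @ y)
    (Load (Suc j), map Tr (es @ [ef]), [Bot], map Cell l2 @ x, map Cell r2 @ y)"
    by (rule steps_le_trans[OF A steps_le_trans[OF B steps_le_trans[OF C D]]])
  then have "store_le (2 * length es + 3)
    (Check j, map Tr (es @ [ef]), [Bot], map Cell l @ x, map Cell r @ y)
    (Load (Suc j), map Tr (es @ [ef]), [Bot], map Cell l2 @ x, map Cell r2 @ y)"
    by (rule steps_le_mono) simp
  then show ?thesis by blast
qed

text \<open>For a computation of \<open>n\<close> steps, guessing, turning over the input and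
  checking tape 0 cost \<open>3 * n + length w + 7\<close>. Each work tape adds
  \<open>3 * n + 7\<close>: \<open>n + 4\<close> for building its segment and
  \<open>2 * n + 3\<close> for the pass. The stated product is a coarse bound for the sum.\<close>

lemma store_complete:
  assumes "w \<in> language M" and T: "\<And>k c. runs M w k c \<Longrightarrow> k \<le> T"
  shows "\<exists>A B L R. store_le ((8 * tapes M + 12) * (T + length w + 1)) (initial_store w)
    (Load (Suc (tapes M)), A, B, L, R)"
proof -
  obtain cf where cf: "reaches M w cf" "\<nexists>c'. step M w cf c'" "fst cf \<in> accepting M"
    using assms(1) by (auto simp: language_def halts_in_def)
  obtain n where n: "runs M w n cf" using cf(1) by (meson rtranclp_power)
  have nT: "n \<le> T" using T[OF n] .
  obtain es ef where es: "length es = n" "set es \<subseteq> transitions M" "ef \<in> final_transitions M"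
    "chain (fst (initial M)) es (source ef)"
    and mv: "\<And>j z. j \<le> tapes M \<Longrightarrow> tape_rep w j z (initial M) \<Longrightarrow>
       (0 < j \<longrightarrow> Suc n \<le> length (fst z) \<and> Suc (Suc n) \<le> length (snd z)) \<Longrightarrow>
       tape_moves (cells M j) (map (view j) (es @ [ef])) z \<noteq> None"
    using transcript_complete[OF M well_formed_initial[OF M] n cf(2,3)] by blast
  \<comment> \<open>\<open>n + 2\<close> blanks on each side leave room for \<open>n + 1\<close>
    moves and the scanned cell.\<close>
  have moves: "tape_moves (cells M j) (map (view j) (es @ [ef])) (start_segment w j (n + 2)) \<noteq> None"
    if "j \<le> tapes M" for j
    by (rule mv[OF that tape_rep_start[OF that]]) (simp add: start_segment_def)
  let ?E = "map Tr (es @ [ef])"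
  have ch: "chain (start M) es (source ef)" using es(4) by (simp add: initial_def)
  let ?X = "map Cell (rev (input_cells w))"
  have a: "store_le 1 (initial_store w) (Guess (source ef), [Tr ef], [Bot], ?X, [])"
    unfolding initial_store_def by (intro steps_le_step store_step.start es)
  have b: "store_le n (Guess (source ef), [Tr ef], [Bot], ?X, []) (Guess (start M), ?E, [Bot], ?X, [])"
    using guess_run[OF es(2) ch, of "[Tr ef]"] es(1) by simp
  have c: "store_le 1 (Guess (start M), ?E, [Bot], ?X, []) (Shift, ?E, [Bot], ?X, [])"
    by (intro steps_le_step store_step.guessed)
  let ?I = "rev (map In w @ [RightEnd])"
  have X: "?X = map Cell (map InS ?I) @ [Cell (InS LeftEnd)]"
    by (simp add: input_cells_def rev_map)
  have d: "store_le (length w + 1) (Shift, ?E, [Bot], ?X, [])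
      (Shift, ?E, [Bot], [Cell (InS LeftEnd)], map Cell (tl (input_cells w)))"
    using shift_run[of ?I ?E "[Bot]" "[Cell (InS LeftEnd)]" "[]"] unfolding X
    by (auto simp: input_cells_def rev_map)
  have e: "store_le 1 (Shift, ?E, [Bot], [Cell (InS LeftEnd)], map Cell (tl (input_cells w)))
      (Check 0, ?E, [Bot], [], map Cell (input_cells w))"
    using steps_le_step[of store_step, OF store_step.shifted[of ?E "[Bot]" "[]" "map Cell (tl (input_cells w))"]]
    by (simp add: input_cells_def)
  obtain L0 R0 where f: "store_le (2 * n + 3) (Check 0, ?E, [Bot], [], map Cell (input_cells w))
      (Load (Suc 0), ?E, [Bot], L0, R0)"
    using pass_run[OF _ es(2,3), of 0 "[]" "input_cells w" "[]" "[]"] moves[of 0] es(1)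
    by (auto simp: start_segment_def)
  have base: "store_le (1 + (n + (1 + ((length w + 1) + (1 + (2 * n + 3)))))) (initial_store w)
      (Load (Suc 0), ?E, [Bot], L0, R0)"
    by (rule steps_le_trans[OF a steps_le_trans[OF b steps_le_trans[OF c steps_le_trans[OF d steps_le_trans[OF e f]]]]])
  have "\<exists>L R. store_le (3 * n + length w + 7 + m * (3 * n + 7)) (initial_store w)
      (Load (Suc m), ?E, [Bot], L, R)" if "m \<le> tapes M" for m
    using that
  proof (induction m)
    case 0
    have "store_le (3 * n + length w + 7 + 0 * (3 * n + 7)) (initial_store w) (Load (Suc 0), ?E, [Bot], L0, R0)"
      by (rule steps_le_mono[OF base]) simp
    then show ?case by blast
  next
    case (Suc m)
    then obtain L R where IH: "store_le (3 * n + length w + 7 + m * (3 * n + 7)) (initial_store w)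
      (Load (Suc m), ?E, [Bot], L, R)" by auto
    let ?b = "map Cell (replicate (n + 2) (Wk Blank))"
    have j: "0 < Suc m" "Suc m \<le> tapes M" using Suc.prems by auto
    have 1: "store_le 1 (Load (Suc m), ?E, [Bot], L, R) (Fill (Suc m), ?E, [Bot], Bot # L, Bot # R)"
      by (intro steps_le_step store_step.load j)
    note 2 = fill_run[OF j, of "n + 2" ?E "[Bot]" "Bot # L" "Bot # R"]
    have 3: "store_le 1 (Fill (Suc m), ?E, [Bot], ?b @ Bot # L, ?b @ Bot # R)
        (Check (Suc m), ?E, [Bot], ?b @ Bot # L, ?b @ Bot # R)"
      by (intro steps_le_step store_step.filled j)
    obtain L' R' where 4: "store_le (2 * n + 3) (Check (Suc m), ?E, [Bot], ?b @ Bot # L, ?b @ Bot # R)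
        (Load (Suc (Suc m)), ?E, [Bot], L', R')"
      using pass_run[OF j(2) es(2,3), of "replicate (n + 2) (Wk Blank)" "replicate (n + 2) (Wk Blank)" "Bot # L" "Bot # R"]
        moves[OF j(2)] es(1) unfolding start_segment_def by auto
    have "store_le (3 * n + length w + 7 + Suc m * (3 * n + 7)) (initial_store w)
        (Load (Suc (Suc m)), ?E, [Bot], L', R')"
      by (rule steps_le_mono[OF steps_le_trans[OF IH steps_le_trans[OF 1 steps_le_trans[OF 2 steps_le_trans[OF 3 4]]]]])
        simp
    then show ?case by blast
  qed
  from this[of "tapes M"] obtain L R where
    L: "store_le (3 * n + length w + 7 + tapes M * (3 * n + 7)) (initial_store w)
      (Load (Suc (tapes M)), ?E, [Bot], L, R)" by blast
  have "tapes M * (3 * n + 7) \<le> tapes M * (8 * (T + length w + 1))"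
    using nT by (intro mult_le_mono2) simp
  then have "3 * n + length w + 7 + tapes M * (3 * n + 7) \<le> (8 * tapes M + 12) * (T + length w + 1)"
    using nT by (simp add: algebra_simps)
  from steps_le_mono[OF L this] show ?thesis by blast
qed

end

section \<open>Reduction to the universal machine\<close>

lemma time_bound_mono: "time_bound f \<Longrightarrow> a \<le> b \<Longrightarrow> f a \<le> f b"
  unfolding time_bound_def by (metis Suc_eq_plus1 lift_Suc_mono_le)

definition push_input :: "input_symbol \<Rightarrow> token list" where
  "push_input a = ops_tokens [Push 3 (Cell (InS a))]"

text \<open>The code of \<open>Nop\<close> is a single bit, so every greater length is reached
  exactly.\<close>

definition pad_to :: "nat \<Rightarrow> token list \<Rightarrow> token list" where
  "pad_to m v = v @ replicate (m - code_length v) Nop"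

lemma token_code_Nops: "token_code (replicate n Nop) = replicate n False"
  by (induction n) auto

lemma length_padded: "code_length v \<le> m \<Longrightarrow> code_length (pad_to m v) = m"
  by (simp add: pad_to_def token_code_Nops)

lemma token_code_concat: "token_code (concat vs) = concat (map token_code vs)"
  by (induction vs) auto

lemma run_padded: "run_tokens (pad_to m v) ts = run_tokens v ts"
  by (cases "run_tokens v ts") (auto simp: pad_to_def run_tokens_append run_Nops)

lemma plain_padded: "plain_tokens d v \<Longrightarrow> plain_tokens d (pad_to m v)"
  by (auto simp: pad_to_def plain_tokens_def)

lemma run_ops_tokens_Some:
  assumes "represents d ts \<sigma>" "\<And>x. x \<in> set xs \<Longrightarrow> op_stack x < d" "exec_ops xs \<sigma> = Some \<sigma>'"
  shows "\<exists>ts'. run_tokens (ops_tokens xs) ts = Some ts' \<and> represents d ts' \<sigma>'"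
  using run_ops_tokens[of d ts \<sigma> xs, OF assms(1,2)] assms(3) by (cases "run_tokens (ops_tokens xs) ts") auto

lemma run_push_inputs:
  assumes "represents 5 ts (store Z A B L R)"
  shows "\<exists>ts'. run_tokens (concat (map (\<lambda>a. pad_to m (push_input a)) as)) ts = Some ts' \<and>
    represents 5 ts' (store Z A B (rev (map (Cell \<circ> InS) as) @ L) R)"
  using assms
proof (induction as arbitrary: ts L)
  case Nil
  then show ?case by simp
next
  case (Cons a as)
  have "\<exists>ts1. run_tokens (push_input a) ts = Some ts1 \<and> represents 5 ts1 (store Z A B (Cell (InS a) # L) R)"
    unfolding push_input_def by (rule run_ops_tokens_Some[OF Cons.prems]) auto
  then obtain ts1 where ts1: "run_tokens (push_input a) ts = Some ts1"
    "represents 5 ts1 (store Z A B (Cell (InS a) # L) R)" by blast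
  from Cons.IH[OF ts1(2)] show ?case
    by (simp add: run_tokens_append run_padded ts1(1))
qed

text \<open>The padding by \<open>Nop\<close> makes the encoded input long enough for the time bound to cover the
  simulation; it is skipped only once, so the cost of a simulated step does not depend on it.\<close>

lemma universal_reduction:
  assumes tb: "time_bound f" and sh: "superhomogeneous f" and M: "is_NTM M" and time: "runs_in_time_O M f"
    and sound: "\<And>w. w \<in> U \<Longrightarrow>
      \<exists>q i ts. reaches (universal 5) w (q, i, ts) \<and> q \<in> accepting (universal 5)"
    and complete: "\<And>w k q i ts. runs (universal 5) w k (q, i, ts) \<Longrightarrow>
      q \<in> accepting (universal 5) \<Longrightarrow> k \<le> 2 * f (length w) \<Longrightarrow> w \<in> U"
  shows "\<exists>blk m. block_code blk m \<and> (\<forall>x. block_input blk x \<in> U \<longleftrightarrow> x \<in> language M)"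
proof -
  interpret transcript_program M by unfold_locales (rule M)
  obtain c where c: "\<And>w k e. runs M w k e \<Longrightarrow> k \<le> c * f (length w) + c"
    using time unfolding runs_in_time_O_iff[OF tb] by blast
  obtain rules where set_rules: "set rules = rule_ops" using finite_list[OF finite_rule_ops] by blast
  define fin where "fin = [Pop 0 (Load (Suc (tapes M)))]"
  define rtoks where "rtoks = map ops_tokens rules"
  define ftoks where "ftoks = ops_tokens fin"
  define tlen where "tlen = table_length rtoks ftoks"
  \<comment> \<open>\<open>store_complete\<close> bounds the number of rules applied, and each costs
    at most \<open>2 * tlen + 5\<close> steps; the extra 1 pays for the jump to \<open>fin\<close>
    and its execution. So \<open>K * (f n + 1)\<close> covers everything after the loading of the
    input.\<close>
  define K where "K = ((8 * tapes M + 12) * (c + 1) + 1) * (2 * tlen + 5) + 4"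
  \<comment> \<open>The factor 2 is there because \<open>f n + 1 \<le> 2 * f n\<close> for
    \<open>n > 0\<close>.\<close>
  obtain c1 where c1: "\<And>n. n > 0 \<Longrightarrow> (2 * K) * f n \<le> f (c1 * n)"
  proof -
    have "2 * K > 0" by (simp add: K_def)
    then show ?thesis using sh that unfolding superhomogeneous_def by blast
  qed
  \<comment> \<open>The last block loads its own end marker and the two fixed symbols of
    \<open>initial_store\<close> before the table begins.\<close>
  define pre where "pre = ops_tokens [Push 3 (Cell (InS RightEnd)), Push 0 Begin, Push 2 Bot]"
  define last where "last = program pre rtoks ftoks []"
  \<comment> \<open>A block must be able to hold each of the codes. The summand \<open>c1\<close>
    makes the encoded word at least \<open>c1\<close> times as long as the input; the last summand
    settles the empty input, about which superhomogeneity says nothing.\<close>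
  define m where "m = 1 + code_length (push_input LeftEnd) +
    code_length (push_input (In True)) + code_length (push_input (In False)) +
    code_length last + c1 + K * (f 0 + 1)"
  define btoks where "btoks a = pad_to m (if a = RightEnd then last else push_input a)" for a
  define blk where "blk a = token_code (btoks a)" for a
  have len_push: "code_length (push_input a) \<le> m" if "a \<noteq> RightEnd" for a
  proof (cases a)
    case (In b)
    then show ?thesis by (cases b) (auto simp: m_def)
  qed (use that in \<open>auto simp: m_def\<close>)
  have len_last: "code_length last \<le> m" by (simp add: m_def)
  have blk: "block_code blk m"
  proof
    show "length (blk a) = m" for a
      unfolding blk_def btoks_def by (rule length_padded) (use len_push len_last in simp)
    show "m > 0" by (simp add: m_def)
  qed
  have "block_input blk x \<in> U \<longleftrightarrow> x \<in> language M" for x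
  proof -
    define as where "as = LeftEnd # map In x"
    define ini where "ini = concat (map (\<lambda>a. pad_to m (push_input a)) as) @ pre"
    define pad where "pad = replicate (m - code_length last) Nop"
    have as: "RightEnd \<notin> set as" by (auto simp: as_def)
    have "block_input blk x = token_code (concat (map btoks (as @ [RightEnd])))"
      by (simp add: block_input_def token_code_concat as_def blk_def comp_def)
    also have "concat (map btoks (as @ [RightEnd])) = program ini rtoks ftoks pad"
    proof -
      have btoks: "map btoks as = map (\<lambda>a. pad_to m (push_input a)) as"
        using as by (intro map_cong refl) (auto simp: btoks_def)
      have "btoks RightEnd = last @ pad" by (simp add: btoks_def pad_to_def pad_def)
      then show ?thesis
        unfolding map_append btoks by (simp add: ini_def program_def last_def)
    qed
    finally have w: "block_input blk x = token_code (program ini rtoks ftoks pad)" .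
    have plain_push: "plain_tokens 5 (push_input a)" for a
      unfolding push_input_def by (rule plain_ops_tokens) auto
    have plain_pre: "plain_tokens 5 pre"
      unfolding pre_def by (rule plain_ops_tokens) auto
    have "plain_tokens 5 (concat (map (\<lambda>a. pad_to m (push_input a)) bs))" for bs
      by (induction bs) (auto intro: plain_padded plain_push)
    then have plain_ini: "plain_tokens 5 ini"
      using plain_pre by (simp add: ini_def)
    have "pre \<noteq> []" by (simp add: pre_def ops_tokens_def symbol_code_def)
    then have ini_ne: "ini \<noteq> []" by (simp add: ini_def)
    have empty: "represents 5 (empty_tapes 5) (store [] [] [] [] [])"
    proof -
      have "(\<lambda>s. stack_code (store [] [] [] [] [] s)) = (\<lambda>_. [])"
        by (auto simp: store_def stack_code_def)
      then show ?thesis using stack_tapes_empty by (simp add: represents_def)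
    qed
    from run_push_inputs[OF empty, of m as] obtain ts0 where
      ts0: "run_tokens (concat (map (\<lambda>a. pad_to m (push_input a)) as)) (empty_tapes 5) = Some ts0"
        "represents 5 ts0 (store [] [] [] (rev (map (Cell \<circ> InS) as)) [])" by auto
    have "\<exists>ts1. run_tokens pre ts0 = Some ts1 \<and>
        represents 5 ts1 (store [Begin] [] [Bot] (Cell (InS RightEnd) # rev (map (Cell \<circ> InS) as)) [])"
      unfolding pre_def by (rule run_ops_tokens_Some[OF ts0(2)]) auto
    moreover have "store [Begin] [] [Bot] (Cell (InS RightEnd) # rev (map (Cell \<circ> InS) as)) [] =
        store_of (initial_store x)"
      by (simp add: initial_store_def input_cells_def as_def rev_map comp_def)
    ultimately obtain ts1 where ts1: "run_tokens ini (empty_tapes 5) = Some ts1"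
      "represents 5 ts1 (store_of (initial_store x))"
      using ts0(1) by (auto simp: ini_def run_tokens_append)
    interpret stack_program 5 ini rules fin pad ts1 "store_of (initial_store x)"
      by unfold_locales
        (use plain_ini ini_ne ts1 set_rules rule_ops_stack in \<open>auto simp: fin_def pad_def\<close>)
    have prog: "program ini (map ops_tokens rules) (ops_tokens fin) pad = program ini rtoks ftoks pad"
      "table_length (map ops_tokens rules) (ops_tokens fin) = tlen"
      by (simp_all add: rtoks_def ftoks_def tlen_def)
    have fin_iff: "exec_ops fin (store_of e) \<noteq> None \<longleftrightarrow> fst e = Load (Suc (tapes M))" for e
      by (cases e) (auto simp: fin_def)
    have forward: "\<exists>c'. store_step c0 c' \<and> \<sigma> = store_of c'" if "ops_rel rules (store_of c0) \<sigma>" for c0 \<sigma>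
      using that rule_ops_step unfolding ops_rel_def set_rules by blast
    have backward: "ops_rel rules (store_of c0) (store_of c')" if "store_step c0 c'" for c0 c'
      using step_rule_ops[OF that] unfolding ops_rel_def set_rules .
    show ?thesis
    proof
      assume "block_input blk x \<in> U"
      from sound[OF this] obtain \<sigma>2 where \<sigma>2: "(ops_rel rules)\<^sup>*\<^sup>* (store_of (initial_store x)) \<sigma>2"
        "exec_ops fin \<sigma>2 \<noteq> None"
        using stack_program_sound unfolding w prog by blast
      from \<sigma>2(1) have "\<exists>c2. store_step\<^sup>*\<^sup>* (initial_store x) c2 \<and> \<sigma>2 = store_of c2"
      proof (induction rule: rtranclp_induct)
        case base
        then show ?case by blast
      next
        case (step y z)
        then show ?case using forward by (metis rtranclp.rtrancl_into_rtrancl)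
      qed
      then obtain c2 where c2: "store_step\<^sup>*\<^sup>* (initial_store x) c2" "\<sigma>2 = store_of c2" by blast
      then have "fst c2 = Load (Suc (tapes M))" using \<sigma>2(2) fin_iff by simp
      then show "x \<in> language M" using store_sound c2(1) by (cases c2) simp
    next
      assume "x \<in> language M"
      let ?n = "length x"
      obtain A B L R where run: "store_le ((8 * tapes M + 12) * (c * f ?n + c + ?n + 1)) (initial_store x)
          (Load (Suc (tapes M)), A, B, L, R)" (is "store_le _ _ ?e")
        using store_complete[OF \<open>x \<in> language M\<close>, of "c * f ?n + c"] c by blast
      then obtain k where k: "k \<le> (8 * tapes M + 12) * (c * f ?n + c + ?n + 1)"
        "(store_step ^^ k) (initial_store x) ?e" unfolding steps_le_def by blast
      have "\<exists>\<sigma>. (ops_rel rules ^^ k) (store_of (initial_store x)) \<sigma> \<and> \<sigma> = store_of ?e"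
        by (rule relpowp_simulation[where R = "\<lambda>e \<sigma>. \<sigma> = store_of e", OF _ refl k(2)])
          (use backward in blast)
      then have "(ops_rel rules ^^ k) (store_of (initial_store x)) (store_of ?e)" by simp
      moreover have "exec_ops fin (store_of ?e) \<noteq> None" using fin_iff[of ?e] by simp
      ultimately obtain n q i ts where
        acc: "runs (universal 5) (block_input blk x) n (q, i, ts)"
          "q \<in> accepting (universal 5)"
        and n: "n \<le> code_length ini + Suc k * (2 * tlen + 5) + 4"
        using stack_program_complete unfolding w prog by blast
      let ?N = "length (block_input blk x)"
      have N: "?N = m * (?n + 2)" using block_code.length_block_input[OF blk] .
      have ini_N: "code_length ini \<le> ?N" unfolding w by (simp add: program_def)
      have n_f: "?n \<le> f ?n" "?N \<le> f ?N" using tb unfolding time_bound_def by blast+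
      have "k \<le> (8 * tapes M + 12) * ((c + 1) * (f ?n + 1))"
        by (rule order_trans[OF k(1)]) (intro mult_le_mono2, use n_f in \<open>simp add: algebra_simps\<close>)
      then have "Suc k \<le> ((8 * tapes M + 12) * (c + 1) + 1) * (f ?n + 1)"
        by (simp add: algebra_simps)
      from mult_le_mono1[OF this, of "2 * tlen + 5"]
      have "Suc k * (2 * tlen + 5) \<le> (((8 * tapes M + 12) * (c + 1) + 1) * (2 * tlen + 5)) * (f ?n + 1)"
        by (simp only: ac_simps)
      then have "Suc k * (2 * tlen + 5) + 4 \<le>
          (((8 * tapes M + 12) * (c + 1) + 1) * (2 * tlen + 5)) * (f ?n + 1) + 4 * (f ?n + 1)"
        by (rule add_mono) simp
      also have "\<dots> = K * (f ?n + 1)" unfolding K_def by (simp only: distrib_right)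
      also have "\<dots> \<le> f ?N"
      proof (cases "?n = 0")
        case True
        have "K * (f 0 + 1) \<le> m" unfolding m_def by linarith
        then show ?thesis using True N n_f(2) by simp
      next
        case False
        then have "f ?n \<ge> 1" using n_f(1) by linarith
        then have "K * (f ?n + 1) \<le> K * (2 * f ?n)" by (intro mult_le_mono2) simp
        also have "\<dots> \<le> f (c1 * ?n)" using c1[of ?n] False by (simp add: mult.assoc mult.left_commute)
        also have "\<dots> \<le> f ?N"
          unfolding N by (intro time_bound_mono[OF tb] mult_le_mono) (auto simp: m_def)
        finally show ?thesis .
      qed
      \<comment> \<open>Loading costs at most \<open>?N \<le> f ?N\<close> steps, the simulation
        another \<open>f ?N\<close>.\<close>
      finally have "n \<le> 2 * f ?N" using n ini_N n_f(2) by linarith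
      then show "block_input blk x \<in> U" using complete[OF acc] by simp
    qed
  qed
  with blk show ?thesis by blast
qed

text \<open>The number of steps is that of \<open>D\<close> on a word of length
  \<open>m * (n + 2)\<close>, and \<open>n + 2 \<le> 3 * n\<close> for \<open>n \<ge> 1\<close>;
  this is why subhomogeneity is applied with the factor \<open>3 * m\<close>. The empty input
  contributes the constant \<open>f (2 * m)\<close>.\<close>

lemma runs_in_time_pull_back:
  assumes tb: "time_bound f" and sub: "subhomogeneous f" and time: "runs_in_time_O D f"
    and blk: "block_code blk m"
  shows "runs_in_time_O (pull_back D blk m) f"
proof -
  obtain c where c: "\<And>w k e. runs D w k e \<Longrightarrow> k \<le> c * f (length w) + c"
    using time unfolding runs_in_time_O_iff[OF tb] by blast
  have "3 * m > 0" using block_code.m_pos[OF blk] by simp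
  then obtain c' where c': "\<And>n. n > 0 \<Longrightarrow> f (3 * m * n) \<le> c' * f n"
    using sub unfolding subhomogeneous_def by blast
  have bound: "f (m * (n + 2)) \<le> c' * f n + f (2 * m)" for n
  proof (cases "n = 0")
    case False
    then have "m * (n + 2) \<le> m * (3 * n)" by (intro mult_le_mono2) simp
    then have "f (m * (n + 2)) \<le> f (3 * m * n)"
      by (intro time_bound_mono[OF tb]) (simp add: ac_simps)
    then show ?thesis using c'[of n] False by simp
  next
    case True
    have "m * (n + 2) = 2 * m" using True by simp
    then show ?thesis by (simp only: le_add2)
  qed
  show ?thesis
    unfolding runs_in_time_O_iff[OF tb]
  proof (intro exI allI impI)
    fix x k e
    assume "runs (pull_back D blk m) x k e"
    then obtain e' where "runs D (block_input blk x) k e'"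
      using block_code.pull_back_runs[OF blk] by blast
    from c[OF this] have "k \<le> c * f (m * (length x + 2)) + c"
      unfolding block_code.length_block_input[OF blk] .
    also have "\<dots> \<le> c * (c' * f (length x) + f (2 * m)) + c"
      using mult_le_mono2[OF bound] by simp
    also have "\<dots> \<le> (c * c' + c * f (2 * m) + c) * f (length x) + (c * c' + c * f (2 * m) + c)"
      by (simp add: algebra_simps)
    finally show "k \<le> (c * c' + c * f (2 * m) + c) * f (length x) + (c * c' + c * f (2 * m) + c)" .
  qed
qed

theorem theorem1:
  fixes f :: "nat \<Rightarrow> nat"
  assumes "time_bound f"
    and "time_constructible f"
    and "quasihomogeneous f"
    and "\<forall>b. DTIME_b b f \<noteq> DTIME f"
  shows "DTIME f \<noteq> NTIME f"
proof
  assume eq: "DTIME f = NTIME f"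
  obtain U where U: "U \<in> NTIME f"
    and sound: "\<And>w. w \<in> U \<Longrightarrow>
      \<exists>q i ts. reaches (universal 5) w (q, i, ts) \<and> q \<in> accepting (universal 5)"
    and complete: "\<And>w k q i ts. runs (universal 5) w k (q, i, ts) \<Longrightarrow>
      q \<in> accepting (universal 5) \<Longrightarrow> k \<le> 2 * f (length w) \<Longrightarrow> w \<in> U"
    using clocked_universal_language[OF assms(1,2) is_NTM_universal[of 5] universal_dead] by metis
  \<comment> \<open>\<open>U\<close> depends on \<open>f\<close> alone, so \<open>D\<close> and its
    number of tapes are fixed before any machine \<open>M\<close> is considered.\<close>
  obtain D where D: "is_DTM D" "language D = U" "runs_in_time_O D f"
    using U unfolding eq[symmetric] DTIME_def by blast
  have "L \<in> DTIME_b (tapes D) f" if L: "L \<in> DTIME f" for L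
  proof -
    obtain M where M: "is_DTM M" "language M = L" "runs_in_time_O M f"
      using L unfolding DTIME_def by blast
    have N: "is_NTM M" using M(1) by (simp add: is_DTM_def)
    have hom: "superhomogeneous f" "subhomogeneous f"
      using assms(3) by (auto simp: quasihomogeneous_def)
    have "\<exists>blk m. block_code blk m \<and> (\<forall>x. block_input blk x \<in> U \<longleftrightarrow> x \<in> language M)"
      by (rule universal_reduction[OF assms(1) hom(1) N M(3)]) (erule sound, erule (2) complete)
    then obtain blk m where blk: "block_code blk m"
      and red: "\<And>x. block_input blk x \<in> U \<longleftrightarrow> x \<in> language M" by blast
    have "language (pull_back D blk m) = L"
      using block_code.language_pull_back[OF blk, of _ D] red D(2) M(2) by auto
    moreover have "is_DTM (pull_back D blk m)"
      using is_DTM_pull_back[OF D(1)] block_code.m_pos[OF blk] by simp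
    moreover have "runs_in_time_O (pull_back D blk m) f"
      using runs_in_time_pull_back[OF assms(1) hom(2) D(3) blk] .
    ultimately show ?thesis
      unfolding DTIME_b_def by (intro CollectI exI[of _ "pull_back D blk m"]) simp
  qed
  moreover have "DTIME_b (tapes D) f \<subseteq> DTIME f"
    unfolding DTIME_b_def DTIME_def by blast
  ultimately have "DTIME_b (tapes D) f = DTIME f" by blast
  with assms(4) show False by blast
qed

end
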